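(* Define integers $a(n)$ by $\prod_{n\ge1}\frac{1}{1+(-1)^nq^{2n-1}}=\sum_{n\ge0}a(n)q^n$. As $n\to\infty$, $$a(n)\sim \frac{\Gamma\left(\frac14\right)\pi^{\frac14}}{2^{\frac94}3^{\frac38}n^{\frac38}}\,I_{-\frac34}\!\left(\frac\pi2\sqrt{\frac n3}\right)+(-1)^n\frac{\Gamma\left(\frac34\right)\pi^{\frac34}}{2^{\frac{11}4}3^{\frac58}n^{\frac58}}\,I_{-\frac54}\!\left(\frac\pi2\sqrt{\frac n3}\right),$$ and for $n>4800$ the difference between the two sides has absolute value at most $E(n)$.
   Context: $I_\nu$ denotes the modified Bessel function of the first kind, $I_\nu(x)=\left(\frac x2\right)^\nu\sum_{k\ge0}\frac{x^{2k}}{4^kk!\,\Gamma(\nu+k+1)}$. The error function is $$E(n)=\frac{21\pi}{10}\exp\!\left(\left(\frac\pi4+\frac{12}{5\pi}\right)\sqrt{\frac n3}\right)+\left[\frac{4}{n^{7/8}}+\frac5n+\frac{13}{20n^{9/8}}+\frac{21291081}{n^{19/8}}+\frac{17716899}{n^{21/8}}\right]\exp\!\left(\frac\pi2\sqrt{\frac n3}\right).$$ Note that $\prod_{n\ge1}\frac{1}{1+(-1)^nq^{2n-1}}=\prod_{m\ge0}\frac{1}{(1-q^{4m+1})(1+q^{4m+3})}$. *)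

theory Defs
  imports
    "HOL-Computational_Algebra.Formal_Power_Series"
    "HOL-Library.Landau_Symbols"
    "HOL-Analysis.Analysis"
begin

(* For real arguments x > 0. At the poles of Gamma, HOL has Gamma z = 0 and t / 0 = 0, so these
   terms vanish, in agreement with the usual convention 1 / Gamma z = 0. *)
definition besselI :: "real \<Rightarrow> real \<Rightarrow> real" where
  "besselI \<nu> x =
     (x / 2) powr \<nu> * (\<Sum>k. x ^ (2 * k) / (4 ^ k * fact k * Gamma (\<nu> + real k + 1)))"

definition main_term :: "nat \<Rightarrow> real" where
  "main_term n =
     Gamma (1/4) * pi powr (1/4) / (2 powr (9/4) * 3 powr (3/8) * real n powr (3/8))
       * besselI (-3/4) (pi / 2 * sqrt (real n / 3))
     + (-1) ^ n * (Gamma (3/4) * pi powr (3/4) / (2 powr (11/4) * 3 powr (5/8) * real n powr (5/8)))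
       * besselI (-5/4) (pi / 2 * sqrt (real n / 3))"

definition error_fun :: "nat \<Rightarrow> real" where
  "error_fun n =
     21 * pi / 10 * exp ((pi / 4 + 12 / (5 * pi)) * sqrt (real n / 3))
     + (4 / real n powr (7/8) + 5 / real n + 13 / (20 * real n powr (9/8))
        + 21291081 / real n powr (19/8) + 17716899 / real n powr (21/8))
       * exp (pi / 2 * sqrt (real n / 3))"

(* The factor for n = i + 1, as has_prod indexes the factors from 0. *)
definition gf_factor :: "nat \<Rightarrow> real fps" where
  "gf_factor i = (let n = i + 1 in 1 / (1 + (-1) ^ n * fps_X ^ (2 * n - 1)))"

(* The infinite product is taken in the formal power series topology of the library: every
   coefficient of the partial products is eventually constant. *)
definition is_coeff_seq :: "(nat \<Rightarrow> int) \<Rightarrow> bool" where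
  "is_coeff_seq a \<longleftrightarrow> gf_factor has_prod Abs_fps (\<lambda>n. of_int (a n))"

lemma gf_factor_mult: "gf_factor i * (1 + (-1) ^ (i + 1) * fps_X ^ (2 * i + 1)) = 1"
proof -
  have "fps_nth (1 + (-1) ^ (i + 1) * fps_X ^ (2 * i + 1) :: real fps) 0 \<noteq> 0" by simp
  then show ?thesis
    by (simp add: gf_factor_def Let_def fps_divide_unit inverse_mult_eq_1)
qed

lemma gf_factor_nth_0: "fps_nth (gf_factor i) 0 = 1"
  using arg_cong[OF gf_factor_mult[of i], of "\<lambda>f. fps_nth f 0"] by simp

lemma gf_factor_nth_Ints: "fps_nth (gf_factor i) n \<in> \<int>"
proof (induction n rule: less_induct)
  case (less n)
  have "gf_factor i = 1 - gf_factor i * fps_const ((-1) ^ (i + 1)) * fps_X ^ (2 * i + 1)"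
    using gf_factor_mult[of i]
    by (simp add: algebra_simps flip: fps_const_neg fps_const_power)
  then have "fps_nth (gf_factor i) n =
      fps_nth (1 - gf_factor i * fps_const ((-1) ^ (i + 1)) * fps_X ^ (2 * i + 1)) n" by simp
  also have "\<dots> \<in> \<int>"
    unfolding fps_sub_nth fps_X_power_mult_right_nth fps_mult_right_const_nth
    using less by (auto intro!: Ints_diff Ints_mult Ints_power)
  finally show ?case .
qed

lemma gf_factor_subdegree: "subdegree (gf_factor i - 1) = 2 * i + 1"
proof -
  have "gf_factor i - 1 = gf_factor i * fps_const (- ((-1) ^ (i + 1))) * fps_X ^ (2 * i + 1)"
    using gf_factor_mult[of i]
    by (simp add: algebra_simps flip: fps_const_neg fps_const_power)
  moreover have "gf_factor i \<noteq> 0" "subdegree (gf_factor i) = 0"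
    using gf_factor_nth_0[of i] by (auto simp: subdegree_eq_0_iff)
  ultimately show ?thesis by simp
qed

lemma prod_gf_factor_nth_Ints: "fps_nth (\<Prod>i\<in>A. gf_factor i) n \<in> \<int>"
  by (induction A arbitrary: n rule: infinite_finite_induct)
     (auto simp: fps_mult_nth intro!: Ints_sum Ints_mult gf_factor_nth_Ints)

lemma prod_gf_factor_nth_0: "fps_nth (\<Prod>i\<in>A. gf_factor i) 0 = 1"
  by (induction A rule: infinite_finite_induct) (auto simp: gf_factor_nth_0)

lemma is_coeff_seq_ex1: "\<exists>!a. is_coeff_seq a"
proof -
  have "gf_factor k \<noteq> 0" for k using gf_factor_nth_0[of k] by auto
  moreover have "subdegree (gf_factor k - 1) > n" if "k > n" for k n
    using that unfolding gf_factor_subdegree by simp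
  ultimately obtain P where P: "(\<lambda>n. \<Prod>k\<le>n. gf_factor k) \<longlonglongrightarrow> P"
    using tendsto_prod_fps[of gf_factor "\<lambda>n. n"] by blast
  then have ev: "\<forall>\<^sub>F N in sequentially. fps_nth (\<Prod>k\<le>N. gf_factor k) n = fps_nth P n" for n
    by (simp add: tendsto_fps_iff)
  have "fps_nth P n \<in> \<int>" for n
    using eventually_happens[OF ev[of n]] prod_gf_factor_nth_Ints by (metis sequentially_bot)
  then have "fps_nth P n = of_int \<lfloor>fps_nth P n\<rfloor>" for n by (metis Ints_cases floor_of_int)
  then have "P = Abs_fps (\<lambda>n. of_int \<lfloor>fps_nth P n\<rfloor>)" by (simp add: fps_eq_iff)
  moreover have "fps_nth P 0 = 1"
    using eventually_happens[OF ev[of 0]] prod_gf_factor_nth_0 by (metis sequentially_bot)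
  then have "P \<noteq> 0" by auto
  with P have "gf_factor has_prod P"
    by (simp add: has_prod_def raw_has_prod_def)
  ultimately have "is_coeff_seq (\<lambda>n. \<lfloor>fps_nth P n\<rfloor>)" by (simp add: is_coeff_seq_def)
  moreover have "a = b" if "is_coeff_seq a" "is_coeff_seq b" for a b
  proof -
    have "Abs_fps (\<lambda>n. of_int (a n)) = (Abs_fps (\<lambda>n. of_int (b n)) :: real fps)"
      using that has_prod_unique2 unfolding is_coeff_seq_def by blast
    then show ?thesis by (auto simp: fps_eq_iff)
  qed
  ultimately show ?thesis by blast
qed

end

theory Submission
  imports
    Defs
    "HOL-Complex_Analysis.Complex_Analysis"
    "HOL-Probability.Distributions"
    "HOL-Real_Asymp.Real_Asymp"
begin

text \<open>
  On the circle of radius exp (- t) the logarithm of the generating function is Lev + Lod, where Lev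
  and Lod are hyperbolic series over the even and the odd multiples of \<tau> = t + i \<theta>; replacing q by -q
  flips the sign of Lod, so Cauchy's formula becomes an integral over |\<theta>| \<le> \<pi>/2 of
  exp (Lev + Lod) + (-1)^n exp (Lev - Lod). Near \<tau> = 0 one has Lev \<approx> \<pi>^2/(48 \<tau>) - (ln 2)/4 and
  Lod \<approx> - (Ln \<tau>)/4 + const, with explicit O(|\<tau>|) errors from comparing the derivatives with Riemann
  sums; the constant is found from a telescoping product of values of tanh, which produces the
  quotient of the two Gamma values. With the saddle point radius t = \<pi>/(4 sqrt (3 n)) the arc
  |\<theta>| \<le> t gives a Gaussian integral whose value is the leading term of the first Bessel summand. The
  remaining arcs are of size exp (1/(5 t) + n t), which is the first exponential of the error
  function. The second Bessel summand is itself smaller than the admissible error, so only upper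
  bounds are needed near q = -1.
\<close>

subsection \<open>Modified Bessel functions of large argument\<close>

text \<open>The radius minimises \<pi>^2/(48 t) + n t. There both summands equal x/2, where x =
  (\<pi>/2) sqrt (n/3) is the argument of the Bessel functions; hence the recurring relations n t^2
  = \<pi>^2/48 and x = 2 n t. In terms of u = t^(1/4) the leading term has size u^5 exp x, while
  n^(-7/8) is a constant multiple of u^7. A relative error of order sqrt t is therefore allowed, and
  O(|\<tau>|) accuracy in the two logarithms together with the first order of the Bessel function is
  enough. The obstacle lies off the arc: the exponent must stay below 1/(5 t) there, but it is about
  0.2056/t at \<theta> = 0, so taking absolute values term by term all around the circle loses too
  much. Up to |\<theta>| = 5 t/4 the expansion at \<tau> = 0 is still used. In the middle range the
  first term of each series is treated by itself. Within 10 t of \<pi>/2, that is near q = i and q =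
  -i, every term of both series has a nearby pole; summing these poles exactly gives \<pi>^2/96 and
  half of Catalan's constant, and just enough room under 1/(5 t).\<close>

definition bessel_coeff :: "real \<Rightarrow> real \<Rightarrow> nat \<Rightarrow> real" where
  "bessel_coeff \<nu> z k = z ^ k / fact k * rGamma (\<nu> + real k + 1)"

lemma besselI_altdef: "besselI \<nu> x = (x / 2) powr \<nu> * (\<Sum>k. bessel_coeff \<nu> (x\<^sup>2 / 4) k)"
  by (simp add: besselI_def bessel_coeff_def rGamma_inverse_Gamma power_divide divide_simps
        flip: power_mult)

text \<open>Lowering the order is the functional equation of \<open>rGamma\<close>, which is entire,
  so no order has to be excluded; raising the order only reindexes the argument of
  \<open>rGamma\<close>.\<close>

lemma bessel_coeff_rec:
  "bessel_coeff (\<nu> - 1) z k = (\<nu> + real k) * bessel_coeff \<nu> z k"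
  "z * bessel_coeff (\<nu> + 1) z k = real (Suc k) * bessel_coeff \<nu> z (Suc k)"
proof -
  show "bessel_coeff (\<nu> - 1) z k = (\<nu> + real k) * bessel_coeff \<nu> z k"
    using rGamma_plus1[of "\<nu> + real k"] by (simp add: bessel_coeff_def algebra_simps)
  show "z * bessel_coeff (\<nu> + 1) z k = real (Suc k) * bessel_coeff \<nu> z (Suc k)"
    by (simp add: bessel_coeff_def field_simps add_ac del: of_nat_Suc) (simp add: algebra_simps)
qed

lemma summable_bessel_coeff: "summable (bessel_coeff \<nu> z)"
proof -
  have step: "real (Suc k) * (\<nu> + real k + 1) * bessel_coeff \<nu> z (Suc k) = z * bessel_coeff \<nu> z k" for k
  proof -
    have "(\<nu> + real k + 1) * rGamma (\<nu> + real (Suc k) + 1) = rGamma (\<nu> + real k + 1)"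
      using rGamma_plus1[of "\<nu> + real k + 1"] by (simp add: algebra_simps)
    moreover have "real (Suc k) * (\<nu> + real k + 1) * bessel_coeff \<nu> z (Suc k) =
        z * (z ^ k / fact k * ((\<nu> + real k + 1) * rGamma (\<nu> + real (Suc k) + 1)))"
      by (simp add: bessel_coeff_def divide_simps del: of_nat_Suc)
    ultimately show ?thesis by (simp add: bessel_coeff_def)
  qed
  \<comment> \<open>From \<open>N\<close> on, \<nu> + k + 1 is at least 2 |z| + 1, so the ratio of
    consecutive terms is at most 1/2; the summand 1 keeps the divisor positive when z = 0.\<close>
  define N where "N = nat \<lceil>2 * \<bar>z\<bar> + \<bar>\<nu>\<bar> + 1\<rceil>"
  show ?thesis
  proof (rule summable_ratio_test[of "1/2" N])
    fix k assume "N \<le> k"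
    hence k: "2 * \<bar>z\<bar> + \<bar>\<nu>\<bar> + 1 \<le> real k" unfolding N_def by linarith
    have "2 * \<bar>z\<bar> + 1 \<le> real (Suc k) * (\<nu> + real k + 1)"
    proof -
      have "1 * (2 * \<bar>z\<bar> + 1) \<le> real (Suc k) * (\<nu> + real k + 1)"
        using k by (intro mult_mono) auto
      thus ?thesis by simp
    qed
    hence "(2 * \<bar>z\<bar> + 1) * \<bar>bessel_coeff \<nu> z (Suc k)\<bar> \<le> \<bar>z\<bar> * \<bar>bessel_coeff \<nu> z k\<bar>"
    proof -
      have "(2 * \<bar>z\<bar> + 1) * \<bar>bessel_coeff \<nu> z (Suc k)\<bar> \<le> real (Suc k) * (\<nu> + real k + 1) * \<bar>bessel_coeff \<nu> z (Suc k)\<bar>"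
        using \<open>2 * \<bar>z\<bar> + 1 \<le> _\<close> by (intro mult_right_mono) auto
      also have "\<dots> = \<bar>real (Suc k) * (\<nu> + real k + 1) * bessel_coeff \<nu> z (Suc k)\<bar>"
        using k by (simp add: abs_mult)
      also have "\<dots> = \<bar>z\<bar> * \<bar>bessel_coeff \<nu> z k\<bar>" unfolding step by (simp add: abs_mult)
      finally show ?thesis .
    qed
    also have "\<dots> \<le> (2 * \<bar>z\<bar> + 1) * (1/2 * \<bar>bessel_coeff \<nu> z k\<bar>)"
      by (simp add: algebra_simps)
    finally have "\<bar>bessel_coeff \<nu> z (Suc k)\<bar> \<le> 1/2 * \<bar>bessel_coeff \<nu> z k\<bar>"
      by (subst (asm) mult_le_cancel_left_pos) auto
    thus "norm (bessel_coeff \<nu> z (Suc k)) \<le> 1/2 * norm (bessel_coeff \<nu> z k)" by simp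
  qed simp
qed

text \<open>The sum of k times the k-th coefficient is computed twice, by lowering the order and by
  raising it. The recurrence carries the negative orders -3/4 and -5/4 into the range where
  Poisson's integral converges.\<close>

lemma besselI_rec:
  assumes x: "x > 0"
  shows "besselI (\<nu> - 1) x = besselI (\<nu> + 1) x + 2 * \<nu> / x * besselI \<nu> x"
proof -
  define z where "z = x\<^sup>2 / 4"
  let ?c = "bessel_coeff \<nu> z"
  have S: "(\<lambda>k. real k * ?c k) sums ((\<Sum>k. bessel_coeff (\<nu> - 1) z k) - \<nu> * (\<Sum>k. ?c k))"
  proof -
    have "(\<lambda>k. bessel_coeff (\<nu> - 1) z k - \<nu> * ?c k) = (\<lambda>k. real k * ?c k)"
      by (simp add: bessel_coeff_rec algebra_simps)
    thus ?thesis
      using sums_diff[OF summable_sums[OF summable_bessel_coeff[of "\<nu>-1" z]]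
        sums_mult[OF summable_sums[OF summable_bessel_coeff[of \<nu> z]], of \<nu>]] by simp
  qed
  have "(\<lambda>k. real (Suc k) * ?c (Suc k)) sums (z * (\<Sum>k. bessel_coeff (\<nu> + 1) z k))"
    using sums_mult[OF summable_sums[OF summable_bessel_coeff[of "\<nu>+1" z]], of z]
    by (simp add: bessel_coeff_rec del: of_nat_Suc)
  hence "(\<lambda>k. real k * ?c k) sums (z * (\<Sum>k. bessel_coeff (\<nu> + 1) z k))"
    using sums_Suc_iff[of "\<lambda>k. real k * ?c k"] by simp
  from sums_unique2[OF S this]
  have eq: "(\<Sum>k. bessel_coeff (\<nu> - 1) z k) = z * (\<Sum>k. bessel_coeff (\<nu> + 1) z k) + \<nu> * (\<Sum>k. ?c k)"
    by linarith
  have p: "(x / 2) powr (\<nu> - 1) = (x / 2) powr \<nu> * (2 / x)" "(x / 2) powr (\<nu> + 1) = (x / 2) powr \<nu> * (x / 2)"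
    using x by (simp_all add: powr_diff powr_add)
  show ?thesis
    unfolding besselI_altdef z_def[symmetric] p eq using x
    by (simp add: z_def field_simps power2_eq_square)
qed

section \<open>Poisson's integral and its two-sided estimate\<close>

lemma Gamma_plus1_pos: "y > 0 \<Longrightarrow> Gamma (y + 1) = y * Gamma (y :: real)"
  using nonpos_Ints_nonpos[of y] by (intro Gamma_plus1) auto

lemma Gamma_half_nat: "Gamma (real k + 1/2) * (4 ^ k * fact k) = sqrt pi * fact (2 * k)"
proof (induction k)
  case 0 show ?case by (simp add: Gamma_one_half_real)
next
  case (Suc k)
  have "Gamma (real (Suc k) + 1/2) = (real k + 1/2) * Gamma (real k + 1/2)"
    using Gamma_plus1_pos[of "real k + 1/2"] by (simp add: add_ac)
  hence "Gamma (real (Suc k) + 1/2) * (4 ^ Suc k * fact (Suc k)) =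
     (real k + 1/2) * (4 * (real k + 1)) * (Gamma (real k + 1/2) * (4 ^ k * fact k))"
    by simp
  also have "\<dots> = sqrt pi * fact (2 * Suc k)" unfolding Suc.IH by (simp add: field_simps)
  finally show ?case .
qed

text \<open>Substituting y = s^2 turns Euler's Beta integral into this moment.\<close>

lemma nn_integral_even_moment:
  assumes "\<alpha> \<ge> (0::real)"
  shows "(\<integral>\<^sup>+s. ennreal ((1 - s\<^sup>2) powr \<alpha> * s ^ (2 * k)) * indicator {0..1} s \<partial>lborel)
       = ennreal (Beta (real k + 1/2) (\<alpha> + 1) / 2)"
proof -
  define f where "f = (\<lambda>y::real. 1/2 * (y powr (real k + 1/2 - 1) * (1 - y) powr (\<alpha> + 1 - 1)))"
  have [measurable]: "f \<in> borel_measurable borel" unfolding f_def by measurable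
  have B: "(f has_integral (1/2 * Beta (real k + 1/2) (\<alpha> + 1))) {0..1}"
    unfolding f_def using assms by (intro has_integral_mult_right has_integral_Beta_real) auto
  have "ennreal (1/2 * Beta (real k + 1/2) (\<alpha> + 1)) = (\<integral>\<^sup>+y. ennreal (f y) * indicator {0^2..1^2} y \<partial>lborel)"
    using nn_integral_has_integral_lebesgue'[OF _ B] by (simp add: f_def)
  also have "\<dots> = (\<integral>\<^sup>+s. ennreal (f (s^2) * (2 * s) * indicator {0..1} s) \<partial>lborel)"
  proof -
    have D: "((\<lambda>s. s\<^sup>2) has_real_derivative 2 * s) (at s)" for s :: real
      by (auto intro!: derivative_eq_intros)
    show ?thesis using D nn_integral_substitution[where f = f and g = "\<lambda>s. s^2" and a = 0 and b = 1 and g' = "\<lambda>s. 2 * s"]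
      by (simp add: set_borel_measurable_def nn_integral_set_ennreal continuous_intros)
  qed
  also have "\<dots> = (\<integral>\<^sup>+s. ennreal ((1 - s\<^sup>2) powr \<alpha> * s ^ (2 * k)) * indicator {0..1} s \<partial>lborel)"
  proof (rule nn_integral_cong_AE)
    \<comment> \<open>At s = 0 with k = 0 the substituted integrand is 0, because
      \<open>0 powr b = 0\<close>, whereas the moment integrand is 1 there.\<close>
    have "AE s::real in lborel. s \<noteq> 0" by (rule AE_lborel_singleton)
    thus "AE s in lborel. ennreal (f (s^2) * (2 * s) * indicator {0..1} s) =
            ennreal ((1 - s\<^sup>2) powr \<alpha> * s ^ (2 * k)) * indicator {0..1} s"
    proof eventually_elim
      case (elim s)
      show ?case
      proof (cases "s \<in> {0..1}")
        case True
        with elim have s: "s > 0" by auto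
        have "s\<^sup>2 = s powr 2" using s by simp
        hence "(s\<^sup>2) powr (real k + 1/2 - 1) * s = (s powr (2 * real k - 1)) * s"
          by (simp only: powr_powr) (simp add: algebra_simps)
        also have "\<dots> = s powr (2 * real k)" using s by (simp add: powr_diff)
        also have "\<dots> = s ^ (2 * k)" using s powr_realpow[of s "2 * k"] by simp
        finally have "f (s^2) * (2 * s) = (1 - s\<^sup>2) powr \<alpha> * s ^ (2 * k)"
          by (simp add: f_def mult_ac)
        thus ?thesis using True by simp
      qed simp
    qed
  qed
  finally show ?thesis by simp
qed

lemma cosh_sums_even: "(\<lambda>k. x ^ (2 * k) / fact (2 * k)) sums cosh (x::real)"
proof -
  have "(\<lambda>k. (\<lambda>n. if even n then x ^ n /\<^sub>R fact n else 0) (2 * k)) sums cosh x"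
    by (subst sums_mono_reindex) (auto intro!: strict_monoI cosh_converges simp: image_iff elim!: evenE)
  thus ?thesis by (simp add: field_simps)
qed

text \<open>Poisson's integral; the even part of the exponential is used because all terms are nonnegative.\<close>

lemma besselI_Poisson:
  assumes "\<alpha> \<ge> (0::real)" "x > 0"
  shows "(\<integral>\<^sup>+s. ennreal ((1 - s\<^sup>2) powr \<alpha> * (2 * cosh (x * s))) * indicator {0..1} s \<partial>lborel)
       = ennreal (sqrt pi * Gamma (\<alpha> + 1) * (\<Sum>k. bessel_coeff (\<alpha> + 1/2) (x\<^sup>2 / 4) k))"
proof -
  let ?c = "\<lambda>k. bessel_coeff (\<alpha> + 1/2) (x\<^sup>2 / 4) k"
  have cnn: "?c k \<ge> 0" for k
    using assms by (simp add: bessel_coeff_def rGamma_inverse_Gamma Gamma_real_nonneg)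
  have G: "Gamma (\<alpha> + 1) > 0" using assms by (intro Gamma_real_pos) auto
  have term_eq: "x ^ (2 * k) / fact (2 * k) * Beta (real k + 1/2) (\<alpha> + 1) = sqrt pi * Gamma (\<alpha> + 1) * ?c k" for k
  proof -
    have "x ^ (2 * k) / fact (2 * k) * Gamma (real k + 1/2) =
        x ^ (2 * k) / fact (2 * k) * (sqrt pi * fact (2 * k) / (4 ^ k * fact k))"
      using Gamma_half_nat[of k] by (simp add: field_simps)
    also have "\<dots> = sqrt pi * ((x\<^sup>2 / 4) ^ k / fact k)"
      by (simp add: power_divide flip: power_mult)
    finally have e: "x ^ (2 * k) / fact (2 * k) * Gamma (real k + 1/2) = sqrt pi * ((x\<^sup>2 / 4) ^ k / fact k)" .
    have "x ^ (2 * k) / fact (2 * k) * Beta (real k + 1/2) (\<alpha> + 1) =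
        x ^ (2 * k) / fact (2 * k) * Gamma (real k + 1/2) * Gamma (\<alpha> + 1) * rGamma (\<alpha> + 1/2 + real k + 1)"
      unfolding Beta_altdef by (simp add: add_ac)
    thus ?thesis unfolding e by (simp add: bessel_coeff_def)
  qed
  have "(\<integral>\<^sup>+s. ennreal ((1 - s\<^sup>2) powr \<alpha> * (2 * cosh (x * s))) * indicator {0..1} s \<partial>lborel)
     = (\<integral>\<^sup>+s. (\<Sum>k. ennreal (2 * x ^ (2*k) / fact (2*k)) *
           (ennreal ((1 - s\<^sup>2) powr \<alpha> * s ^ (2 * k)) * indicator {0..1} s)) \<partial>lborel)"
  proof (intro nn_integral_cong)
    fix s :: real
    have "(\<lambda>k. ((1 - s\<^sup>2) powr \<alpha> * 2) * ((x * s) ^ (2*k) / fact (2*k))) sums ((1 - s\<^sup>2) powr \<alpha> * 2 * cosh (x * s))"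
      by (intro sums_mult cosh_sums_even)
    hence 1: "(\<lambda>k. 2 * x ^ (2*k) / fact (2*k) * ((1 - s\<^sup>2) powr \<alpha> * s ^ (2*k))) sums ((1 - s\<^sup>2) powr \<alpha> * (2 * cosh (x * s)))"
      by (simp add: power_mult_distrib mult_ac)
    have "ennreal ((1 - s\<^sup>2) powr \<alpha> * (2 * cosh (x * s))) =
       (\<Sum>k. ennreal (2 * x ^ (2*k) / fact (2*k) * ((1 - s\<^sup>2) powr \<alpha> * s ^ (2*k))))"
      using 1 assms by (subst suminf_ennreal_eq) (auto intro!: mult_nonneg_nonneg divide_nonneg_nonneg simp: power_mult)
    also have "\<dots> = (\<Sum>k. ennreal (2 * x ^ (2*k) / fact (2*k)) * ennreal ((1 - s\<^sup>2) powr \<alpha> * s ^ (2*k)))"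
      using assms by (intro suminf_cong, subst ennreal_mult) (auto simp: power_mult)
    finally show "ennreal ((1 - s\<^sup>2) powr \<alpha> * (2 * cosh (x * s))) * indicator {0..1} s = (\<Sum>k. ennreal (2 * x ^ (2*k) / fact (2*k)) *
           (ennreal ((1 - s\<^sup>2) powr \<alpha> * s ^ (2 * k)) * indicator {0..1} s))"
      by (auto split: split_indicator)
  qed
  also have "\<dots> = (\<Sum>k. ennreal (2 * x ^ (2*k) / fact (2*k)) * ennreal (Beta (real k + 1/2) (\<alpha> + 1) / 2))"
    by (subst nn_integral_suminf) (auto simp: nn_integral_cmult nn_integral_even_moment[OF assms(1)])
  also have "\<dots> = (\<Sum>k. ennreal (sqrt pi * Gamma (\<alpha> + 1) * ?c k))"
    using assms by (simp add: ennreal_mult[symmetric] Beta_def Gamma_real_nonneg divide_nonneg_nonneg flip: term_eq)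
  also have "\<dots> = ennreal (sqrt pi * Gamma (\<alpha> + 1) * (\<Sum>k. ?c k))"
    using G cnn by (intro suminf_ennreal_eq sums_mult summable_sums summable_bessel_coeff) auto
  finally show ?thesis .
qed

lemma nn_integral_Gamma_scaled:
  assumes "\<beta> > -1" "x > (0::real)"
  shows "(\<integral>\<^sup>+r. ennreal (r powr \<beta> * exp (- (x * r))) * indicator {0..} r \<partial>lborel) = ennreal (Gamma (\<beta> + 1) * x powr (- \<beta> - 1))"
proof -
  let ?I = "\<integral>\<^sup>+r. ennreal (r powr \<beta> * exp (- (x * r))) * indicator {0..} r \<partial>lborel"
  have "ennreal (Gamma (\<beta> + 1)) = (\<integral>\<^sup>+r. ennreal (indicator {0..} r * r powr (\<beta> + 1 - 1) / exp r) \<partial>lborel)"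
    by (rule Gamma_conv_nn_integral_real) (use assms in simp)
  also have "\<dots> = ennreal \<bar>x\<bar> * (\<integral>\<^sup>+r. ennreal (indicator {0..} (0 + x * r) * (0 + x * r) powr (\<beta> + 1 - 1) / exp (0 + x * r)) \<partial>lborel)"
    by (rule nn_integral_real_affine) (use assms in auto)
  also have "(\<integral>\<^sup>+r. ennreal (indicator {0..} (0 + x * r) * (0 + x * r) powr (\<beta> + 1 - 1) / exp (0 + x * r)) \<partial>lborel)
     = (\<integral>\<^sup>+r. ennreal (x powr \<beta>) * (ennreal (r powr \<beta> * exp (- (x * r))) * indicator {0..} r) \<partial>lborel)"
  proof (rule nn_integral_cong)
    fix r :: real
    show "ennreal (indicator {0..} (0 + x * r) * (0 + x * r) powr (\<beta> + 1 - 1) / exp (0 + x * r)) =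
       ennreal (x powr \<beta>) * (ennreal (r powr \<beta> * exp (- (x * r))) * indicator {0..} r)"
    proof (cases "r \<ge> 0")
      case True
      thus ?thesis using assms by (simp add: powr_mult exp_minus field_simps flip: ennreal_mult)
    next
      case False
      thus ?thesis using assms by (simp add: zero_le_mult_iff)
    qed
  qed
  also have "\<dots> = ennreal (x powr \<beta>) * ?I" by (rule nn_integral_cmult) measurable
  also have "ennreal \<bar>x\<bar> * (ennreal (x powr \<beta>) * ?I) = ennreal (x powr (\<beta> + 1)) * ?I"
  proof -
    have "x * x powr \<beta> = x powr (\<beta> + 1)" using assms by (simp add: powr_add)
    hence "ennreal (x powr (\<beta> + 1)) = ennreal \<bar>x\<bar> * ennreal (x powr \<beta>)"
      using assms by (simp flip: ennreal_mult)
    thus ?thesis by (simp add: mult.assoc)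
  qed
  finally have e: "ennreal (x powr (\<beta> + 1)) * ?I = ennreal (Gamma (\<beta> + 1))" ..
  have "?I = ennreal (x powr (- \<beta> - 1) * x powr (\<beta> + 1)) * ?I"
    using assms by (simp flip: powr_add)
  also have "\<dots> = ennreal (x powr (- \<beta> - 1)) * (ennreal (x powr (\<beta> + 1)) * ?I)"
    by (simp add: ennreal_mult mult.assoc)
  also have "\<dots> = ennreal (Gamma (\<beta> + 1) * x powr (- \<beta> - 1))"
    unfolding e using assms by (simp add: Gamma_real_nonneg mult.commute flip: ennreal_mult)
  finally show ?thesis .
qed

text \<open>The two exponentials of 2 cosh are moved by r = 1 - s and r = 1 + s onto the two halves
  of [0, 2]. The factor exp x comes out and the remaining mass concentrates at r = 0, as Watson's
  lemma requires.\<close>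

lemma Poisson_integral_shifted:
  assumes "\<alpha> \<ge> (0::real)"
  shows "(\<integral>\<^sup>+s. ennreal ((1 - s\<^sup>2) powr \<alpha> * (2 * cosh (x * s))) * indicator {0..1} s \<partial>lborel)
       = (\<integral>\<^sup>+r. ennreal (exp x * ((r * (2 - r)) powr \<alpha> * exp (- (x * r)))) * indicator {0..2} r \<partial>lborel)"
proof -
  let ?f = "\<lambda>r. exp x * ((r * (2 - r)) powr \<alpha> * exp (- (x * r)))"
  have 1: "(\<integral>\<^sup>+s. ennreal ((1 - s\<^sup>2) powr \<alpha> * exp (x * s)) * indicator {0..1} s \<partial>lborel)
      = (\<integral>\<^sup>+r. ennreal (?f r) * indicator {0..1} r \<partial>lborel)"
    by (subst nn_integral_real_affine[where t = 1 and c = "-1"])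
       (auto intro!: nn_integral_cong split: split_indicator simp: algebra_simps power2_eq_square simp flip: exp_add)
  have 2: "(\<integral>\<^sup>+s. ennreal ((1 - s\<^sup>2) powr \<alpha> * exp (- (x * s))) * indicator {0..1} s \<partial>lborel)
      = (\<integral>\<^sup>+r. ennreal (?f r) * indicator {1..2} r \<partial>lborel)"
    by (subst nn_integral_real_affine[where t = "-1" and c = "1"])
       (auto intro!: nn_integral_cong split: split_indicator simp: algebra_simps power2_eq_square simp flip: exp_add)
  have "(\<integral>\<^sup>+s. ennreal ((1 - s\<^sup>2) powr \<alpha> * (2 * cosh (x * s))) * indicator {0..1} s \<partial>lborel)
     = (\<integral>\<^sup>+s. ennreal ((1 - s\<^sup>2) powr \<alpha> * exp (x * s)) * indicator {0..1} s +
            ennreal ((1 - s\<^sup>2) powr \<alpha> * exp (- (x * s))) * indicator {0..1} s \<partial>lborel)"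
    by (intro nn_integral_cong) (auto split: split_indicator simp: cosh_def algebra_simps simp flip: ennreal_plus)
  also have "\<dots> = (\<integral>\<^sup>+r. ennreal (?f r) * indicator {0..1} r + ennreal (?f r) * indicator {1..2} r \<partial>lborel)"
    by (subst (1 2) nn_integral_add) (auto simp: 1 2)
  also have "\<dots> = (\<integral>\<^sup>+r. ennreal (?f r) * indicator {0..2} r \<partial>lborel)"
  proof (rule nn_integral_cong_AE)
    \<comment> \<open>The two halves overlap in the point 1.\<close>
    have "AE s::real in lborel. s \<noteq> 1" by (rule AE_lborel_singleton)
    thus "AE r in lborel. ennreal (?f r) * indicator {0..1} r + ennreal (?f r) * indicator {1..2} r
        = ennreal (?f r) * indicator {0..2} r"
      by eventually_elim (auto split: split_indicator)
  qed
  finally show ?thesis .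
qed

text \<open>Watson's lemma as an inequality: 2 - r is replaced by 2 and the range of integration is
  extended to the half-line.\<close>

lemma Poisson_integral_upper:
  assumes "\<alpha> \<ge> (0::real)" "x > 0"
  shows "sqrt pi * Gamma (\<alpha> + 1) * (\<Sum>k. bessel_coeff (\<alpha> + 1/2) (x\<^sup>2 / 4) k)
      \<le> exp x * 2 powr \<alpha> * Gamma (\<alpha> + 1) * x powr (- \<alpha> - 1)"
proof -
  have "ennreal (sqrt pi * Gamma (\<alpha> + 1) * (\<Sum>k. bessel_coeff (\<alpha> + 1/2) (x\<^sup>2 / 4) k))
     = (\<integral>\<^sup>+r. ennreal (exp x * ((r * (2 - r)) powr \<alpha> * exp (- (x * r)))) * indicator {0..2} r \<partial>lborel)"
    using besselI_Poisson[OF assms] Poisson_integral_shifted[OF assms(1)] by simp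
  also have "\<dots> \<le> (\<integral>\<^sup>+r. ennreal (exp x * 2 powr \<alpha>) * (ennreal (r powr \<alpha> * exp (- (x * r))) * indicator {0..} r) \<partial>lborel)"
  proof (rule nn_integral_mono)
    fix r :: real
    show "ennreal (exp x * ((r * (2 - r)) powr \<alpha> * exp (- (x * r)))) * indicator {0..2} r
      \<le> ennreal (exp x * 2 powr \<alpha>) * (ennreal (r powr \<alpha> * exp (- (x * r))) * indicator {0..} r)"
    proof (cases "r \<in> {0..2}")
      case True
      hence "(r * (2 - r)) powr \<alpha> \<le> (r * 2) powr \<alpha>" using assms
        by (intro powr_mono2) (auto intro!: mult_left_mono)
      also have "\<dots> = r powr \<alpha> * 2 powr \<alpha>" using True by (simp add: powr_mult)
      finally show ?thesis using True by (auto simp: mult_ac intro!: ennreal_leI mult_left_mono simp flip: ennreal_mult)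
    qed auto
  qed
  also have "\<dots> = ennreal (exp x * 2 powr \<alpha>) * ennreal (Gamma (\<alpha> + 1) * x powr (- \<alpha> - 1))"
    using assms by (subst nn_integral_cmult) (simp_all add: nn_integral_Gamma_scaled)
  also have "\<dots> = ennreal (exp x * 2 powr \<alpha> * Gamma (\<alpha> + 1) * x powr (- \<alpha> - 1))"
    using assms by (simp add: Gamma_real_nonneg mult_ac flip: ennreal_mult)
  finally show ?thesis using assms by (subst (asm) ennreal_le_iff) (auto simp: Gamma_real_nonneg)
qed

text \<open>For exponents in [0, 1] one has (1 - r/2)^\<alpha> >= 1 - r/2 on [0, 2], so the loss
  against the full Gamma integral is at most r/2 times its integrand. Beyond r = 2 the same
  correction already exceeds the whole integrand.\<close>

lemma Poisson_integral_lower: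
  assumes "\<alpha> \<ge> (0::real)" "\<alpha> \<le> 1" "x > 0"
  shows "exp x * 2 powr \<alpha> * (Gamma (\<alpha> + 1) * x powr (- \<alpha> - 1)) \<le>
    sqrt pi * Gamma (\<alpha> + 1) * (\<Sum>k. bessel_coeff (\<alpha> + 1/2) (x\<^sup>2 / 4) k)
      + exp x * 2 powr \<alpha> * (Gamma (\<alpha> + 2) * x powr (- \<alpha> - 2) / 2)"
proof -
  let ?E = "exp x * 2 powr \<alpha>"
  have "ennreal (?E * (Gamma (\<alpha> + 1) * x powr (- \<alpha> - 1))) =
     (\<integral>\<^sup>+r. ennreal ?E * (ennreal (r powr \<alpha> * exp (- (x * r))) * indicator {0..} r) \<partial>lborel)"
    using assms by (subst nn_integral_cmult)
      (simp_all add: nn_integral_Gamma_scaled Gamma_real_nonneg flip: ennreal_mult)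
  also have "\<dots> \<le> (\<integral>\<^sup>+r. ennreal (exp x * ((r * (2 - r)) powr \<alpha> * exp (- (x * r)))) * indicator {0..2} r
       + ennreal (?E / 2) * (ennreal (r powr (\<alpha> + 1) * exp (- (x * r))) * indicator {0..} r) \<partial>lborel)"
  proof (rule nn_integral_mono)
    fix r :: real
    show "ennreal ?E * (ennreal (r powr \<alpha> * exp (- (x * r))) * indicator {0..} r) \<le>
       ennreal (exp x * ((r * (2 - r)) powr \<alpha> * exp (- (x * r)))) * indicator {0..2} r
       + ennreal (?E / 2) * (ennreal (r powr (\<alpha> + 1) * exp (- (x * r))) * indicator {0..} r)"
    proof (cases "r > 0")
      case True
      have r1: "r powr (\<alpha> + 1) = r powr \<alpha> * r" using True by (simp add: powr_add)
      show ?thesis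
      proof (cases "r \<le> 2")
        case r2: True
        have "(1 - r / 2) powr 1 \<le> (1 - r / 2) powr \<alpha>" using True r2 assms
          by (intro powr_mono') auto
        hence "1 \<le> (1 - r / 2) powr \<alpha> + r / 2" using r2 by simp
        hence "2 powr \<alpha> * r powr \<alpha> * 1 \<le> 2 powr \<alpha> * r powr \<alpha> * ((1 - r / 2) powr \<alpha> + r / 2)"
          by (intro mult_left_mono) auto
        also have "\<dots> = (r * (2 * (1 - r / 2))) powr \<alpha> + 2 powr \<alpha> / 2 * (r powr \<alpha> * r)"
        proof -
          have "(r * (2 * (1 - r / 2))) powr \<alpha> = r powr \<alpha> * (2 powr \<alpha> * (1 - r / 2) powr \<alpha>)"
            using True r2 by (simp only: powr_mult)
          thus ?thesis by (simp only:) (simp add: algebra_simps)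
        qed
        finally have "2 powr \<alpha> * r powr \<alpha> \<le> (r * (2 - r)) powr \<alpha> + 2 powr \<alpha> / 2 * (r powr \<alpha> * r)"
          by (simp add: algebra_simps)
        hence "exp x * exp (- (x * r)) * (2 powr \<alpha> * r powr \<alpha>) \<le>
           exp x * exp (- (x * r)) * ((r * (2 - r)) powr \<alpha> + 2 powr \<alpha> / 2 * (r powr \<alpha> * r))"
          by (intro mult_left_mono) auto
        thus ?thesis using True r2 unfolding r1
          by (auto simp: algebra_simps intro!: ennreal_leI simp flip: ennreal_mult ennreal_plus)
      next
        case r2: False
        have "?E * (r powr \<alpha> * exp (- (x * r))) * 1 \<le> ?E * (r powr \<alpha> * exp (- (x * r))) * (r / 2)"
          using r2 by (intro mult_left_mono) auto
        thus ?thesis using True r2 unfolding r1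
          by (auto simp: algebra_simps intro!: ennreal_leI simp flip: ennreal_mult ennreal_plus)
      qed
    qed (auto split: split_indicator)
  qed
  also have "\<dots> = ennreal (sqrt pi * Gamma (\<alpha> + 1) * (\<Sum>k. bessel_coeff (\<alpha> + 1/2) (x\<^sup>2 / 4) k))
      + ennreal (?E / 2) * ennreal (Gamma (\<alpha> + 1 + 1) * x powr (- (\<alpha> + 1) - 1))"
    using assms besselI_Poisson[of \<alpha> x] Poisson_integral_shifted[of \<alpha> x]
    by (subst nn_integral_add)
       (simp_all add: nn_integral_cmult nn_integral_Gamma_scaled)
  also have "\<dots> = ennreal (sqrt pi * Gamma (\<alpha> + 1) * (\<Sum>k. bessel_coeff (\<alpha> + 1/2) (x\<^sup>2 / 4) k)
      + exp x * 2 powr \<alpha> * (Gamma (\<alpha> + 2) * x powr (- \<alpha> - 2) / 2))"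
  proof -
    have "0 \<le> (\<Sum>k. bessel_coeff (\<alpha> + 1/2) (x\<^sup>2 / 4) k)"
      using assms by (intro suminf_nonneg summable_bessel_coeff)
        (simp add: bessel_coeff_def rGamma_inverse_Gamma Gamma_real_nonneg)
    moreover have "Gamma (\<alpha> + 1 + 1) = Gamma (\<alpha> + 2)" "- (\<alpha> + 1) - 1 = - \<alpha> - 2" by (simp_all add: add_ac)
    ultimately show ?thesis using assms
      by (simp only:) (simp add: Gamma_real_nonneg mult_ac flip: ennreal_mult ennreal_plus)
  qed
  finally show ?thesis
  proof (subst (asm) ennreal_le_iff)
    have "0 \<le> (\<Sum>k. bessel_coeff (\<alpha> + 1/2) (x\<^sup>2 / 4) k)"
      using assms by (intro suminf_nonneg summable_bessel_coeff)
        (simp add: bessel_coeff_def rGamma_inverse_Gamma Gamma_real_nonneg)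
    thus "0 \<le> sqrt pi * Gamma (\<alpha> + 1) * (\<Sum>k. bessel_coeff (\<alpha> + 1/2) (x\<^sup>2 / 4) k)
      + exp x * 2 powr \<alpha> * (Gamma (\<alpha> + 2) * x powr (- \<alpha> - 2) / 2)"
      using assms by (simp add: Gamma_real_nonneg)
  qed
qed

section \<open>Bounds for the orders at least 1/2 and the passage to the two negative orders\<close>

lemma besselI_nonneg: "\<nu> \<ge> 0 \<Longrightarrow> 0 \<le> besselI \<nu> x"
  unfolding besselI_altdef
  by (intro mult_nonneg_nonneg suminf_nonneg summable_bessel_coeff)
     (auto simp add: bessel_coeff_def rGamma_inverse_Gamma Gamma_real_nonneg)

text \<open>Separates the classical leading term from the quotient of Poisson's integral by its
  Watson approximation; this quotient is what the two estimates above control.\<close>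

lemma besselI_eq_Poisson:
  assumes "\<nu> \<ge> 1/2" "x > 0"
  shows "besselI \<nu> x = exp x / sqrt (2 * pi * x) * (sqrt pi * Gamma (\<nu> + 1/2) * (\<Sum>k. bessel_coeff \<nu> (x\<^sup>2 / 4) k)
            / (exp x * 2 powr (\<nu> - 1/2) * (Gamma (\<nu> + 1/2) * x powr (- \<nu> - 1/2))))"
proof -
  have G: "Gamma (\<nu> + 1/2) > 0" using assms by (intro Gamma_real_pos) auto
  have "exp x / sqrt (2 * pi * x) * (sqrt pi * g * S
            / (exp x * 2 powr (\<nu> - 1/2) * (g * x powr (- \<nu> - 1/2)))) = (x / 2) powr \<nu> * S" if "g > 0" for S g
  proof -
    have "x powr (- \<nu> - 1/2) = 1 / (x powr \<nu> * sqrt x)"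
    proof -
      have "- \<nu> - 1/2 = - (\<nu> + 1/2)" by simp
      thus ?thesis using assms
        by (simp only: powr_minus powr_add powr_half_sqrt) (simp add: field_simps)
    qed
    moreover have "2 powr (\<nu> - 1/2) = 2 powr \<nu> / sqrt 2" by (simp add: powr_diff powr_half_sqrt)
    ultimately show ?thesis using assms that
      by (simp add: real_sqrt_mult powr_divide)
  qed
  from this[OF G] show ?thesis by (simp add: besselI_altdef)
qed

lemma besselI_le:
  assumes "\<nu> \<ge> 1/2" "x > 0"
  shows "besselI \<nu> x \<le> exp x / sqrt (2 * pi * x)"
proof -
  have G: "Gamma (\<nu> + 1/2) > 0" using assms by (intro Gamma_real_pos) auto
  have "sqrt pi * Gamma (\<nu> + 1/2) * (\<Sum>k. bessel_coeff \<nu> (x\<^sup>2 / 4) k) \<le>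
     exp x * 2 powr (\<nu> - 1/2) * (Gamma (\<nu> + 1/2) * x powr (- \<nu> - 1/2))"
    using Poisson_integral_upper[of "\<nu> - 1/2" x] assms by (simp add: algebra_simps)
  hence "exp x / sqrt (2 * pi * x) * (sqrt pi * Gamma (\<nu> + 1/2) * (\<Sum>k. bessel_coeff \<nu> (x\<^sup>2 / 4) k)
            / (exp x * 2 powr (\<nu> - 1/2) * (Gamma (\<nu> + 1/2) * x powr (- \<nu> - 1/2)))) \<le> exp x / sqrt (2 * pi * x) * 1"
    using assms G by (intro mult_left_mono) (auto simp: divide_le_eq)
  thus ?thesis using besselI_eq_Poisson[OF assms] by simp
qed

lemma besselI_ge:
  assumes "\<nu> \<ge> 1/2" "\<nu> \<le> 3/2" "x > 0"
  shows "besselI \<nu> x \<ge> exp x / sqrt (2 * pi * x) * (1 - (\<nu> + 1/2) / (2 * x))"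
proof -
  have G: "Gamma (\<nu> + 1/2) > 0" using assms by (intro Gamma_real_pos) auto
  let ?M = "exp x * 2 powr (\<nu> - 1/2) * (Gamma (\<nu> + 1/2) * x powr (- \<nu> - 1/2))"
  have M: "?M > 0" using G assms by simp
  have "Gamma (\<nu> + 3/2) * x powr (- \<nu> - 3/2) = (\<nu> + 1/2) / x * (Gamma (\<nu> + 1/2) * x powr (- \<nu> - 1/2))"
  proof -
    have "Gamma (\<nu> + 3/2) = (\<nu> + 1/2) * Gamma (\<nu> + 1/2)"
      using Gamma_plus1_pos[of "\<nu> + 1/2"] assms by (simp add: add_ac)
    moreover have "x powr (- \<nu> - 3/2) = x powr (- \<nu> - 1/2) / x"
    proof -
      have "- \<nu> - 3/2 = (- \<nu> - 1/2) - 1" by simp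
      thus ?thesis using assms powr_diff[of x "- \<nu> - 1/2" 1] by (simp only: powr_one)
    qed
    ultimately show ?thesis by simp
  qed
  hence "?M * (1 - (\<nu> + 1/2) / (2 * x)) \<le> sqrt pi * Gamma (\<nu> + 1/2) * (\<Sum>k. bessel_coeff \<nu> (x\<^sup>2 / 4) k)"
    using Poisson_integral_lower[of "\<nu> - 1/2" x] assms by (simp add: algebra_simps)
  hence "1 - (\<nu> + 1/2) / (2 * x) \<le> sqrt pi * Gamma (\<nu> + 1/2) * (\<Sum>k. bessel_coeff \<nu> (x\<^sup>2 / 4) k) / ?M"
    using M by (subst pos_le_divide_eq) (auto simp: mult.commute)
  hence "exp x / sqrt (2 * pi * x) * (1 - (\<nu> + 1/2) / (2 * x)) \<le>
     exp x / sqrt (2 * pi * x) * (sqrt pi * Gamma (\<nu> + 1/2) * (\<Sum>k. bessel_coeff \<nu> (x\<^sup>2 / 4) k) / ?M)"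
    using assms by (intro mult_left_mono) auto
  thus ?thesis using besselI_eq_Poisson[OF assms(1,3)] by simp
qed

text \<open>One step of the recurrence leaves order 1/4, still too small for the estimates, so a
  second step is taken; orders 5/4 and 9/4 remain. Since x >= 1, the correction is at most 7/2
  leading terms times 1/(2 x), which gives 7/(4 x). The lower bound for order 5/4 costs only 7/(8
  x).\<close>

lemma besselI_minus_three_quarters:
  assumes "x \<ge> 1"
  shows "\<bar>besselI (-3/4) x - exp x / sqrt (2 * pi * x)\<bar> \<le> exp x / sqrt (2 * pi * x) * (7 / (4 * x))"
proof -
  have x: "x > 0" using assms by simp
  let ?E = "exp x / sqrt (2 * pi * x)"
  have "besselI (-3/4) x = besselI (5/4) x + 1 / (2 * x) * besselI (1/4) x"
    using besselI_rec[OF x, of "1/4"] by simp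
  also have "besselI (1/4) x = besselI (9/4) x + 5 / (2 * x) * besselI (5/4) x"
    using besselI_rec[OF x, of "5/4"] by simp
  finally have e: "besselI (-3/4) x = besselI (5/4) x + 1 / (2 * x) * (besselI (9/4) x + 5 / (2 * x) * besselI (5/4) x)" .
  have "5 / (2 * x) \<le> 5 / 2" using assms by (simp add: field_simps)
  hence "5 / (2 * x) * besselI (5/4) x \<le> 5 / 2 * ?E"
    using assms besselI_le[of "5/4" x] by (intro mult_mono) (auto simp: besselI_nonneg)
  hence "besselI (9/4) x + 5 / (2 * x) * besselI (5/4) x \<le> 7/2 * ?E"
    using besselI_le[of "9/4" x] x by simp
  hence "1 / (2 * x) * (besselI (9/4) x + 5 / (2 * x) * besselI (5/4) x) \<le> 1 / (2 * x) * (7/2 * ?E)"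
    using x by (intro mult_left_mono) auto
  moreover have "0 \<le> 1 / (2 * x) * (besselI (9/4) x + 5 / (2 * x) * besselI (5/4) x)"
    using x by (auto simp: besselI_nonneg)
  moreover have "besselI (5/4) x \<le> ?E" using besselI_le[of "5/4" x] x by simp
  moreover have "?E * (1 - 7 / (8 * x)) \<le> besselI (5/4) x" using besselI_ge[of "5/4" x] x by (simp add: field_simps)
  moreover have "?E * (1 - 7 / (8 * x)) \<ge> ?E - ?E * (7 / (4 * x))"
    using x by (simp add: field_simps)
  ultimately show ?thesis unfolding e by (auto simp: abs_le_iff field_simps)
qed

lemma besselI_minus_five_quarters:
  assumes "x \<ge> 1"
  shows "\<bar>besselI (-5/4) x\<bar> \<le> exp x / sqrt (2 * pi * x) * (1 + 5 / (4 * x))"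
proof -
  have x: "x > 0" using assms by simp
  let ?E = "exp x / sqrt (2 * pi * x)"
  have "besselI (-5/4) x = besselI (3/4) x - 1 / (2 * x) * besselI (-1/4) x"
    using besselI_rec[OF x, of "-1/4"] by simp
  also have "besselI (-1/4) x = besselI (7/4) x + 3 / (2 * x) * besselI (3/4) x"
    using besselI_rec[OF x, of "3/4"] by simp
  finally have e: "besselI (-5/4) x = besselI (3/4) x - 1 / (2 * x) * (besselI (7/4) x + 3 / (2 * x) * besselI (3/4) x)" .
  have "3 / (2 * x) \<le> 3 / 2" using assms by (simp add: field_simps)
  hence "3 / (2 * x) * besselI (3/4) x \<le> 3 / 2 * ?E"
    using assms besselI_le[of "3/4" x] by (intro mult_mono) (auto simp: besselI_nonneg)
  hence "besselI (7/4) x + 3 / (2 * x) * besselI (3/4) x \<le> 5/2 * ?E"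
    using besselI_le[of "7/4" x] x by simp
  hence "1 / (2 * x) * (besselI (7/4) x + 3 / (2 * x) * besselI (3/4) x) \<le> 1 / (2 * x) * (5/2 * ?E)"
    using x by (intro mult_left_mono) auto
  moreover have "0 \<le> 1 / (2 * x) * (besselI (7/4) x + 3 / (2 * x) * besselI (3/4) x)"
    using x by (auto simp: besselI_nonneg)
  moreover have "besselI (3/4) x \<le> ?E" "0 \<le> besselI (3/4) x" using besselI_le[of "3/4" x] x by (auto simp: besselI_nonneg)
  moreover have "0 \<le> ?E" using x by simp
  ultimately show ?thesis unfolding e by (auto simp: abs_le_iff algebra_simps)
qed

subsection \<open>Telescoping with the arctangent\<close>

lemma arctan_step:
  assumes "h > 0" "y \<ge> (0::real)"
  shows "h / (1 + (y + h)\<^sup>2) \<le> arctan (y + h) - arctan y"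
proof -
  obtain z where z: "y < z" "z < y + h" "arctan (y + h) - arctan y = (y + h - y) * (inverse (1 + z\<^sup>2))"
    using MVT2[of y "y + h" arctan "\<lambda>x. inverse (1 + x\<^sup>2)"] assms by (auto intro: DERIV_arctan)
  have "z\<^sup>2 \<le> (y + h)\<^sup>2" using z assms by (intro power_mono) auto
  hence "h / (1 + (y + h)\<^sup>2) \<le> h / (1 + z\<^sup>2)" using assms
    by (intro divide_left_mono mult_pos_pos) (auto simp: add_pos_nonneg)
  thus ?thesis using z by (simp add: field_simps)
qed

lemma arctan_partial_sum:
  assumes "h > 0"
  shows "(\<Sum>k<n. h / (1 + (real (Suc k) * h)\<^sup>2)) \<le> arctan (real n * h)"
proof (induction n)
  case (Suc n)
  have "h / (1 + (real n * h + h)\<^sup>2) \<le> arctan (real n * h + h) - arctan (real n * h)"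
    using assms by (intro arctan_step) auto
  thus ?case using Suc by (simp add: algebra_simps)
qed simp

text \<open>The majorant is a lower Riemann sum of 1/(1 + y^2) with mesh h, so its sum is at most
  \<pi>/2 for every h. This uniformity makes the later error constants independent of
  \<tau>.\<close>

lemma norm_suminf_le_arctan:
  fixes f :: "nat \<Rightarrow> 'a :: banach"
  assumes "h > 0" "K \<ge> 0" "\<And>k. norm (f k) \<le> K * (h / (1 + (real (Suc k) * h)\<^sup>2))"
  shows "summable f" "norm (\<Sum>k. f k) \<le> K * (pi / 2)" "summable (\<lambda>k. norm (f k))" "(\<Sum>k. norm (f k)) \<le> K * (pi / 2)"
proof -
  let ?g = "\<lambda>k. K * (h / (1 + (real (Suc k) * h)\<^sup>2))"
  have part: "(\<Sum>k<n. ?g k) \<le> K * (pi / 2)" for n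
    unfolding sum_distrib_left[symmetric] using assms
    by (intro mult_left_mono order_trans[OF arctan_partial_sum] less_imp_le[OF arctan_ubound]) auto
  have sg: "summable ?g"
    using assms part by (intro summableI_nonneg_bounded[where x = "K * (pi / 2)"]) auto
  show s: "summable f" by (rule summable_comparison_test[OF _ sg]) (use assms(3) in auto)
  show sn: "summable (\<lambda>k. norm (f k))" by (rule summable_comparison_test[OF _ sg]) (use assms(3) in auto)
  show "(\<Sum>k. norm (f k)) \<le> K * (pi / 2)"
    by (rule order_trans[OF suminf_le[OF assms(3) sn sg] suminf_le_const[OF sg part]])
  thus "norm (\<Sum>k. f k) \<le> K * (pi / 2)" using summable_norm[OF sn] by simp
qed

subsection \<open>Hyperbolic functions in a sector\<close>

text \<open>The major arc needs slope 1 only. The wider 5/4 lets the expansion at 0 also cover the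
  adjacent arc, up to where the termwise estimate becomes strong enough.\<close>

definition sector :: "complex set" where
  "sector = {z. 0 < Re z \<and> \<bar>Im z\<bar> \<le> 5/4 * Re z}"

lemma Re_cosh: "Re (cosh z) = cosh (Re z) * cos (Im z)"
  and Im_cosh: "Im (cosh z) = sinh (Re z) * sin (Im z)"
  and Re_sinh: "Re (sinh z) = sinh (Re z) * cos (Im z)"
  and Im_sinh: "Im (sinh z) = cosh (Re z) * sin (Im z)"
  by (simp_all add: cosh_field_def sinh_field_def Re_exp Im_exp algebra_simps)

lemma norm_cosh_sq: "(norm (cosh z))\<^sup>2 = (sinh (Re z))\<^sup>2 + (cos (Im z))\<^sup>2"
proof -
  have "(norm (cosh z))\<^sup>2 = (cosh (Re z))\<^sup>2 * (cos (Im z))\<^sup>2 + (sinh (Re z))\<^sup>2 * (sin (Im z))\<^sup>2"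
    by (simp add: cmod_power2 Re_cosh Im_cosh power_mult_distrib)
  thus ?thesis by (simp add: cosh_square_eq sin_squared_eq algebra_simps)
qed

lemma norm_sinh_sq: "(norm (sinh z))\<^sup>2 = (sinh (Re z))\<^sup>2 + (sin (Im z))\<^sup>2"
proof -
  have "(norm (sinh z))\<^sup>2 = (sinh (Re z))\<^sup>2 * (cos (Im z))\<^sup>2 + (cosh (Re z))\<^sup>2 * (sin (Im z))\<^sup>2"
    by (simp add: cmod_power2 Re_sinh Im_sinh power_mult_distrib)
  thus ?thesis by (simp add: cosh_square_eq cos_squared_eq algebra_simps)
qed

lemma sinh_le_norm_cosh: "Re z \<ge> 0 \<Longrightarrow> sinh (Re z) \<le> norm (cosh z)"
  by (rule power2_le_imp_le) (simp_all add: norm_cosh_sq)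

lemma sinh_le_norm_sinh: "Re z \<ge> 0 \<Longrightarrow> sinh (Re z) \<le> norm (sinh z)"
  by (rule power2_le_imp_le) (simp_all add: norm_sinh_sq)

lemma norm_cosh_le: "norm (cosh z) \<le> cosh (Re z)"
  by (rule power2_le_imp_le) (simp_all add: norm_cosh_sq cosh_square_eq abs_square_le_1)

lemma norm_sinh_le: "norm (sinh z) \<le> cosh (Re z)"
  by (rule power2_le_imp_le) (simp_all add: norm_sinh_sq cosh_square_eq abs_square_le_1)

lemma le_sinh: "x \<ge> 0 \<Longrightarrow> x \<le> sinh (x::real)"
  using real_le_x_sinh[of x] by (simp add: sinh_def field_simps exp_minus)

lemma sinh_nonzero: "Re z > 0 \<Longrightarrow> sinh z \<noteq> 0"
  using sinh_le_norm_sinh[of z] by (auto dest!: le_zero_eq[THEN iffD1] simp: less_imp_le not_le)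

lemma cosh_nonzero: "Re z > 0 \<Longrightarrow> cosh z \<noteq> 0"
  using sinh_le_norm_cosh[of z] by (auto simp: less_imp_le not_le)

lemma sinh_ge_poly:
  assumes "x \<ge> (0::real)"
  shows "x + x ^ 3 / 6 + x ^ 5 / 120 \<le> sinh x"
proof -
  have "(\<Sum>n<6. if even n then 0 else x ^ n /\<^sub>R fact n) \<le> (\<Sum>n. if even n then 0 else x ^ n /\<^sub>R fact n)"
    by (rule sum_le_suminf) (use assms sinh_converges[of x] in \<open>auto simp: sums_iff\<close>)
  also have "\<dots> = sinh x" using sinh_converges[of x] by (simp add: sums_iff)
  also have "{..<6::nat} = {0, 1, 2, 3, 4, 5}" by auto
  finally show ?thesis by (simp add: fact_numeral field_simps)
qed

lemma sinh_sq_ge: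
  assumes "x \<ge> (0::real)"
  shows "x\<^sup>2 + (x\<^sup>2)\<^sup>2 / 3 + 2 * (x\<^sup>2) ^ 3 / 45 \<le> (sinh x)\<^sup>2"
proof -
  have "x\<^sup>2 + (x\<^sup>2)\<^sup>2 / 3 + 2 * (x\<^sup>2) ^ 3 / 45 \<le> (x + x ^ 3 / 6 + x ^ 5 / 120)\<^sup>2"
    using assms by (simp add: power2_eq_square field_simps eval_nat_numeral)
  also have "\<dots> \<le> (sinh x)\<^sup>2"
    using assms by (intro power_mono sinh_ge_poly) auto
  finally show ?thesis .
qed

lemma cos_ge_quadratic: "1 - y\<^sup>2 / 2 \<le> cos (y::real)"
proof -
  have "(sin (y/2))\<^sup>2 \<le> (y/2)\<^sup>2"
    using abs_sin_x_le_abs_x[of "y/2"] abs_le_square_iff by blast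
  thus ?thesis using cos_double_sin[of "y/2"] by (simp add: power2_eq_square)
qed

lemma sector_norm_le:
  assumes "z \<in> sector"
  shows "(norm z)\<^sup>2 \<le> 41/16 * (Re z)\<^sup>2"
proof -
  have "(Im z)\<^sup>2 \<le> (5/4 * Re z)\<^sup>2" using assms
    by (subst abs_le_square_iff[symmetric]) (auto simp: sector_def)
  thus ?thesis by (simp add: cmod_power2 power_mult_distrib power_divide)
qed

text \<open>The squared modulus is sinh^2 of the real part plus cos^2 of the imaginary part, and the
  cosine can vanish in the sector only where sinh is already large. The cases split at X = 32/25, up
  to which the lower bound 1 - 25/32 X for the cosine is nonnegative and may be squared; beyond it
  sinh alone suffices.\<close>

lemma norm_cosh_sector_sq:
  assumes "z \<in> sector"
  shows "4/5 \<le> (norm (cosh z))\<^sup>2" "((1 + (norm z)\<^sup>2) / 4)\<^sup>2 \<le> (norm (cosh z))\<^sup>2"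
proof -
  define X where "X = (Re z)\<^sup>2"
  have X0: "X \<ge> 0" by (simp add: X_def)
  have S: "X + X\<^sup>2 / 3 + 2 * X ^ 3 / 45 \<le> (sinh (Re z))\<^sup>2"
    using sinh_sq_ge[of "Re z"] assms by (simp add: X_def sector_def)
  have ez: "((1 + (norm z)\<^sup>2) / 4)\<^sup>2 \<le> ((1 + 41/16 * X) / 4)\<^sup>2"
    using sector_norm_le[OF assms] by (intro power_mono) (auto simp: X_def)
  have "4/5 \<le> (norm (cosh z))\<^sup>2 \<and> ((1 + 41/16 * X) / 4)\<^sup>2 \<le> (norm (cosh z))\<^sup>2"
  proof (cases "X \<le> 32/25")
    case True
    define Y where "Y = (Im z)\<^sup>2"
    have Y: "Y \<le> 25/16 * X" "Y \<ge> 0"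
    proof -
      have "(Im z)\<^sup>2 \<le> (5/4 * Re z)\<^sup>2" using assms
        by (subst abs_le_square_iff[symmetric]) (auto simp: sector_def)
      thus "Y \<le> 25/16 * X" "Y \<ge> 0" by (simp_all add: X_def Y_def power2_eq_square)
    qed
    have "1 - 25/32 * X \<ge> 0" using True by simp
    moreover have "1 - 25/32 * X \<le> cos (Im z)" using cos_ge_quadratic[of "Im z"] Y by (simp add: Y_def)
    ultimately have C: "(1 - 25/32 * X)\<^sup>2 \<le> (cos (Im z))\<^sup>2" by (intro power_mono) auto
    have "X ^ 3 \<ge> 0" using X0 by simp
    \<comment> \<open>The two polynomial differences are quadratics in X whose minima lie close to
      3/10 and 4/5.\<close>
    have "0 \<le> (X - 3/10)\<^sup>2" "0 \<le> (X - 4/5)\<^sup>2" by auto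
    with X0 True have "4/5 \<le> X + X\<^sup>2 / 3 + (1 - 25/32 * X)\<^sup>2" "((1 + 41/16 * X) / 4)\<^sup>2 \<le> X + X\<^sup>2 / 3 + (1 - 25/32 * X)\<^sup>2"
      by (simp_all add: power2_eq_square field_simps)
    thus ?thesis using S C \<open>X ^ 3 \<ge> 0\<close> unfolding norm_cosh_sq by linarith
  next
    case False
    \<comment> \<open>This is the difference of the two sides with rounded coefficients and without
      the constant 1/16. The coefficient 17/25 is rounded up slightly; the slack in the quadratic
      coefficient pays for it because X >= 32/25.\<close>
    have "X * (17/25 - 2/25 * X + 2/45 * X\<^sup>2) \<ge> 32/25 * (3/5)"
    proof (rule mult_mono)
      have "0 \<le> (X - 9/10)\<^sup>2" by simp
      thus "3/5 \<le> 17/25 - 2/25 * X + 2/45 * X\<^sup>2" by (simp add: power2_eq_square field_simps)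
    qed (use False X0 in auto)
    hence "((1 + 41/16 * X) / 4)\<^sup>2 \<le> X + X\<^sup>2 / 3 + 2 * X ^ 3 / 45"
    proof -
      have "32/25 * X \<le> X * X" using False X0 by (intro mult_right_mono) auto
      moreover have "17/25 * X - 2/25 * (X * X) + 2/45 * (X * (X * X)) \<ge> 96/125"
        using \<open>_ \<ge> 32/25 * (3/5)\<close> by (simp add: algebra_simps power2_eq_square)
      moreover have "((1 + 41/16 * X) / 4)\<^sup>2 = 1/16 + 41/128 * X + 1681/4096 * (X * X)"
        by (simp add: power2_eq_square field_simps)
      moreover have "X\<^sup>2 = X * X" "X ^ 3 = X * (X * X)" by (simp_all add: eval_nat_numeral)
      ultimately show ?thesis using False by linarith
    qed
    moreover have "4/5 \<le> X + X\<^sup>2 / 3 + 2 * X ^ 3 / 45"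
      using False X0 by (intro add_increasing2) auto
    ultimately show ?thesis using S unfolding norm_cosh_sq
      by (smt (verit) zero_le_power2)
  qed
  thus "4/5 \<le> (norm (cosh z))\<^sup>2" "((1 + (norm z)\<^sup>2) / 4)\<^sup>2 \<le> (norm (cosh z))\<^sup>2"
    using order_trans[OF ez] by blast+
qed

lemma norm_cosh_sector:
  assumes "z \<in> sector"
  shows "(1 + (norm z)\<^sup>2) / 4 \<le> norm (cosh z)"
  by (rule power2_le_imp_le[OF norm_cosh_sector_sq(2)[OF assms]]) simp

subsection \<open>Taylor estimates near the origin\<close>

lemma exp_le_11_4: "x \<le> 1 \<Longrightarrow> exp x \<le> (11/4 :: real)"
proof -
  assume "x \<le> 1"
  hence "exp x \<le> exp 1" by simp
  thus ?thesis using e_less_272 by linarith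
qed

lemma norm_sinh_Taylor:
  assumes "norm (z::complex) \<le> 1"
  shows "norm (sinh z - z - z ^ 3 / 6) \<le> norm z ^ 5 / 80"
proof -
  have T: "norm (exp w - (\<Sum>i\<le>6. w ^ i / fact i)) \<le> 11/4 * norm w ^ 7 / 720" if "norm w \<le> 1" for w :: complex
  proof -
    have "\<bar>Re w\<bar> \<le> 1" using that abs_Re_le_cmod[of w] by linarith
    have "norm (exp w - (\<Sum>i\<le>6. w ^ i / fact i)) \<le> exp \<bar>Re w\<bar> * norm w ^ Suc 6 / fact 6" by (rule Taylor_exp)
    also have "\<dots> \<le> 11/4 * norm w ^ 7 / 720"
      using mult_right_mono[OF exp_le_11_4[OF \<open>\<bar>Re w\<bar> \<le> 1\<close>], of "norm w ^ 7"] by (simp add: fact_numeral)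
    finally show ?thesis .
  qed
  have tri: "norm ((a - b) / 2 + w) \<le> (c + c) / 2 + d"
    if "norm a \<le> c" "norm b \<le> c" "norm w \<le> d" for a b w :: complex and c d
    using norm_triangle_ineq[of "(a - b) / 2" w] norm_triangle_ineq4[of a b] that
    by (simp add: norm_divide)
  have e: "sinh z - z - z ^ 3 / 6 = ((exp z - (\<Sum>i\<le>6. z ^ i / fact i)) - (exp (-z) - (\<Sum>i\<le>6. (-z) ^ i / fact i))) / 2 + z ^ 5 / 120"
    by (simp add: sinh_field_def atMost_nat_numeral fact_numeral field_simps)
  have "norm (sinh z - z - z ^ 3 / 6) \<le> (11/4 * norm z ^ 7 / 720 + 11/4 * norm z ^ 7 / 720) / 2 + norm z ^ 5 / 120"
    unfolding e using T[of z] T[of "-z"] assms by (intro tri) (simp_all add: norm_divide norm_power)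
  also have "\<dots> \<le> norm z ^ 5 / 80"
  proof -
    have "(11/4 * p / 720 + 11/4 * p / 720) / 2 + q / 120 \<le> q / 80" if "p \<le> q" "0 \<le> q" for p q :: real
      using that by (simp add: field_simps)
    from this[OF power_decreasing] show ?thesis using assms by auto
  qed
  finally show ?thesis .
qed

lemma norm_cosh_Taylor:
  assumes "norm (z::complex) \<le> 1"
  shows "norm (cosh z - 1 - z\<^sup>2 / 2) \<le> norm z ^ 4 / 15"
proof -
  have T: "norm (exp w - (\<Sum>i\<le>5. w ^ i / fact i)) \<le> 11/4 * norm w ^ 6 / 120" if "norm w \<le> 1" for w :: complex
  proof -
    have "\<bar>Re w\<bar> \<le> 1" using that abs_Re_le_cmod[of w] by linarith
    have "norm (exp w - (\<Sum>i\<le>5. w ^ i / fact i)) \<le> exp \<bar>Re w\<bar> * norm w ^ Suc 5 / fact 5" by (rule Taylor_exp)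
    also have "\<dots> \<le> 11/4 * norm w ^ 6 / 120"
      using mult_right_mono[OF exp_le_11_4[OF \<open>\<bar>Re w\<bar> \<le> 1\<close>], of "norm w ^ 6"] by (simp add: fact_numeral)
    finally show ?thesis .
  qed
  have tri: "norm ((a + b) / 2 + w) \<le> (c + c) / 2 + d"
    if "norm a \<le> c" "norm b \<le> c" "norm w \<le> d" for a b w :: complex and c d
    using norm_triangle_ineq[of "(a + b) / 2" w] norm_triangle_ineq[of a b] that
    by (simp add: norm_divide)
  have e: "cosh z - 1 - z\<^sup>2 / 2 = ((exp z - (\<Sum>i\<le>5. z ^ i / fact i)) + (exp (-z) - (\<Sum>i\<le>5. (-z) ^ i / fact i))) / 2 + z ^ 4 / 24"
    by (simp add: cosh_field_def atMost_nat_numeral fact_numeral field_simps)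
  have "norm (cosh z - 1 - z\<^sup>2 / 2) \<le> (11/4 * norm z ^ 6 / 120 + 11/4 * norm z ^ 6 / 120) / 2 + norm z ^ 4 / 24"
    unfolding e using T[of z] T[of "-z"] assms by (intro tri) (simp_all add: norm_divide norm_power)
  also have "\<dots> \<le> norm z ^ 4 / 15"
  proof -
    have "(11/4 * p / 120 + 11/4 * p / 120) / 2 + q / 24 \<le> q / 15" if "p \<le> q" "0 \<le> q" for p q :: real
      using that by (simp add: field_simps)
    from this[OF power_decreasing] show ?thesis using assms by auto
  qed
  finally show ?thesis .
qed

lemma norm_sinh_lower:
  assumes "norm (z::complex) \<le> 1"
  shows "4/5 * norm z \<le> norm (sinh z)" "norm (sinh z - z) \<le> 9/50 * norm z ^ 3"
proof -
  have "norm (sinh z - z) \<le> norm (sinh z - z - z ^ 3 / 6) + norm (z ^ 3 / 6)"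
    using norm_triangle_ineq[of "sinh z - z - z ^ 3 / 6" "z ^ 3 / 6"] by simp
  also have "\<dots> \<le> norm z ^ 5 / 80 + norm z ^ 3 / 6"
    using norm_sinh_Taylor[OF assms] by (simp add: norm_divide norm_power)
  finally have "norm (sinh z - z) \<le> norm z ^ 5 / 80 + norm z ^ 3 / 6" .
  moreover have "norm z ^ 5 \<le> norm z ^ 3" using assms by (intro power_decreasing) auto
  moreover have "0 \<le> norm z ^ 3" by simp
  ultimately show 1: "norm (sinh z - z) \<le> 9/50 * norm z ^ 3" by linarith
  have "norm z ^ 3 \<le> norm z ^ 1" using assms by (intro power_decreasing) auto
  with 1 have "norm (sinh z - z) \<le> 1/5 * norm z" using norm_ge_zero[of z] unfolding power_one_right by linarith
  moreover have "norm z \<le> norm (sinh z) + norm (sinh z - z)"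
    using norm_triangle_ineq4[of "sinh z" "sinh z - z"] by simp
  ultimately show "4/5 * norm z \<le> norm (sinh z)" by simp
qed

text \<open>coth without its pole at 0. Its derivative is the function whose Riemann sum describes
  the derivative of \<open>Lcoth\<close>; the poles taken away are summed exactly by the value of
  zeta at 2.\<close>

definition coth_reg :: "complex \<Rightarrow> complex" where
  "coth_reg z = cosh z / sinh z - 1 / z"

lemma norm_coth_reg_le:
  fixes z :: complex
  assumes "norm z \<le> 1" "z \<noteq> 0"
  shows "norm (coth_reg z) \<le> norm z"
proof -
  have snz: "sinh z \<noteq> 0" using norm_sinh_lower(1)[OF assms(1)] assms(2) by auto
  have e: "coth_reg z = (z * (cosh z - 1 - z\<^sup>2 / 2) - (sinh z - z - z ^ 3 / 6) + z ^ 3 / 3) / (z * sinh z)"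
    using assms snz by (simp add: coth_reg_def field_simps power2_eq_square power3_eq_cube)
  have "norm (z * (cosh z - 1 - z\<^sup>2 / 2) - (sinh z - z - z ^ 3 / 6) + z ^ 3 / 3)
      \<le> norm z * (norm z ^ 4 / 15) + norm z ^ 5 / 80 + norm z ^ 3 / 3"
  proof -
    have 1: "norm (z * (cosh z - 1 - z\<^sup>2 / 2)) \<le> norm z * (norm z ^ 4 / 15)"
      unfolding norm_mult using norm_cosh_Taylor[OF assms(1)] by (intro mult_left_mono) auto
    have 2: "norm (z ^ 3 / 3) = norm z ^ 3 / 3" by (simp add: norm_divide norm_power)
    have tri: "norm (a - b + c) \<le> norm a + norm b + norm c" for a b c :: complex
      using norm_triangle_ineq[of "a - b" c] norm_triangle_ineq4[of a b] by linarith
    show ?thesis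
      by (rule order_trans[OF tri]) (intro add_mono 1 norm_sinh_Taylor[OF assms(1)] eq_refl[OF 2])
  qed
  also have "\<dots> = norm z ^ 5 * (1/15 + 1/80) + norm z ^ 3 / 3" by (simp add: eval_nat_numeral field_simps)
  also have "\<dots> \<le> 1/2 * norm z ^ 3"
  proof -
    have "p * (1/15 + 1/80) + q / 3 \<le> 1/2 * q" if "p \<le> q" "0 \<le> q" for p q :: real
      using that by (simp add: field_simps)
    from this[OF power_decreasing] show ?thesis using assms by auto
  qed
  finally have N: "norm (z * (cosh z - 1 - z\<^sup>2 / 2) - (sinh z - z - z ^ 3 / 6) + z ^ 3 / 3) \<le> 1/2 * norm z ^ 3" .
  have D: "norm (z * sinh z) \<ge> norm z * (4/5 * norm z)"
    unfolding norm_mult using norm_sinh_lower(1)[OF assms(1)] by (intro mult_left_mono) auto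
  have "norm (coth_reg z) \<le> (1/2 * norm z ^ 3) / (norm z * (4/5 * norm z))"
    unfolding e norm_divide using assms by (intro frac_le N D) auto
  also have "\<dots> \<le> norm z" using assms by (simp add: field_simps power3_eq_cube)
  finally show ?thesis .
qed

lemma coth_reg_derivs:
  assumes "sinh z \<noteq> 0" "z \<noteq> 0"
  shows "(coth_reg has_field_derivative (1 / z\<^sup>2 - 1 / (sinh z)\<^sup>2)) (at z)"
    "((\<lambda>z. 1 / z\<^sup>2 - 1 / (sinh z)\<^sup>2) has_field_derivative (2 * cosh z / sinh z ^ 3 - 2 / z ^ 3)) (at z)"
proof -
  have "(coth_reg has_field_derivative ((sinh z * sinh z - cosh z * cosh z) / (sinh z * sinh z) + 1 / (z * z))) (at z)"
    unfolding coth_reg_def[abs_def] using assms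
    by (auto intro!: derivative_eq_intros simp: field_simps power2_eq_square)
  moreover have "sinh z * sinh z - cosh z * cosh z = - 1"
    using hyperbolic_pythagoras[of z] by (simp add: power2_eq_square algebra_simps)
  ultimately show "(coth_reg has_field_derivative (1 / z\<^sup>2 - 1 / (sinh z)\<^sup>2)) (at z)"
    by (simp add: power2_eq_square)
  show "((\<lambda>z. 1 / z\<^sup>2 - 1 / (sinh z)\<^sup>2) has_field_derivative (2 * cosh z / sinh z ^ 3 - 2 / z ^ 3)) (at z)"
  proof -
    have "((\<lambda>z. 1 / z\<^sup>2 - 1 / (sinh z)\<^sup>2) has_field_derivative
       ((0 * z\<^sup>2 - 1 * (2 * z)) / (z\<^sup>2 * z\<^sup>2) - (0 * (sinh z)\<^sup>2 - 1 * (2 * sinh z * cosh z)) / ((sinh z)\<^sup>2 * (sinh z)\<^sup>2))) (at z)"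
      using assms by (auto intro!: derivative_eq_intros)
    also have "((0 * z\<^sup>2 - 1 * (2 * z)) / (z\<^sup>2 * z\<^sup>2) - (0 * (sinh z)\<^sup>2 - 1 * (2 * sinh z * cosh z)) / ((sinh z)\<^sup>2 * (sinh z)\<^sup>2))
       = 2 * cosh z / sinh z ^ 3 - 2 / z ^ 3"
      using assms by (simp add: power2_eq_square power3_eq_cube mult.assoc)
    finally show ?thesis .
  qed
qed

text \<open>With e = sinh z / z the numerator becomes cosh z - e^3, whose quadratic terms z^2/2 and
  3 z^2/6 cancel. What is left has order four and outweighs the cubic pole.\<close>

lemma coth_reg_deriv2_near_0:
  fixes z :: complex
  assumes "norm z \<le> 1" "z \<noteq> 0"
  shows "norm (2 * cosh z / sinh z ^ 3 - 2 / z ^ 3) \<le> 1"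
proof -
  have snz: "sinh z \<noteq> 0" using norm_sinh_lower(1)[OF assms(1)] assms(2) by auto
  define r where "r = norm z"
  have r: "r > 0" "r \<le> 1" using assms by (auto simp: r_def)
  define e where "e = sinh z / z"
  define \<epsilon> where "\<epsilon> = (sinh z - z - z ^ 3 / 6) / z"
  define u where "u = z\<^sup>2 / 6 + \<epsilon>"
  define \<eta> where "\<eta> = cosh z - 1 - z\<^sup>2 / 2"
  have \<epsilon>: "norm \<epsilon> \<le> r ^ 4 / 80"
  proof -
    have "norm \<epsilon> \<le> (r ^ 5 / 80) / r"
      unfolding \<epsilon>_def norm_divide r_def using norm_sinh_Taylor[OF assms(1)] by (intro divide_right_mono) auto
    thus ?thesis using r by (simp add: eval_nat_numeral)
  qed
  have \<eta>: "norm \<eta> \<le> r ^ 4 / 15" using norm_cosh_Taylor[OF assms(1)] by (simp add: \<eta>_def r_def)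
  have r42: "r ^ 4 \<le> r\<^sup>2" using r by (intro power_decreasing) auto
  have u: "norm u \<le> 9/50 * r\<^sup>2"
  proof -
    have "norm u \<le> r\<^sup>2 / 6 + r ^ 4 / 80"
      unfolding u_def using \<epsilon> by (intro order_trans[OF norm_triangle_ineq] add_mono) (auto simp: norm_divide norm_power r_def)
    thus ?thesis using r42 zero_le_power2[of r] by linarith
  qed
  have eu: "e = 1 + u" using assms by (simp add: e_def u_def \<epsilon>_def field_simps power2_eq_square power3_eq_cube)
  have id: "cosh z - e ^ 3 = \<eta> - (3 * \<epsilon> + 3 * u\<^sup>2 + u ^ 3)"
    unfolding eu \<eta>_def by (simp add: u_def field_simps power2_eq_square power3_eq_cube)
  have "norm (u\<^sup>2) \<le> (9/50 * r\<^sup>2)\<^sup>2" unfolding norm_power using u by (intro power_mono) auto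
  hence u2: "norm (u\<^sup>2) \<le> 81/2500 * r ^ 4" by (simp add: eval_nat_numeral field_simps)
  have "norm (u ^ 3) \<le> (9/50 * r\<^sup>2) ^ 3" unfolding norm_power using u by (intro power_mono) auto
  also have "\<dots> = 729/125000 * r ^ 6" by (simp add: eval_nat_numeral field_simps)
  also have "r ^ 6 \<le> r ^ 4" using r by (intro power_decreasing) auto
  finally have u3: "norm (u ^ 3) \<le> 729/125000 * r ^ 4" by simp
  have "norm (cosh z - e ^ 3) \<le> r ^ 4 / 15 + (3 * (r ^ 4 / 80) + 3 * (81/2500 * r ^ 4) + 729/125000 * r ^ 4)"
    unfolding id
    by (intro order_trans[OF norm_triangle_ineq4] add_mono \<eta> order_trans[OF norm_triangle_ineq] u3)
       (use u2 \<epsilon> in \<open>auto simp: norm_mult\<close>)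
  moreover have "r ^ 4 \<ge> 0" using r by simp
  ultimately have num: "norm (cosh z - e ^ 3) \<le> 21/100 * r ^ 4" by linarith
  have "4/5 \<le> norm e" using norm_sinh_lower(1)[OF assms(1)] r
    by (simp add: e_def norm_divide r_def field_simps)
  hence "(4/5) ^ 3 \<le> norm e ^ 3" by (intro power_mono) auto
  hence e3: "64/125 \<le> norm (e ^ 3)" by (simp add: norm_power power3_eq_cube norm_mult)
  have "e \<noteq> 0" using \<open>4/5 \<le> norm e\<close> by auto
  have "2 * cosh z / sinh z ^ 3 - 2 / z ^ 3 = 2 * (cosh z - e ^ 3) / (z ^ 3 * e ^ 3)"
    using assms snz by (simp add: e_def field_simps power_divide)
  also have "norm \<dots> \<le> (2 * (21/100 * r ^ 4)) / (r ^ 3 * (64/125))"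
    unfolding norm_divide norm_mult norm_power[of z] r_def[symmetric]
    using num e3 r by (intro frac_le mult_left_mono mult_pos_pos mult_nonneg_nonneg) auto
  also have "\<dots> = 105/128 * r" using r by (simp add: eval_nat_numeral)
  also have "\<dots> \<le> 1" using r by simp
  finally show ?thesis .
qed

lemma cosh_le_2_sinh:
  assumes "x \<ge> (3/5 :: real)"
  shows "cosh x \<le> 2 * sinh x"
proof -
  \<comment> \<open>The claim is equivalent to exp (2 x) >= 3, and the twentieth power of 1 + 3/50
    already exceeds 3.\<close>
  have "(53/50) ^ 20 \<le> (1 + x / 10) ^ 20" using assms by (intro power_mono) auto
  also have "(1 + x / 10) ^ 20 \<le> (exp (x / 10)) ^ 20"
    using exp_ge_add_one_self[of "x / 10"] assms by (intro power_mono) auto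
  also have "(exp (x / 10)) ^ 20 = exp (2 * x)" by (simp flip: exp_of_nat_mult)
  finally have "3 \<le> exp (2 * x)" by (rule order_trans[rotated]) (simp add: power_divide)
  hence "3 * exp (-x) \<le> exp (2 * x) * exp (-x)" by (intro mult_right_mono) auto
  hence "3 * exp (-x) \<le> exp x" by (simp flip: exp_add)
  thus ?thesis by (simp add: cosh_def sinh_def)
qed

lemma coth_reg_deriv2_sector:
  assumes "z \<in> sector"
  shows "norm (2 * cosh z / sinh z ^ 3 - 2 / z ^ 3) \<le> 25 / (1 + (norm z)\<^sup>2)"
proof -
  have z0: "z \<noteq> 0" "Re z > 0" using assms by (auto simp: sector_def)
  show ?thesis
  proof (cases "norm z \<le> 1")
    case True
    hence "(norm z)\<^sup>2 \<le> 1" by (simp add: power_le_one)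
    hence "1 \<le> 25 / (1 + (norm z)\<^sup>2)" by (simp add: field_simps add_pos_nonneg)
    thus ?thesis using coth_reg_deriv2_near_0[OF True z0(1)] by linarith
  next
    case False
    define x where "x = Re z"
    have n1: "(norm z)\<^sup>2 \<ge> 1" using False by (simp add: one_le_power)
    have nz: "(norm z)\<^sup>2 \<le> 41/16 * x\<^sup>2" using sector_norm_le[OF assms] by (simp add: x_def)
    have x: "x \<ge> 3/5"
    proof -
      have "(3/5)\<^sup>2 \<le> x\<^sup>2" using nz n1 by (simp add: power2_eq_square)
      thus ?thesis using z0 by (auto simp: x_def intro: power2_le_imp_le)
    qed
    have sx: "x \<le> sinh x" using x by (intro le_sinh) auto
    have "norm (2 * cosh z / sinh z ^ 3) \<le> 2 * cosh x / sinh x ^ 3"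
      unfolding norm_divide norm_mult norm_power using norm_cosh_le[of z] sinh_le_norm_sinh[of z] z0 x
      by (intro frac_le mult_mono power_mono) (auto simp: x_def)
    also have "\<dots> \<le> 2 * (2 * sinh x) / sinh x ^ 3"
      using cosh_le_2_sinh[OF x] x by (intro divide_right_mono) auto
    also have "\<dots> = 4 / (sinh x)\<^sup>2" using x by (simp add: eval_nat_numeral)
    also have "\<dots> \<le> 4 / x\<^sup>2" using sx x by (intro divide_left_mono power_mono mult_pos_pos) auto
    also have "\<dots> \<le> (41/4) / (norm z)\<^sup>2"
    proof (subst frac_le_eq)
      show "x\<^sup>2 \<noteq> 0" "(norm z)\<^sup>2 \<noteq> 0" using x n1 by auto
      show "(4 * (norm z)\<^sup>2 - 41 / 4 * x\<^sup>2) / (x\<^sup>2 * (norm z)\<^sup>2) \<le> 0"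
        using nz by (intro divide_nonpos_nonneg) auto
    qed
    finally have 1: "norm (2 * cosh z / sinh z ^ 3) \<le> (41/4) / (norm z)\<^sup>2" .
    have "norm (2 / z ^ 3) = 2 / norm z ^ 3" by (simp add: norm_divide norm_power)
    also have "\<dots> \<le> 2 / (norm z)\<^sup>2"
      using False by (intro divide_left_mono power_increasing mult_pos_pos) auto
    finally have "norm (2 * cosh z / sinh z ^ 3 - 2 / z ^ 3) \<le> (41/4) / (norm z)\<^sup>2 + 2 / (norm z)\<^sup>2"
      using 1 by (intro order_trans[OF norm_triangle_ineq4] add_mono)
    also have "\<dots> = (49/4) / (norm z)\<^sup>2" by (simp add: field_simps)
    also have "\<dots> \<le> 25 / (1 + (norm z)\<^sup>2)"
    proof -
      have "49 / 4 / N \<le> 25 / (1 + N)" if "N \<ge> 1" for N :: real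
        using that by (simp add: field_simps)
      from this[OF n1] show ?thesis .
    qed
    finally show ?thesis .
  qed
qed

lemma half_sech_derivs:
  assumes "cosh z \<noteq> (0::complex)"
  shows "((\<lambda>z. 1 / (2 * cosh z)) has_field_derivative (- sinh z / (2 * (cosh z)\<^sup>2))) (at z)"
    "((\<lambda>z. - sinh z / (2 * (cosh z)\<^sup>2)) has_field_derivative (1 / (2 * cosh z) - 1 / cosh z ^ 3)) (at z)"
proof -
  show "((\<lambda>z. 1 / (2 * cosh z)) has_field_derivative (- sinh z / (2 * (cosh z)\<^sup>2))) (at z)"
    using assms by (auto intro!: derivative_eq_intros simp: divide_simps power2_eq_square)
  have "((\<lambda>z. - sinh z / (2 * (cosh z)\<^sup>2)) has_field_derivative
     ((- cosh z * (2 * (cosh z)\<^sup>2) - (- sinh z) * (2 * (2 * cosh z * sinh z))) / (2 * (cosh z)\<^sup>2 * (2 * (cosh z)\<^sup>2)))) (at z)"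
  proof (rule DERIV_divide)
    show "((\<lambda>z. - sinh z) has_field_derivative - cosh z) (at z)"
      "((\<lambda>z. 2 * (cosh z)\<^sup>2) has_field_derivative (2 * (2 * cosh z * sinh z))) (at z)"
      by (auto intro!: derivative_eq_intros)
  qed (use assms in simp)
  also have "(- cosh z * (2 * (cosh z)\<^sup>2) - (- sinh z) * (2 * (2 * cosh z * sinh z))) / (2 * (cosh z)\<^sup>2 * (2 * (cosh z)\<^sup>2))
     = (- (cosh z)\<^sup>2 + 2 * (sinh z)\<^sup>2) / (2 * cosh z ^ 3)"
    using assms by (simp add: divide_simps eval_nat_numeral) (simp add: algebra_simps)?
  also have "\<dots> = 1 / (2 * cosh z) - 1 / cosh z ^ 3"
    using assms unfolding sinh_square_eq by (simp add: divide_simps eval_nat_numeral) (simp add: algebra_simps)?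
  finally show "((\<lambda>z. - sinh z / (2 * (cosh z)\<^sup>2)) has_field_derivative (1 / (2 * cosh z) - 1 / cosh z ^ 3)) (at z)" .
qed

lemma half_sech_deriv2_sector:
  assumes "z \<in> sector"
  shows "norm (1 / (2 * cosh z) - 1 / cosh z ^ 3) \<le> 7 / (1 + (norm z)\<^sup>2)"
proof -
  define C where "C = norm (cosh z)"
  have C: "C\<^sup>2 \<ge> 4/5" "C \<ge> (1 + (norm z)\<^sup>2) / 4"
    using norm_cosh_sector_sq(1)[OF assms] norm_cosh_sector[OF assms] by (auto simp: C_def)
  have p: "1 + (norm z)\<^sup>2 > 0" by (simp add: add_pos_nonneg)
  have C0: "C > 0" using C(2) p by (intro less_le_trans[OF _ C(2)]) simp
  have "norm (1 / (2 * cosh z) - 1 / cosh z ^ 3) \<le> 1 / (2 * C) + 1 / C ^ 3"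
    by (rule order_trans[OF norm_triangle_ineq4]) (simp add: norm_divide norm_mult norm_power C_def)
  also have "\<dots> = (1 / C) * (1/2 + 1 / C\<^sup>2)" using C0 by (simp add: field_simps eval_nat_numeral)
  also have "\<dots> \<le> (4 / (1 + (norm z)\<^sup>2)) * (1/2 + 5/4)"
    using C C0 p by (intro mult_mono add_left_mono) (auto simp: field_simps)
  also have "\<dots> = 7 / (1 + (norm z)\<^sup>2)" using p by (simp add: divide_simps)
  finally show ?thesis .
qed

subsection \<open>Riemann sums along a ray\<close>

lemma sector_scale: "z \<in> sector \<Longrightarrow> r > 0 \<Longrightarrow> of_real r * z \<in> sector"
  by (auto simp: sector_def abs_mult mult.left_commute)

lemma convex_sector: "convex sector"
proof -
  have "sector = {z. 0 < Re z} \<inter> {z. Im z - 5/4 * Re z \<le> 0} \<inter> {z. Im z + 5/4 * Re z \<ge> 0}"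
    by (auto simp: sector_def abs_le_iff)
  moreover have *: "convex {z. Im z - 5/4 * Re z \<le> 0}" "convex {z. Im z + 5/4 * Re z \<ge> 0}"
  proof -
    have "{z. Im z - 5/4 * Re z \<le> 0} = {z. Complex (-5/4) 1 \<bullet> z \<le> 0}"
      "{z. Im z + 5/4 * Re z \<ge> 0} = {z. Complex (5/4) 1 \<bullet> z \<ge> 0}"
      by (auto simp: inner_complex_def)
    thus "convex {z. Im z - 5/4 * Re z \<le> 0}" "convex {z. Im z + 5/4 * Re z \<ge> 0}"
      by (auto intro: convex_halfspace_le convex_halfspace_ge)
  qed
  from * have "convex ({z. 0 < Re z} \<inter> {z. Im z - 5/4 * Re z \<le> 0} \<inter> {z. Im z + 5/4 * Re z \<ge> 0})"
    by (intro convex_Int convex_halfspace_Re_gt)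
  ultimately show ?thesis by simp
qed

text \<open>First-order Euler-Maclaurin summation along a ray. Each h g'(z_j) is compared with
  g(z_(j+1)) - g(z_j); these increments telescope to L - g(c h), and the Taylor remainders add up to
  a Riemann sum of 1/(1 + y^2). The offset c is 1/2 for the odd multiples and 1 for all
  multiples.\<close>

lemma Riemann_telescope:
  fixes g g1 g2 :: "complex \<Rightarrow> complex"
  assumes h: "h \<in> sector" and c: "0 < c" "c \<le> 1" and K: "K \<ge> 0"
    and d1: "\<And>z. z \<in> sector \<Longrightarrow> (g has_field_derivative g1 z) (at z)"
    and d2: "\<And>z. z \<in> sector \<Longrightarrow> (g1 has_field_derivative g2 z) (at z)"
    and bd: "\<And>z. z \<in> sector \<Longrightarrow> norm (g2 z) \<le> K / (1 + (norm z)\<^sup>2)"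
    and L: "(\<lambda>j. g (of_real (real j + c) * h)) \<longlonglongrightarrow> L"
  shows "norm ((\<Sum>j. g1 (of_real (real j + c) * h)) - (L - g (of_real c * h)) / h) \<le> K * (norm h + pi / 2)"
proof -
  have h0: "h \<noteq> 0" "norm h > 0" using h by (auto simp: sector_def)
  define z where "z = (\<lambda>j. of_real (real j + c) * h)"
  define d where "d = (\<lambda>j. g1 (z j) - (g (z (Suc j)) - g (z j)) / h)"
  have zS: "z (Suc j) = z j + h" for j by (simp add: z_def algebra_simps)
  have nz: "norm (z j) = (real j + c) * norm h" for j
    unfolding z_def norm_mult norm_of_real using c by simp
  have db: "norm (d j) \<le> norm h * (K / (1 + (norm (z j))\<^sup>2))" for j
  proof -
    define B where "B = K / (1 + (norm (z j))\<^sup>2)"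
    define F where "F = (\<lambda>i::nat. if i = 0 then g else if i = 1 then g1 else g2)"
    have seg: "x \<in> sector \<and> norm (z j) \<le> norm x" if x: "x \<in> closed_segment (z j) (z (Suc j))" for x
    proof -
      from x obtain u where u: "0 \<le> u" "u \<le> 1" "x = z j + of_real u * (z (Suc j) - z j)"
        by (auto simp: closed_segment_def algebra_simps scaleR_conv_of_real)
      hence xe: "x = of_real (real j + c + u) * h" by (simp add: zS z_def algebra_simps)
      have "norm x = (real j + c + u) * norm h" unfolding xe norm_mult norm_of_real using c u by simp
      thus ?thesis using u c h0 sector_scale[OF h, of "real j + c + u"] unfolding xe[symmetric]
        by (simp add: nz)
    qed
    have "norm (F 0 (z (Suc j)) - (\<Sum>i\<le>1. F i (z j) * (z (Suc j) - z j) ^ i / fact i)) \<le> B * norm (z (Suc j) - z j) ^ Suc 1 / fact 1"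
    proof (rule complex_Taylor)
      show "convex (closed_segment (z j) (z (Suc j)))" by (rule convex_closed_segment)
      show "(F i has_field_derivative F (Suc i) x) (at x within closed_segment (z j) (z (Suc j)))"
        if "x \<in> closed_segment (z j) (z (Suc j))" "i \<le> 1" for i x
        using that seg[OF that(1)] d1 d2 by (cases i) (auto simp: F_def intro: has_field_derivative_at_within)
      show "norm (F (Suc 1) x) \<le> B" if "x \<in> closed_segment (z j) (z (Suc j))" for x
      proof -
        have "norm (g2 x) \<le> K / (1 + (norm x)\<^sup>2)" using seg[OF that] bd by auto
        also have "\<dots> \<le> B" unfolding B_def using seg[OF that] K
          by (intro divide_left_mono add_left_mono power_mono mult_pos_pos) (auto simp: add_pos_nonneg)
        finally show ?thesis by (simp add: F_def)
      qed
    qed auto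
    hence "norm (g (z (Suc j)) - (g (z j) + g1 (z j) * h)) \<le> B * (norm h)\<^sup>2"
      by (simp add: F_def zS power2_eq_square)
    moreover have "norm (d j) * norm h = norm (g (z (Suc j)) - (g (z j) + g1 (z j) * h))"
    proof -
      have "d j * h = - (g (z (Suc j)) - (g (z j) + g1 (z j) * h))" using h0
        by (simp add: d_def left_diff_distrib[of "g1 (z j)"])
      thus ?thesis by (metis norm_minus_cancel norm_mult)
    qed
    ultimately have "norm (d j) * norm h \<le> (norm h * B) * norm h" by (simp add: power2_eq_square mult_ac)
    hence "norm (d j) \<le> norm h * B" using h0(2) by (rule mult_right_le_imp_le)
    thus ?thesis by (simp add: B_def)
  qed
  \<comment> \<open>The arctangent bound starts at the first multiple of |h|, which the point z_0 =
    c h need not reach; its remainder is bounded by itself.\<close>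
  have d0: "norm (d 0) \<le> K * norm h"
  proof -
    have "norm (d 0) \<le> norm h * (K / (1 + (norm (z 0))\<^sup>2))" by (rule db)
    also have "\<dots> \<le> norm h * (K / 1)" using K by (intro mult_left_mono divide_left_mono) (auto simp: add_pos_nonneg)
    finally show ?thesis by (simp add: mult.commute)
  qed
  have dS: "norm (d (Suc k)) \<le> K * (norm h / (1 + (real (Suc k) * norm h)\<^sup>2))" for k
  proof -
    have "norm (d (Suc k)) \<le> norm h * (K / (1 + (norm (z (Suc k)))\<^sup>2))" by (rule db)
    also have "\<dots> \<le> norm h * (K / (1 + (real (Suc k) * norm h)\<^sup>2))"
      using K c h0 unfolding nz
      by (intro mult_left_mono divide_left_mono add_left_mono power_mono mult_right_mono mult_pos_pos) (auto simp: add_pos_nonneg)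
    finally show ?thesis by (simp add: mult_ac)
  qed
  have sm: "summable (\<lambda>k. d (Suc k))" and le: "norm (\<Sum>k. d (Suc k)) \<le> K * (pi / 2)"
    using norm_suminf_le_arctan[OF h0(2) K dS] by blast+
  have sd: "summable d" using sm by (subst (asm) summable_Suc_iff)
  have "(\<lambda>j. g (z j)) \<longlonglongrightarrow> L" using L by (simp add: z_def)
  from sums_divide[OF telescope_sums[OF this], of h]
  have tel: "(\<lambda>j. (g (z (Suc j)) - g (z j)) / h) sums ((L - g (z 0)) / h)" .
  have "(\<lambda>j. d j + (g (z (Suc j)) - g (z j)) / h) sums (suminf d + (L - g (z 0)) / h)"
    by (rule sums_add[OF summable_sums[OF sd] tel])
  hence "(\<lambda>j. g1 (z j)) sums (suminf d + (L - g (z 0)) / h)" by (simp add: d_def)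
  hence "(\<Sum>j. g1 (z j)) - (L - g (z 0)) / h = suminf d" by (simp add: sums_iff)
  also have "suminf d = (\<Sum>k. d (Suc k)) + d 0" using suminf_split_head[OF sd] by simp
  also have "norm \<dots> \<le> K * (pi / 2) + K * norm h" by (intro order_trans[OF norm_triangle_ineq] add_mono le d0)
  finally show ?thesis by (simp add: z_def algebra_simps)
qed

subsection \<open>The two logarithmic series\<close>

definition lod_term :: "nat \<Rightarrow> complex \<Rightarrow> complex" where
  "lod_term j z = 1 / (2 * of_nat (2 * j + 1) * cosh (of_nat (2 * j + 1) * z))"

definition Lod :: "complex \<Rightarrow> complex" where "Lod z = (\<Sum>j. lod_term j z)"

definition lev_term :: "nat \<Rightarrow> complex \<Rightarrow> complex" where
  "lev_term j z = 1 / (4 * of_nat (Suc j) * sinh (2 * of_nat (Suc j) * z))"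

definition Lev :: "complex \<Rightarrow> complex" where "Lev z = (\<Sum>j. lev_term j z)"

text \<open>The subtracted 1 is the limit of coth at infinity. It makes the terms decay
  exponentially and disappears in the difference that yields \<open>lev_term\<close>.\<close>

definition coth_term :: "nat \<Rightarrow> complex \<Rightarrow> complex" where
  "coth_term j z = (cosh (of_nat (Suc j) * z) / sinh (of_nat (Suc j) * z) - 1) / (4 * of_nat (Suc j))"

section \<open>Exponential decay and termwise differentiation\<close>

lemma inverse_sinh_le:
  assumes "0 < \<delta>" "\<delta> \<le> x"
  shows "1 / sinh x \<le> 2 / (1 - exp (- 2 * \<delta>)) * exp (- x :: real)"
proof -
  have p: "1 - exp (- 2 * \<delta>) > 0" using assms by simp
  have "exp x * (1 - exp (- 2 * \<delta>)) \<le> exp x * (1 - exp (- 2 * x))" using assms by simp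
  also have "\<dots> = 2 * sinh x" by (simp add: sinh_def algebra_simps flip: exp_add)
  finally have "exp x * (1 - exp (- 2 * \<delta>)) / 2 \<le> sinh x" by simp
  hence "1 / sinh x \<le> 1 / (exp x * (1 - exp (- 2 * \<delta>)) / 2)"
    using p assms by (intro divide_left_mono mult_pos_pos) auto
  also have "\<dots> = 2 / (1 - exp (- 2 * \<delta>)) * exp (- x)" by (simp add: exp_minus field_simps)
  finally show ?thesis .
qed

lemma cosh_real_le_exp: "x \<ge> 0 \<Longrightarrow> cosh x \<le> exp (x :: real)"
  by (simp add: cosh_def)

lemma norm_hyperbolic_decay:
  assumes "0 < \<delta>" "\<delta> \<le> Re z"
  defines "D \<equiv> 2 / (1 - exp (- 2 * \<delta>))"
  shows "norm (1 / cosh z) \<le> D * exp (- Re z)" "norm (1 / sinh z) \<le> D * exp (- Re z)"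
    "norm (sinh z / (cosh z)\<^sup>2) \<le> D\<^sup>2 * exp (- Re z)"
    "norm (1 / (sinh z)\<^sup>2) \<le> D\<^sup>2 * exp (- Re z)"
    "norm (cosh z / sinh z - 1) \<le> D * exp (- Re z)"
proof -
  have s: "sinh (Re z) > 0" using assms by simp
  have I: "1 / sinh (Re z) \<le> D * exp (- Re z)" unfolding D_def using assms by (intro inverse_sinh_le)
  have D0: "D \<ge> 0" using assms by (simp add: D_def)
  show 1: "norm (1 / cosh z) \<le> D * exp (- Re z)"
  proof -
    have "norm (1 / cosh z) \<le> 1 / sinh (Re z)" unfolding norm_divide norm_one
      using sinh_le_norm_cosh[of z] s assms by (intro divide_left_mono mult_pos_pos) auto
    thus ?thesis using I by linarith
  qed
  show 2: "norm (1 / sinh z) \<le> D * exp (- Re z)"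
  proof -
    have "norm (1 / sinh z) \<le> 1 / sinh (Re z)" unfolding norm_divide norm_one
      using sinh_le_norm_sinh[of z] s assms by (intro divide_left_mono mult_pos_pos) auto
    thus ?thesis using I by linarith
  qed
  have sq: "(D * exp (- Re z))\<^sup>2 = D\<^sup>2 * exp (- Re z) * exp (- Re z)"
    by (simp add: power2_eq_square)
  have "norm (sinh z / (cosh z)\<^sup>2) = norm (sinh z) * (norm (1 / cosh z))\<^sup>2"
    by (simp add: norm_divide norm_power power_divide)
  also have "\<dots> \<le> exp (Re z) * (D * exp (- Re z))\<^sup>2"
    using 1 norm_sinh_le[of z] cosh_real_le_exp[of "Re z"] assms by (intro mult_mono power_mono) auto
  also have "\<dots> = D\<^sup>2 * exp (- Re z)" unfolding sq by (simp add: exp_minus field_simps)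
  finally show "norm (sinh z / (cosh z)\<^sup>2) \<le> D\<^sup>2 * exp (- Re z)" .
  have "norm (1 / (sinh z)\<^sup>2) = (norm (1 / sinh z))\<^sup>2" by (simp add: norm_divide norm_power power_divide)
  also have "\<dots> \<le> (D * exp (- Re z))\<^sup>2" using 2 by (intro power_mono) auto
  also have "\<dots> \<le> D\<^sup>2 * exp (- Re z) * 1" unfolding sq using assms by (intro mult_left_mono) auto
  finally show "norm (1 / (sinh z)\<^sup>2) \<le> D\<^sup>2 * exp (- Re z)" by simp
  have snz: "sinh z \<noteq> 0" using assms by (intro sinh_nonzero) auto
  have "cosh z / sinh z - 1 = exp (- z) * (1 / sinh z)"
    using snz by (simp add: field_simps cosh_minus_sinh[symmetric])
  also have "norm \<dots> = exp (- Re z) * norm (1 / sinh z)" unfolding norm_mult by simp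
  also have "\<dots> \<le> 1 * (D * exp (- Re z))" using 2 assms by (intro mult_mono) auto
  finally show "norm (cosh z / sinh z - 1) \<le> D * exp (- Re z)" by simp
qed

lemma summable_exp_linear:
  assumes "\<delta> > (0::real)" "\<And>j. real j \<le> m j"
  shows "summable (\<lambda>j. C * exp (- (m j * \<delta>)))"
proof (rule summable_mult, rule summable_comparison_test)
  show "\<exists>N. \<forall>n\<ge>N. norm (exp (- (m n * \<delta>))) \<le> exp (- \<delta>) ^ n"
  proof (intro exI allI impI)
    fix n :: nat
    have "real n * \<delta> \<le> m n * \<delta>" using assms by (intro mult_right_mono) auto
    thus "norm (exp (- (m n * \<delta>))) \<le> exp (- \<delta>) ^ n" by (simp flip: exp_of_nat_mult)
  qed
  show "summable (\<lambda>n. exp (- \<delta>) ^ n)" using assms by (intro summable_geometric) auto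
qed

lemma exp_decay_le:
  assumes "\<delta> \<le> Re z" "C \<ge> 0" "m \<ge> (0::real)"
  shows "C * exp (- (m * Re z)) \<le> C * exp (- (m * \<delta>))"
  using assms by (intro mult_left_mono) (auto intro: mult_left_mono)

text \<open>On the half-plane of real parts at least Re z / 2 the terms and their derivatives have
  exponential majorants independent of the point, so the series may be differentiated term by
  term.\<close>

lemma Lod_deriv:
  assumes z: "Re z > 0"
  shows "summable (\<lambda>j. lod_term j z)"
    "(Lod has_field_derivative (\<Sum>j. - sinh (of_nat (2 * j + 1) * z) / (2 * (cosh (of_nat (2 * j + 1) * z))\<^sup>2))) (at z)"
proof -
  define \<delta> where "\<delta> = Re z / 2"
  define S where "S = {w. Re w \<ge> \<delta>}"
  define D where "D = 2 / (1 - exp (- 2 * \<delta>))"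
  have \<delta>: "\<delta> > 0" using z by (simp add: \<delta>_def)
  have D0: "D \<ge> 0" using \<delta> by (simp add: D_def)
  let ?d = "\<lambda>j w. - sinh (of_nat (2 * j + 1) * w) / (2 * (cosh (of_nat (2 * j + 1) * w))\<^sup>2)"
  have big: "\<delta> \<le> Re (of_nat (2 * j + 1) * w)" if "w \<in> S" for w j
  proof -
    have "1 * \<delta> \<le> real (2 * j + 1) * Re w" using that \<delta> by (intro mult_mono) (auto simp: S_def)
    thus ?thesis by simp
  qed
  have b1: "norm (?d j w) \<le> D\<^sup>2 * exp (- (real (2 * j + 1) * \<delta>))" if "w \<in> S" for j w
  proof -
    have "norm (?d j w) \<le> norm (sinh (of_nat (2 * j + 1) * w) / (cosh (of_nat (2 * j + 1) * w))\<^sup>2)"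
    proof -
      have "norm (- a / (2 * b)) \<le> norm (a / b)" for a b :: complex
        by (simp add: norm_divide norm_mult divide_simps)
      thus ?thesis .
    qed
    also have "\<dots> \<le> D\<^sup>2 * exp (- Re (of_nat (2 * j + 1) * w))"
      unfolding D_def by (rule norm_hyperbolic_decay(3)[OF \<delta> big[OF that]])
    also have "Re (of_nat (2 * j + 1) * w) = real (2 * j + 1) * Re w" by simp
    also have "D\<^sup>2 * exp (- (real (2 * j + 1) * Re w)) \<le> D\<^sup>2 * exp (- (real (2 * j + 1) * \<delta>))"
      using that by (intro exp_decay_le) (auto simp: S_def)
    finally show ?thesis .
  qed
  have b0: "norm (lod_term j w) \<le> D * exp (- (real (2 * j + 1) * \<delta>))" if "w \<in> S" for j w
  proof -
    have "norm (lod_term j w) = 1 / (2 * real (2 * j + 1)) * norm (1 / cosh (of_nat (2 * j + 1) * w))"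
      unfolding lod_term_def norm_divide norm_mult norm_of_nat norm_numeral norm_one by simp
    also have "\<dots> \<le> 1 * norm (1 / cosh (of_nat (2 * j + 1) * w))" by (intro mult_right_mono) auto
    also have "\<dots> \<le> D * exp (- Re (of_nat (2 * j + 1) * w))"
      unfolding D_def using norm_hyperbolic_decay(1)[OF \<delta> big[OF that]] by simp
    also have "Re (of_nat (2 * j + 1) * w) = real (2 * j + 1) * Re w" by simp
    also have "D * exp (- (real (2 * j + 1) * Re w)) \<le> D * exp (- (real (2 * j + 1) * \<delta>))"
      using that D0 by (intro exp_decay_le) (auto simp: S_def)
    finally show ?thesis .
  qed
  have zS: "z \<in> S" "z \<in> interior S"
  proof -
    show "z \<in> S" using z by (simp add: S_def \<delta>_def)
    show "z \<in> interior S"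
    proof (rule interiorI)
      show "open {w. Re w > \<delta>}" by (rule open_halfspace_Re_gt)
    qed (use z in \<open>auto simp: S_def \<delta>_def\<close>)
  qed
  have sm: "summable (\<lambda>j. C * exp (- (real (2 * j + 1) * \<delta>)))" for C
    by (rule summable_exp_linear[OF \<delta>]) auto
  show s0: "summable (\<lambda>j. lod_term j z)"
    by (rule summable_comparison_test'[OF sm b0[OF zS(1)]])
  have der: "(lod_term j has_field_derivative ?d j w) (at w within S)" if "w \<in> S" for j w
  proof -
    have nz: "cosh (of_nat (2 * j + 1) * w) \<noteq> 0"
      using less_le_trans[OF \<delta> big[OF that]] by (rule cosh_nonzero)
    define c :: complex where "c = of_nat (2 * j + 1)"
    have c0: "c \<noteq> 0" unfolding c_def of_nat_eq_0_iff by simp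
    have "((\<lambda>w. c * w) has_field_derivative c) (at w within S)" by (auto intro!: derivative_eq_intros)
    from DERIV_cdivide[OF DERIV_chain'[OF this half_sech_derivs(1)[OF nz[folded c_def]]], of c]
    show ?thesis using c0 unfolding lod_term_def[abs_def] c_def[symmetric] by (simp add: mult_ac)
  qed
  show "(Lod has_field_derivative (\<Sum>j. ?d j z)) (at z)"
    unfolding Lod_def[abs_def]
  proof (rule has_field_derivative_series'(2)[where S = S and ?x0.0 = z])
    show "convex S" by (simp add: S_def convex_halfspace_Re_ge)
    show "uniformly_convergent_on S (\<lambda>n x. \<Sum>i<n. ?d i x)"
      by (rule Weierstrass_m_test'[OF b1 sm])
  qed (use zS s0 der in auto)
qed

definition Lcoth :: "complex \<Rightarrow> complex" where "Lcoth z = (\<Sum>j. coth_term j z)"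

lemma Lcoth_deriv:
  assumes z: "Re z > 0"
  shows "summable (\<lambda>j. coth_term j z)"
    "summable (\<lambda>j. 1 / (sinh (of_nat (Suc j) * z))\<^sup>2)"
    "(Lcoth has_field_derivative (\<Sum>j. - 1 / (4 * (sinh (of_nat (Suc j) * z))\<^sup>2))) (at z)"
proof -
  define \<delta> where "\<delta> = Re z / 2"
  define S where "S = {w. Re w \<ge> \<delta>}"
  define D where "D = 2 / (1 - exp (- 2 * \<delta>))"
  have \<delta>: "\<delta> > 0" using z by (simp add: \<delta>_def)
  have D0: "D \<ge> 0" using \<delta> by (simp add: D_def)
  let ?d = "\<lambda>j w. - 1 / (4 * (sinh (of_nat (Suc j) * w))\<^sup>2)"
  have big: "\<delta> \<le> Re (of_nat (Suc j) * w)" if "w \<in> S" for w j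
  proof -
    have "1 * \<delta> \<le> real (Suc j) * Re w" using that \<delta> by (intro mult_mono) (auto simp: S_def)
    thus ?thesis by simp
  qed
  have b2: "norm (1 / (sinh (of_nat (Suc j) * w))\<^sup>2) \<le> D\<^sup>2 * exp (- (real (Suc j) * \<delta>))" if "w \<in> S" for j w
  proof -
    have "norm (1 / (sinh (of_nat (Suc j) * w))\<^sup>2) \<le> D\<^sup>2 * exp (- Re (of_nat (Suc j) * w))"
      unfolding D_def by (rule norm_hyperbolic_decay(4)[OF \<delta> big[OF that]])
    also have "Re (of_nat (Suc j) * w) = real (Suc j) * Re w" by simp
    also have "D\<^sup>2 * exp (- (real (Suc j) * Re w)) \<le> D\<^sup>2 * exp (- (real (Suc j) * \<delta>))"
      using that by (intro exp_decay_le) (auto simp: S_def)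
    finally show ?thesis .
  qed
  have b1: "norm (?d j w) \<le> D\<^sup>2 * exp (- (real (Suc j) * \<delta>))" if "w \<in> S" for j w
  proof -
    have "norm (?d j w) = 1/4 * norm (1 / (sinh (of_nat (Suc j) * w))\<^sup>2)"
      by (simp add: norm_divide norm_mult)
    also have "\<dots> \<le> 1 * norm (1 / (sinh (of_nat (Suc j) * w))\<^sup>2)" by (intro mult_right_mono) auto
    finally show ?thesis using b2[OF that, of j] by simp
  qed
  have b0: "norm (coth_term j w) \<le> D * exp (- (real (Suc j) * \<delta>))" if "w \<in> S" for j w
  proof -
    have "norm (coth_term j w) = 1 / (4 * real (Suc j)) * norm (cosh (of_nat (Suc j) * w) / sinh (of_nat (Suc j) * w) - 1)"
      unfolding coth_term_def norm_divide norm_mult norm_of_nat norm_numeral by simp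
    also have "\<dots> \<le> 1 * norm (cosh (of_nat (Suc j) * w) / sinh (of_nat (Suc j) * w) - 1)" by (intro mult_right_mono) auto
    also have "\<dots> \<le> D * exp (- Re (of_nat (Suc j) * w))"
      unfolding D_def using norm_hyperbolic_decay(5)[OF \<delta> big[OF that]] by simp
    also have "Re (of_nat (Suc j) * w) = real (Suc j) * Re w" by simp
    also have "D * exp (- (real (Suc j) * Re w)) \<le> D * exp (- (real (Suc j) * \<delta>))"
      using that D0 by (intro exp_decay_le) (auto simp: S_def)
    finally show ?thesis .
  qed
  have zS: "z \<in> S" "z \<in> interior S"
  proof -
    show "z \<in> S" using z by (simp add: S_def \<delta>_def)
    show "z \<in> interior S"
    proof (rule interiorI)
      show "open {w. Re w > \<delta>}" by (rule open_halfspace_Re_gt)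
    qed (use z in \<open>auto simp: S_def \<delta>_def\<close>)
  qed
  have sm: "summable (\<lambda>j. C * exp (- (real (Suc j) * \<delta>)))" for C
    by (rule summable_exp_linear[OF \<delta>]) auto
  show s0: "summable (\<lambda>j. coth_term j z)"
    by (rule summable_comparison_test'[OF sm b0[OF zS(1)]])
  show "summable (\<lambda>j. 1 / (sinh (of_nat (Suc j) * z))\<^sup>2)"
    by (rule summable_comparison_test'[OF sm b2[OF zS(1)]])
  have der: "(coth_term j has_field_derivative ?d j w) (at w within S)" if "w \<in> S" for j w
  proof -
    have nz: "sinh (of_nat (Suc j) * w) \<noteq> 0"
      using less_le_trans[OF \<delta> big[OF that]] by (rule sinh_nonzero)
    have d: "((\<lambda>w. cosh w / sinh w - 1) has_field_derivative (- 1 / (sinh u)\<^sup>2)) (at u)" if "sinh u \<noteq> 0" for u :: complex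
    proof -
      have "((\<lambda>w. cosh w / sinh w - 1) has_field_derivative ((sinh u * sinh u - cosh u * cosh u) / (sinh u * sinh u))) (at u)"
        using that by (auto intro!: derivative_eq_intros)
      moreover have "sinh u * sinh u - cosh u * cosh u = - 1"
        using hyperbolic_pythagoras[of u] by (simp add: power2_eq_square algebra_simps)
      ultimately show ?thesis by (simp add: power2_eq_square)
    qed
    define c :: complex where "c = of_nat (Suc j)"
    have c0: "c \<noteq> 0" unfolding c_def of_nat_eq_0_iff by simp
    have "((\<lambda>w. c * w) has_field_derivative c) (at w within S)" by (auto intro!: derivative_eq_intros)
    from DERIV_cdivide[OF DERIV_chain'[OF this d[OF nz[folded c_def]]], of "4 * c"]
    show ?thesis using c0 unfolding coth_term_def[abs_def] c_def[symmetric] by (simp add: mult_ac)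
  qed
  show "(Lcoth has_field_derivative (\<Sum>j. ?d j z)) (at z)"
    unfolding Lcoth_def[abs_def]
  proof (rule has_field_derivative_series'(2)[where S = S and ?x0.0 = z])
    show "convex S" by (simp add: S_def convex_halfspace_Re_ge)
    show "uniformly_convergent_on S (\<lambda>n x. \<Sum>i<n. ?d i x)"
      by (rule Weierstrass_m_test'[OF b1 sm])
  qed (use zS s0 der in auto)
qed

text \<open>Rests on 1/sinh (2 w) = coth w - coth (2 w). The derivative of \<open>Lcoth\<close> is a
  plain sum of -1/4 sinh^(-2), whose singular part at 0 is a pure double pole.\<close>

lemma Lev_eq_Lcoth:
  assumes "Re z > 0"
  shows "summable (\<lambda>j. lev_term j z)" "Lev z = Lcoth z - Lcoth (2 * z)"
proof -
  have e: "lev_term j z = coth_term j z - coth_term j (2 * z)" for j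
  proof -
    define w where "w = of_nat (Suc j) * z"
    have "Re w > 0" using assms by (simp add: w_def)
    hence nz: "sinh w \<noteq> 0" "cosh w \<noteq> 0" using sinh_nonzero cosh_nonzero by blast+
    have "1 / sinh (2 * w) = cosh w / sinh w - cosh (2 * w) / sinh (2 * w)"
    proof -
      have "cosh w / sinh w - cosh (2 * w) / sinh (2 * w) = ((cosh w)\<^sup>2 - (sinh w)\<^sup>2) / sinh (2 * w)"
        using nz by (simp add: sinh_double cosh_double divide_simps power2_eq_square)
      thus ?thesis by (simp add: hyperbolic_pythagoras)
    qed
    moreover have "2 * of_nat (Suc j) * z = 2 * w" "of_nat (Suc j) * (2 * z) = 2 * w" by (simp_all add: w_def algebra_simps)
    ultimately show ?thesis unfolding lev_term_def coth_term_def w_def[symmetric]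
    proof (simp only:)
      define c :: complex where "c = of_nat (Suc j)"
      have "c \<noteq> 0" unfolding c_def of_nat_eq_0_iff by simp
      have "1 / (4 * c * sinh (2 * w)) = (1 / sinh (2 * w)) / (4 * c)" by simp
      also have "\<dots> = ((cosh w / sinh w - 1) - (cosh (2 * w) / sinh (2 * w) - 1)) / (4 * c)"
        using \<open>1 / sinh (2 * w) = _\<close> by simp
      finally show "1 / (4 * c * sinh (2 * w)) = (cosh w / sinh w - 1) / (4 * c) - (cosh (2 * w) / sinh (2 * w) - 1) / (4 * c)"
        by (simp only: diff_divide_distrib)
    qed
  qed
  have "(\<lambda>j. coth_term j z - coth_term j (2 * z)) sums (Lcoth z - Lcoth (2 * z))"
    unfolding Lcoth_def using assms by (intro sums_diff summable_sums Lcoth_deriv(1)) auto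
  thus "summable (\<lambda>j. lev_term j z)" "Lev z = Lcoth z - Lcoth (2 * z)"
    by (simp_all add: Lev_def e sums_iff)
qed

text \<open>The derivative of \<open>Lod\<close> is a midpoint sum of step 2 z for the derivative of
  1/(2 cosh). That function is 1/2 at 0 and tends to 0 along the ray, so the sum is close to -1/(4
  z), the derivative of -(Ln z)/4. The bound is mostly 7 \<pi>/2 from the arctangent.\<close>

lemma Lod_deriv_sector:
  assumes "z \<in> sector" "norm z \<le> 1/10"
  shows "norm ((\<Sum>j. - sinh (of_nat (2 * j + 1) * z) / (2 * (cosh (of_nat (2 * j + 1) * z))\<^sup>2)) + 1 / (4 * z)) \<le> 25/2"
proof -
  let ?g = "\<lambda>z::complex. 1 / (2 * cosh z)"
  let ?g1 = "\<lambda>z::complex. - sinh z / (2 * (cosh z)\<^sup>2)"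
  have z0: "Re z > 0" "z \<noteq> 0" using assms by (auto simp: sector_def)
  have cnz: "cosh w \<noteq> 0" if "w \<in> sector" for w using that cosh_nonzero[of w] by (auto simp: sector_def)
  have arg: "of_real (real j + 1/2) * (2 * z) = of_nat (2 * j + 1) * z" for j
    by (simp add: algebra_simps)
  have lim: "(\<lambda>j. ?g (of_real (real j + 1/2) * (2 * z))) \<longlonglongrightarrow> 0"
  proof -
    have eq: "of_nat (2 * j + 1) * lod_term j z = ?g (of_real (real j + 1/2) * (2 * z))" for j
    proof -
      have "(of_nat (2 * j + 1) :: complex) \<noteq> 0" unfolding of_nat_eq_0_iff by simp
      thus ?thesis unfolding arg lod_term_def by (simp only: times_divide_eq_right mult.assoc) (simp add: divide_simps)
    qed
    have "(\<lambda>j. of_nat (2 * j + 1) * lod_term j z) \<longlonglongrightarrow> 0"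
    proof (rule Lim_null_comparison)
      show "\<forall>\<^sub>F j in sequentially. norm (of_nat (2 * j + 1) * lod_term j z) \<le> 1 / (2 * (real (2 * j + 1) * Re z))"
      proof (intro always_eventually allI)
        fix j
        have "real (2 * j + 1) * Re z \<le> norm (cosh (of_nat (2 * j + 1) * z))"
          using sinh_le_norm_cosh[of "of_nat (2 * j + 1) * z"] le_sinh[of "real (2 * j + 1) * Re z"] z0 by simp
        moreover have "real (2 * j + 1) * Re z > 0" using z0 by simp
        ultimately have "1 / (2 * norm (cosh (of_nat (2 * j + 1) * z))) \<le> 1 / (2 * (real (2 * j + 1) * Re z))"
          by (intro frac_le) auto
        moreover have "norm (of_nat (2 * j + 1) * lod_term j z) = 1 / (2 * norm (cosh (of_nat (2 * j + 1) * z)))"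
          unfolding eq arg norm_divide norm_mult by simp
        ultimately show "norm (of_nat (2 * j + 1) * lod_term j z) \<le> 1 / (2 * (real (2 * j + 1) * Re z))" by simp
      qed
      show "(\<lambda>j. 1 / (2 * (real (2 * j + 1) * Re z))) \<longlonglongrightarrow> 0" using z0 by real_asymp
    qed
    thus ?thesis by (simp only: eq)
  qed
  have "norm ((\<Sum>j. ?g1 (of_real (real j + 1/2) * (2 * z))) - (0 - ?g (of_real (1/2) * (2 * z))) / (2 * z)) \<le> 7 * (norm (2 * z) + pi / 2)"
  proof (rule Riemann_telescope[where ?g2.0 = "\<lambda>z. 1 / (2 * cosh z) - 1 / cosh z ^ 3"])
    show "2 * z \<in> sector" using sector_scale[OF assms(1), of 2] by simp
  qed (use half_sech_derivs[OF cnz] half_sech_deriv2_sector lim in auto)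
  hence 1: "norm ((\<Sum>j. ?g1 (of_nat (2 * j + 1) * z)) + ?g z / (2 * z)) \<le> 14 * norm z + 7 * pi / 2"
    unfolding arg by (simp add: norm_mult del: of_nat_add of_nat_mult of_nat_Suc)
  have 2: "norm (?g z / (2 * z) - 1 / (4 * z)) \<le> 1/50"
  proof -
    have nz: "norm z > 0" using z0 by simp
    have "norm (cosh z - 1) \<le> norm (cosh z - 1 - z\<^sup>2 / 2) + norm (z\<^sup>2 / 2)"
      using norm_triangle_ineq[of "cosh z - 1 - z\<^sup>2 / 2" "z\<^sup>2 / 2"] by simp
    also have "\<dots> \<le> norm z ^ 4 / 15 + (norm z)\<^sup>2 / 2"
      using norm_cosh_Taylor[of z] assms by (intro add_mono) (auto simp: norm_divide norm_power)
    also have "norm z ^ 4 \<le> (norm z)\<^sup>2" using assms by (intro power_decreasing) auto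
    finally have c1: "norm (cosh z - 1) \<le> (norm z)\<^sup>2 * (17/30)" by simp
    have c2: "norm (cosh z) \<ge> 4/5"
    proof (rule power2_le_imp_le)
      show "(4/5)\<^sup>2 \<le> (norm (cosh z))\<^sup>2" using norm_cosh_sector_sq(1)[OF assms(1)] by (simp add: power2_eq_square)
    qed simp
    have "?g z / (2 * z) - 1 / (4 * z) = - (cosh z - 1) / (4 * z * cosh z)"
      using z0 cnz[OF assms(1)] by (simp add: field_simps)
    also have "norm \<dots> = norm (cosh z - 1) / (4 * norm z * norm (cosh z))"
      by (simp add: norm_divide norm_mult norm_minus_commute)
    also have "\<dots> \<le> ((norm z)\<^sup>2 * (17/30)) / (4 * norm z * (4/5))"
      using c1 c2 nz by (intro frac_le mult_left_mono mult_pos_pos) auto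
    also have "\<dots> = norm z * (17/96)" using nz by (simp add: power2_eq_square)
    also have "\<dots> \<le> 1/50" using assms by simp
    finally show ?thesis .
  qed
  have "(\<Sum>j. ?g1 (of_nat (2 * j + 1) * z)) + 1 / (4 * z) =
     ((\<Sum>j. ?g1 (of_nat (2 * j + 1) * z)) + ?g z / (2 * z)) - (?g z / (2 * z) - 1 / (4 * z))" by simp
  also have "norm \<dots> \<le> (14 * norm z + 7 * pi / 2) + 1/50"
    by (intro order_trans[OF norm_triangle_ineq4] add_mono 1 2)
  also have "\<dots> \<le> 25/2" using assms pi_approx by simp
  finally show ?thesis .
qed

lemma inverse_squares_complex: "(\<lambda>j. 1 / (of_nat (Suc j) * z)\<^sup>2) sums (of_real (pi\<^sup>2 / 6) / z\<^sup>2)" for z :: complex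
proof -
  have "(\<lambda>n. 1 / (real n + 1)\<^sup>2) sums (pi\<^sup>2 / 6)"
    using inverse_squares_sums by (simp add: add.commute)
  hence "(\<lambda>j. of_real (1 / (real j + 1)\<^sup>2) / z\<^sup>2) sums (of_real (pi\<^sup>2 / 6) / z\<^sup>2)"
    by (intro sums_divide sums_of_real)
  thus ?thesis by (simp add: power_mult_distrib add_ac)
qed

text \<open>Writing sinh^(-2) as w^(-2) minus the derivative of \<open>coth_reg\<close>, the first
  part sums exactly to \<pi>^2/(6 z^2). The second is a Riemann sum, close to 1/z because
  \<open>coth_reg\<close> runs from 0 at the origin to 1 at infinity.\<close>

lemma Lcoth_deriv_sector:
  assumes "z \<in> sector" "norm z \<le> 1/10"
  shows "norm ((\<Sum>j. - 1 / (4 * (sinh (of_nat (Suc j) * z))\<^sup>2)) + of_real (pi\<^sup>2 / 24) / z\<^sup>2 - 1 / (4 * z)) \<le> 11"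
proof -
  let ?g1 = "\<lambda>z::complex. 1 / z\<^sup>2 - 1 / (sinh z)\<^sup>2"
  have z0: "Re z > 0" "z \<noteq> 0" using assms by (auto simp: sector_def)
  have nz: "w \<noteq> 0" "sinh w \<noteq> 0" if "w \<in> sector" for w using that sinh_nonzero[of w] by (auto simp: sector_def)
  have arg: "of_real (real j + 1) * z = of_nat (Suc j) * z" for j by simp
  have lim: "(\<lambda>j. coth_reg (of_real (real j + 1) * z)) \<longlonglongrightarrow> 1"
  proof -
    have eq: "4 * of_nat (Suc j) * coth_term j z = cosh (of_nat (Suc j) * z) / sinh (of_nat (Suc j) * z) - 1" for j
    proof -
      define c :: complex where "c = 4 * of_nat (Suc j)"
      have "c \<noteq> 0" by (simp add: c_def del: of_nat_Suc)
      thus ?thesis unfolding coth_term_def c_def[symmetric] by simp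
    qed
    have 1: "(\<lambda>j. 4 * of_nat (Suc j) * coth_term j z) \<longlonglongrightarrow> 0"
    proof (rule Lim_null_comparison)
      let ?D = "2 / (1 - exp (- 2 * Re z))"
      show "\<forall>\<^sub>F j in sequentially. norm (4 * of_nat (Suc j) * coth_term j z) \<le> ?D * exp (- (real (Suc j) * Re z))"
      proof (intro always_eventually allI)
        fix j
        have "1 * Re z \<le> real (Suc j) * Re z" using z0 by (intro mult_right_mono) auto
        hence "norm (cosh (of_nat (Suc j) * z) / sinh (of_nat (Suc j) * z) - 1) \<le> ?D * exp (- Re (of_nat (Suc j) * z))"
          using z0 by (intro norm_hyperbolic_decay(5)) auto
        thus "norm (4 * of_nat (Suc j) * coth_term j z) \<le> ?D * exp (- (real (Suc j) * Re z))"
          unfolding eq by simp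
      qed
      show "(\<lambda>j. ?D * exp (- (real (Suc j) * Re z))) \<longlonglongrightarrow> 0"
        by (rule summable_LIMSEQ_zero[OF summable_exp_linear[OF z0(1)]]) auto
    qed
    have "(\<lambda>j. 1 / (of_real (real j + 1) * z)) \<longlonglongrightarrow> 0"
    proof (rule Lim_null_comparison)
      show "\<forall>\<^sub>F j in sequentially. norm (1 / (of_real (real j + 1) * z)) \<le> 1 / ((real j + 1) * norm z)"
        unfolding norm_divide norm_mult norm_of_real by simp
      show "(\<lambda>j. 1 / ((real j + 1) * norm z)) \<longlonglongrightarrow> 0" using z0(2) by real_asymp
    qed
    from tendsto_diff[OF tendsto_add[OF 1 tendsto_const[of 1]] this]
    have "(\<lambda>j. 4 * of_nat (Suc j) * coth_term j z + 1 - 1 / (of_real (real j + 1) * z)) \<longlonglongrightarrow> 1" by simp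
    moreover have "4 * of_nat (Suc j) * coth_term j z + 1 - 1 / (of_real (real j + 1) * z) = coth_reg (of_real (real j + 1) * z)" for j
      unfolding arg coth_reg_def eq by simp
    ultimately show ?thesis by simp
  qed
  have "norm ((\<Sum>j. ?g1 (of_real (real j + 1) * z)) - (1 - coth_reg (of_real 1 * z)) / z) \<le> 25 * (norm z + pi / 2)"
    by (rule Riemann_telescope[where ?g2.0 = "\<lambda>z. 2 * cosh z / sinh z ^ 3 - 2 / z ^ 3"])
       (use coth_reg_derivs[OF nz(2,1)] coth_reg_deriv2_sector lim assms in auto)
  hence 1: "norm ((\<Sum>j. ?g1 (of_nat (Suc j) * z)) - (1 - coth_reg z) / z) \<le> 25 * (norm z + pi / 2)"
    unfolding arg by simp
  have "(\<lambda>j. 1 / (of_nat (Suc j) * z)\<^sup>2 - 1 / (sinh (of_nat (Suc j) * z))\<^sup>2) sums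
      (of_real (pi\<^sup>2 / 6) / z\<^sup>2 - (\<Sum>j. 1 / (sinh (of_nat (Suc j) * z))\<^sup>2))"
    by (intro sums_diff inverse_squares_complex summable_sums Lcoth_deriv(2) z0)
  hence 2: "(\<Sum>j. ?g1 (of_nat (Suc j) * z)) = of_real (pi\<^sup>2 / 6) / z\<^sup>2 - (\<Sum>j. 1 / (sinh (of_nat (Suc j) * z))\<^sup>2)"
    by (simp add: sums_iff)
  have "(\<lambda>j. - 1 / 4 * (1 / (sinh (of_nat (Suc j) * z))\<^sup>2)) sums (- 1 / 4 * (\<Sum>j. 1 / (sinh (of_nat (Suc j) * z))\<^sup>2))"
    by (intro sums_mult summable_sums Lcoth_deriv(2) z0)
  hence 3: "(\<Sum>j. - 1 / (4 * (sinh (of_nat (Suc j) * z))\<^sup>2)) = - 1 / 4 * (\<Sum>j. 1 / (sinh (of_nat (Suc j) * z))\<^sup>2)"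
    by (simp add: sums_iff)
  have "(\<Sum>j. - 1 / (4 * (sinh (of_nat (Suc j) * z))\<^sup>2)) + of_real (pi\<^sup>2 / 24) / z\<^sup>2 - 1 / (4 * z)
     = 1/4 * (((\<Sum>j. ?g1 (of_nat (Suc j) * z)) - (1 - coth_reg z) / z) - coth_reg z / z)"
    unfolding 2 3 using z0 by (simp add: diff_divide_distrib algebra_simps)
  also have "norm \<dots> \<le> 1/4 * (25 * (norm z + pi / 2) + 1)"
  proof -
    have "norm (coth_reg z / z) \<le> 1" unfolding norm_divide
      using norm_coth_reg_le[of z] assms z0 by (auto simp: divide_le_eq)
    hence "norm (((\<Sum>j. ?g1 (of_nat (Suc j) * z)) - (1 - coth_reg z) / z) - coth_reg z / z) \<le> 25 * (norm z + pi / 2) + 1"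
      by (intro order_trans[OF norm_triangle_ineq4] add_mono 1)
    thus ?thesis unfolding norm_mult by simp
  qed
  also have "\<dots> \<le> 11" using assms pi_approx by simp
  finally show ?thesis .
qed

subsection \<open>Expansions near the real axis\<close>

lemma sector_Ln: "z \<in> sector \<Longrightarrow> (Ln has_field_derivative 1 / z) (at z)"
  using has_field_derivative_Ln[of z] by (force simp: sector_def complex_nonpos_Reals_iff field_simps)

text \<open>The derivative estimate determines \<open>Lod\<close> only up to an additive constant.
  Stating it for two points allows one of them to tend to 0 later, where the constant is read
  off.\<close>

lemma Lod_Lipschitz:
  assumes "z \<in> sector" "norm z \<le> 1/10" "w \<in> sector" "norm w \<le> 1/10"
  shows "norm ((Lod z + Ln z / 4) - (Lod w + Ln w / 4)) \<le> 25/2 * norm (z - w)"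
proof (rule field_differentiable_bound)
  show "convex (sector \<inter> cball 0 (1/10))" by (intro convex_Int convex_sector convex_cball)
  show "z \<in> sector \<inter> cball 0 (1/10)" "w \<in> sector \<inter> cball 0 (1/10)" using assms by auto
  fix x assume x: "x \<in> sector \<inter> cball 0 (1/10)"
  let ?d = "(\<Sum>j. - sinh (of_nat (2 * j + 1) * x) / (2 * (cosh (of_nat (2 * j + 1) * x))\<^sup>2)) + 1 / (4 * x)"
  show "((\<lambda>z. Lod z + Ln z / 4) has_field_derivative ?d) (at x within sector \<inter> cball 0 (1/10))"
  proof (rule has_field_derivative_at_within)
    have "Re x > 0" "x \<in> sector" using x by (auto simp: sector_def)
    from DERIV_add[OF Lod_deriv(2)[OF this(1)] DERIV_cdivide[OF sector_Ln[OF this(2)], of 4]]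
    show "((\<lambda>z. Lod z + Ln z / 4) has_field_derivative ?d) (at x)"
      by (simp only: divide_divide_eq_left mult.commute[of x 4])
  qed
  show "norm ?d \<le> 25/2" using x by (intro Lod_deriv_sector) auto
qed

text \<open>Unlike for \<open>Lod\<close>, no constant has to be found: \<open>Lev\<close> is a
  difference of values of \<open>Lcoth\<close> at z and 2 z, so the constant of integration cancels,
  and (ln 2)/4 is what the logarithm contributes. The radius is halved to keep 2 z within
  1/10.\<close>

lemma Lev_expansion:
  assumes "z \<in> sector" "norm z \<le> 1/20"
  shows "norm (Lev z - of_real (pi\<^sup>2 / 48) / z + of_real (ln 2 / 4)) \<le> 11 * norm z"
proof -
  let ?F = "\<lambda>z. Lcoth z - of_real (pi\<^sup>2 / 24) / z - Ln z / 4"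
  have z0: "Re z > 0" "z \<noteq> 0" using assms by (auto simp: sector_def)
  have "norm (?F z - ?F (2 * z)) \<le> 11 * norm (z - 2 * z)"
  proof (rule field_differentiable_bound)
    show "convex (sector \<inter> cball 0 (1/10))" by (intro convex_Int convex_sector convex_cball)
    show "z \<in> sector \<inter> cball 0 (1/10)" "2 * z \<in> sector \<inter> cball 0 (1/10)"
      using assms sector_scale[of z 2] by (auto simp: norm_mult)
    fix x assume x: "x \<in> sector \<inter> cball 0 (1/10)"
    hence x0: "Re x > 0" "x \<noteq> 0" by (auto simp: sector_def)
    let ?d = "(\<Sum>j. - 1 / (4 * (sinh (of_nat (Suc j) * x))\<^sup>2)) + of_real (pi\<^sup>2 / 24) / x\<^sup>2 - 1 / (4 * x)"
    have "((\<lambda>z. of_real (pi\<^sup>2 / 24) / z) has_field_derivative (- of_real (pi\<^sup>2 / 24) / x\<^sup>2)) (at x)"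
      using x0 by (auto intro!: derivative_eq_intros simp: power2_eq_square)
    from DERIV_diff[OF DERIV_diff[OF Lcoth_deriv(3)[OF x0(1)] this] DERIV_cdivide[OF sector_Ln[of x], of 4]] x
    have "(?F has_field_derivative (\<Sum>j. - 1 / (4 * (sinh (of_nat (Suc j) * x))\<^sup>2)) - - of_real (pi\<^sup>2 / 24) / x\<^sup>2 - 1 / x / 4) (at x)"
      by blast
    moreover have "(\<Sum>j. - 1 / (4 * (sinh (of_nat (Suc j) * x))\<^sup>2)) - - of_real (pi\<^sup>2 / 24) / x\<^sup>2 - 1 / x / 4 = ?d"
      by (simp only: minus_divide_left[symmetric] diff_minus_eq_add divide_divide_eq_left mult.commute[of x 4])
    ultimately have "(?F has_field_derivative ?d) (at x)" by (simp only:)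
    thus "(?F has_field_derivative ?d) (at x within sector \<inter> cball 0 (1/10))"
      by (rule has_field_derivative_at_within)
    show "norm ?d \<le> 11" using x by (intro Lcoth_deriv_sector) auto
  qed
  also have "norm (z - 2 * z) = norm z" by (simp add: norm_minus_commute)
  also have "?F z - ?F (2 * z) = Lev z - of_real (pi\<^sup>2 / 48) / z + of_real (ln 2 / 4)"
  proof -
    have "Ln (2 * z) = of_real (ln 2) + Ln z" using Ln_times_of_real[of 2 z] Ln_of_real[of 2] z0 by simp
    thus ?thesis unfolding Lev_eq_Lcoth(2)[OF z0(1)] using z0 by (simp add: field_simps)
  qed
  finally show ?thesis .
qed

subsection \<open>The generating function\<close>

definition gf_prod :: "nat \<Rightarrow> complex \<Rightarrow> complex" where
  "gf_prod N z = (\<Prod>i<N. inverse (1 + (-1) ^ (i + 1) * z ^ (2 * i + 1)))"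

text \<open>The coefficientwise embedding of real series into complex ones. It links the formal
  factors to the expansions of holomorphic functions, whose coefficients are complex.\<close>

definition fps_complexify :: "real fps \<Rightarrow> complex fps" where
  "fps_complexify F = Abs_fps (\<lambda>n. of_real (fps_nth F n))"

lemma fps_complexify_nth [simp]: "fps_nth (fps_complexify F) n = of_real (fps_nth F n)"
  by (simp add: fps_complexify_def)

lemma fps_complexify_mult: "fps_complexify (F * G) = fps_complexify F * fps_complexify G"
  by (simp add: fps_eq_iff fps_mult_nth)

lemma fps_complexify_1: "fps_complexify 1 = 1"
  by (simp add: fps_eq_iff)

lemma fps_complexify_gf_factor:
  "fps_complexify (gf_factor i) = inverse (1 + (-1) ^ (i + 1) * fps_X ^ (2 * i + 1))"
proof -
  have "fps_complexify (1 + (-1) ^ (i + 1) * fps_X ^ (2 * i + 1)) = 1 + (-1) ^ (i + 1) * fps_X ^ (2 * i + 1)"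
    by (rule fps_ext) (auto simp: fps_X_power_mult_right_nth minus_one_power_iff)
  hence "fps_complexify (gf_factor i) * (1 + (-1) ^ (i + 1) * fps_X ^ (2 * i + 1)) = 1"
    using arg_cong[OF gf_factor_mult[of i], of fps_complexify] by (simp only: fps_complexify_mult fps_complexify_1)
  thus ?thesis by (metis fps_inverse_unique mult.commute)
qed

lemma gf_prod_has_fps_expansion:
  "gf_prod N has_fps_expansion fps_complexify (\<Prod>i<N. gf_factor i)"
proof (induction N)
  case 0
  show ?case by (simp add: gf_prod_def[abs_def] fps_complexify_1)
next
  case (Suc N)
  have "(\<lambda>z::complex. inverse (1 + (-1) ^ (N + 1) * z ^ (2 * N + 1))) has_fps_expansion inverse (1 + fps_const ((-1) ^ (N + 1)) * fps_X ^ (2 * N + 1))"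
  proof -
    define c :: complex where "c = (-1) ^ (N + 1)"
    have "(\<lambda>z::complex. inverse (1 + c * z ^ (2 * N + 1))) has_fps_expansion inverse (1 + fps_const c * fps_X ^ (2 * N + 1))"
      by (intro fps_expansion_intros) auto
    thus ?thesis by (simp only: c_def)
  qed
  hence "(\<lambda>z. inverse (1 + (-1) ^ (N + 1) * z ^ (2 * N + 1))) has_fps_expansion fps_complexify (gf_factor N)"
    by (simp add: fps_complexify_gf_factor flip: fps_const_power fps_const_neg)
  from has_fps_expansion_mult[OF Suc this] show ?case
    by (simp add: gf_prod_def[abs_def] fps_complexify_mult mult.commute)
qed

lemma gf_prod_denominator:
  assumes "norm (z::complex) < 1"
  shows "1 + (-1) ^ (i + 1) * z ^ (2 * i + 1) \<noteq> 0"
proof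
  assume "1 + (-1) ^ (i + 1) * z ^ (2 * i + 1) = 0"
  hence "(-1) ^ (i + 1) * z ^ (2 * i + 1) = -1" by (simp add: add_eq_0_iff)
  hence "norm ((-1) ^ (i + 1) * z ^ (2 * i + 1)) = 1" by simp
  hence "norm z ^ (2 * i + 1) = 1" by (simp add: norm_mult norm_power)
  moreover have "norm z ^ (2 * i + 1) < 1" using assms by (subst power_less_one_iff) auto
  ultimately show False by simp
qed

lemma gf_prod_holomorphic: "gf_prod N holomorphic_on ball 0 1"
  unfolding gf_prod_def[abs_def] using gf_prod_denominator by (intro holomorphic_intros) auto

lemma is_coeff_seq_eventually:
  assumes "is_coeff_seq a"
  shows "\<forall>\<^sub>F N in sequentially. fps_nth (\<Prod>i<N. gf_factor i) n = of_int (a n)"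
proof -
  \<comment> \<open>Nonzero factors exclude the case of \<open>has_prod\<close> in which a product
    with zero factors has the value 0.\<close>
  have "gf_factor i \<noteq> 0" for i using gf_factor_nth_0[of i] by auto
  hence "(\<lambda>N. \<Prod>i\<le>N. gf_factor i) \<longlonglongrightarrow> Abs_fps (\<lambda>n. of_int (a n))"
    using assms by (simp add: is_coeff_seq_def has_prod_def raw_has_prod_def)
  hence "\<forall>\<^sub>F N in sequentially. fps_nth (\<Prod>i\<le>N. gf_factor i) n = of_int (a n)"
    by (simp add: tendsto_fps_iff)
  hence "\<forall>\<^sub>F N in sequentially. fps_nth (\<Prod>i<Suc N. gf_factor i) n = of_int (a n)"
    by (simp only: lessThan_Suc_atMost)
  thus ?thesis by (subst eventually_sequentially_Suc[symmetric])
qed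

text \<open>Cauchy's formula is used for the finite products, whose n-th coefficient is eventually
  the desired one; the limit is taken under the integral afterwards. With z = t - i \<theta> the
  point exp (- z) traverses the circle counterclockwise.\<close>

lemma Cauchy_gf_prod:
  assumes t: "t > 0"
  shows "((\<lambda>\<theta>. gf_prod N (exp (- Complex t (- \<theta>))) * exp (of_nat n * Complex t (- \<theta>))) has_integral
            of_real (2 * pi * fps_nth (\<Prod>i<N. gf_factor i) n)) {0..2*pi}"
proof -
  define r where "r = exp (- t)"
  have r: "0 < r" "r < 1" using t by (auto simp: r_def)
  have sub: "cball 0 r \<subseteq> ball (0::complex) 1" using r by auto
  have c: "(deriv ^^ n) (gf_prod N) 0 / fact n = of_real (fps_nth (\<Prod>i<N. gf_factor i) n)"
    using fps_nth_fps_expansion[OF gf_prod_has_fps_expansion, of N n] by simp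
  have "((\<lambda>u. gf_prod N u / (u - 0) ^ Suc n) has_contour_integral
      (2 * pi * \<i>) / fact n * (deriv ^^ n) (gf_prod N) 0) (circlepath 0 r)"
  proof (rule Cauchy_has_contour_integral_higher_derivative_circlepath)
    show "continuous_on (cball 0 r) (gf_prod N)"
      using gf_prod_holomorphic sub by (meson holomorphic_on_imp_continuous_on continuous_on_subset)
    show "gf_prod N holomorphic_on ball 0 r"
      using gf_prod_holomorphic sub by (meson ball_subset_cball holomorphic_on_subset)
  qed (use r in auto)
  hence "((\<lambda>\<theta>. gf_prod N (0 + of_real r * cis \<theta>) / (0 + of_real r * cis \<theta> - 0) ^ Suc n * of_real r * \<i> * cis \<theta>) has_integral
      (2 * pi * \<i>) / fact n * (deriv ^^ n) (gf_prod N) 0) {0..2*pi}"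
    unfolding circlepath_def by (subst (asm) has_contour_integral_part_circlepath_iff) auto
  from has_integral_mult_right[OF this, of "- \<i>"]
  have I: "((\<lambda>\<theta>. - \<i> * (gf_prod N (0 + of_real r * cis \<theta>) / (0 + of_real r * cis \<theta> - 0) ^ Suc n * of_real r * \<i> * cis \<theta>)) has_integral
      - \<i> * ((2 * pi * \<i>) / fact n * (deriv ^^ n) (gf_prod N) 0)) {0..2*pi}" .
  have e1: "- \<i> * ((2 * pi * \<i>) / fact n * (deriv ^^ n) (gf_prod N) 0) = of_real (2 * pi * fps_nth (\<Prod>i<N. gf_factor i) n)"
  proof -
    have "- \<i> * ((2 * pi * \<i>) / fact n * (deriv ^^ n) (gf_prod N) 0) = (- \<i> * (2 * pi * \<i>)) * ((deriv ^^ n) (gf_prod N) 0 / fact n)"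
      by (simp only: times_divide_eq_left times_divide_eq_right mult.assoc)
    also have "- \<i> * (2 * pi * \<i>) = 2 * pi" by simp
    finally have "- \<i> * ((2 * pi * \<i>) / fact n * (deriv ^^ n) (gf_prod N) 0) = 2 * pi * ((deriv ^^ n) (gf_prod N) 0 / fact n)" .
    thus ?thesis unfolding c of_real_mult of_real_numeral .
  qed
  have e2: "- \<i> * (gf_prod N (0 + of_real r * cis \<theta>) / (0 + of_real r * cis \<theta> - 0) ^ Suc n * of_real r * \<i> * cis \<theta>)
     = gf_prod N (exp (- Complex t (- \<theta>))) * exp (of_nat n * Complex t (- \<theta>))" for \<theta>
  proof -
    have q: "exp (- Complex t (- \<theta>)) = of_real r * cis \<theta>"
      by (simp add: complex_eq_iff Re_exp Im_exp r_def)
    have "exp (of_nat n * Complex t (- \<theta>)) = (inverse (of_real r * cis \<theta>)) ^ n"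
      by (simp add: exp_of_nat_mult exp_minus flip: q)
    thus ?thesis unfolding q using r by (simp add: field_simps power_inverse)
  qed
  show ?thesis using I unfolding e1 e2 .
qed

subsection \<open>The logarithm of the generating function\<close>

text \<open>Expanding the logarithm of each factor into powers of (-1)^i q^(2 i + 1) and summing the
  geometric series over i first gives this series. Its term for n = 0 is 0, by division by
  0.\<close>

definition log_gf :: "complex \<Rightarrow> complex" where
  "log_gf z = (\<Sum>n. exp (- of_nat n * z) / (1 - (-1) ^ n * exp (- 2 * of_nat n * z)) / of_nat n)"

lemma log_gf_terms:
  assumes z: "Re z > 0" and r: "r = exp (- Re z)"
  defines "l \<equiv> \<lambda>n. exp (- of_nat n * z) / (1 - (-1) ^ n * exp (- 2 * of_nat n * z)) / of_nat n"
  shows "norm (l n) \<le> r ^ n / (1 - r)" "summable l"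
proof -
  have r01: "0 < r" "r < 1" using z by (auto simp: r)
  have b: "norm (l n) \<le> r ^ n / (1 - r)" for n
  proof (cases "n = 0")
    case False
    have "norm ((-1) ^ n * exp (- 2 * of_nat n * z)) = r ^ (2 * n)"
      by (simp add: norm_mult norm_power r flip: exp_of_nat_mult)
    also have "\<dots> \<le> r ^ 1" using r01 False by (intro power_decreasing) auto
    finally have "1 - r \<le> 1 - norm ((-1) ^ n * exp (- 2 * of_nat n * z))" by simp
    also have "\<dots> \<le> norm (1 - (-1) ^ n * exp (- 2 * of_nat n * z))"
      using norm_triangle_ineq2[of 1 "(-1) ^ n * exp (- 2 * of_nat n * z)"] by simp
    finally have d: "1 - r \<le> norm (1 - (-1) ^ n * exp (- 2 * of_nat n * z))" .
    have "norm (exp (- of_nat n * z)) = r ^ n" by (simp add: r flip: exp_of_nat_mult)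
    hence "norm (l n) = r ^ n / norm (1 - (-1) ^ n * exp (- 2 * of_nat n * z)) / real n"
      unfolding l_def norm_divide norm_of_nat by simp
    also have "\<dots> \<le> r ^ n / norm (1 - (-1) ^ n * exp (- 2 * of_nat n * z)) / 1"
      using False r01 by (intro divide_left_mono) auto
    also have "\<dots> \<le> r ^ n / (1 - r)" using d r01 by (simp add: frac_le)
    finally show ?thesis .
  qed (use r01 in \<open>simp add: l_def\<close>)
  show "norm (l n) \<le> r ^ n / (1 - r)" by (rule b)
  have "summable (\<lambda>n. r ^ n / (1 - r))" using r01 by (intro summable_divide summable_geometric) auto
  thus "summable l" by (rule summable_comparison_test') (rule b)
qed

text \<open>The parity of n decides between the denominators 1 + q^(2 n) and 1 - q^(2 n), hence
  between cosh and sinh. The terms are grouped in pairs n = 2 j + 1, 2 j + 2.\<close>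

lemma log_gf_eq:
  assumes z: "Re z > 0"
  shows "log_gf z = Lev z + Lod z"
proof -
  define l where "l = (\<lambda>n. exp (- of_nat n * z) / (1 - (-1) ^ n * exp (- 2 * of_nat n * z)) / of_nat n)"
  have "l sums log_gf z" unfolding log_gf_def l_def by (intro summable_sums log_gf_terms(2)[OF z refl])
  hence "(\<lambda>n. l (Suc n)) sums log_gf z"
    using sums_Suc_iff[of l] by (simp add: l_def)
  from sums_group[OF this, of 2]
  have "(\<lambda>j. \<Sum>n\<in>{j * 2..<j * 2 + 2}. l (Suc n)) sums log_gf z" by simp
  moreover have "(\<Sum>n\<in>{j * 2..<j * 2 + 2}. l (Suc n)) = lod_term j z + lev_term j z" for j
  proof -
    have "{j * 2..<j * 2 + 2} = {2 * j, 2 * j + 1}" by auto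
    hence "(\<Sum>n\<in>{j * 2..<j * 2 + 2}. l (Suc n)) = l (2 * j + 1) + l (2 * Suc j)" by simp
    moreover have "l (2 * j + 1) = lod_term j z"
    proof -
      define m where "m = 2 * j + 1"
      define w where "w = of_nat m * z"
      have "Re w > 0" using z by (simp add: w_def m_def)
      hence "cosh w \<noteq> 0" by (rule cosh_nonzero)
      have "exp w * (1 + exp (-w) * exp (-w)) = 2 * cosh w"
        by (simp add: cosh_field_def distrib_left flip: exp_add)
      hence "1 + exp (-w) * exp (-w) = 2 * cosh w * exp (-w)" by (simp add: exp_minus field_simps)
      hence "exp (- w) / (1 + exp (-w) * exp (-w)) = 1 / (2 * cosh w)" by simp
      moreover have "l m = exp (- w) / (1 + exp (-w) * exp (-w)) / of_nat m"
      proof -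
        have "(-1::complex) ^ m = -1" by (simp add: m_def)
        moreover have "- of_nat m * z = - w" "- 2 * of_nat m * z = -w + -w" by (simp_all add: w_def)
        ultimately show ?thesis unfolding l_def by (simp only: exp_add) simp
      qed
      ultimately show ?thesis unfolding lod_term_def m_def[symmetric] w_def[symmetric] by simp
    qed
    moreover have "l (2 * Suc j) = lev_term j z"
    proof -
      define m where "m = 2 * Suc j"
      define w where "w = of_nat m * z"
      have "Re w > 0" using z by (simp add: w_def m_def)
      hence "sinh w \<noteq> 0" by (rule sinh_nonzero)
      have "exp w * (1 - exp (-w) * exp (-w)) = 2 * sinh w"
        by (simp add: sinh_field_def right_diff_distrib flip: exp_add)
      hence "1 - exp (-w) * exp (-w) = 2 * sinh w * exp (-w)" by (simp add: exp_minus field_simps)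
      hence "exp (- w) / (1 - exp (-w) * exp (-w)) = 1 / (2 * sinh w)" by simp
      moreover have "l m = exp (- w) / (1 - exp (-w) * exp (-w)) / of_nat m"
      proof -
        have "(-1::complex) ^ m = 1" by (simp add: m_def)
        moreover have "- of_nat m * z = - w" "- 2 * of_nat m * z = -w + -w" by (simp_all add: w_def)
        ultimately show ?thesis unfolding l_def by (simp only: exp_add) simp
      qed
      moreover have "of_nat m = 2 * (of_nat (Suc j) :: complex)" "w = 2 * of_nat (Suc j) * z"
        unfolding w_def m_def of_nat_mult by simp_all
      ultimately show ?thesis unfolding lev_term_def m_def[symmetric] by (simp del: of_nat_Suc)
    qed
    ultimately show ?thesis by simp
  qed
  ultimately have "(\<lambda>j. lod_term j z + lev_term j z) sums log_gf z" by simp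
  moreover have "(\<lambda>j. lod_term j z + lev_term j z) sums (Lod z + Lev z)"
    unfolding Lod_def Lev_def using z by (intro sums_add summable_sums Lod_deriv(1) Lev_eq_Lcoth(1))
  ultimately show ?thesis using sums_unique2 by (metis add.commute)
qed

text \<open>Stopping the geometric series after N factors multiplies the n-th term by 1 - R_n^N. The
  discarded part is bounded through |q| alone, hence uniformly on the circle.\<close>

lemma gf_prod_exp:
  assumes z: "Re z > 0" and r: "r = exp (- Re z)"
  obtains d where "gf_prod N (exp (- z)) = exp (log_gf z + d)" "norm d \<le> r ^ N / (1 - r)\<^sup>2"
proof -
  define q where "q = exp (- z)"
  have r01: "0 < r" "r < 1" using z by (auto simp: r)
  have nq: "norm q = r" by (simp add: q_def r)
  define l where "l = (\<lambda>n. exp (- of_nat n * z) / (1 - (-1) ^ n * exp (- 2 * of_nat n * z)) / of_nat n)"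
  define R where "R = (\<lambda>n. (-1) ^ n * q ^ (2 * n))"
  have le: "l n = q ^ n / (1 - R n) / of_nat n" for n
    unfolding l_def R_def q_def by (simp add: mult_ac flip: exp_of_nat_mult)
  have ls: "l sums log_gf z" unfolding log_gf_def l_def by (intro summable_sums log_gf_terms(2)[OF z refl])
  have nR: "norm (R n) = r ^ (2 * n)" for n by (simp add: R_def norm_mult norm_power nq)
  have R1: "R n \<noteq> 1" if "n > 0" for n
  proof
    assume "R n = 1"
    hence "r ^ (2 * n) = 1" using nR[of n] by simp
    moreover have "r ^ (2 * n) < 1" using r01 that by (subst power_less_one_iff) auto
    ultimately show False by simp
  qed
  define \<zeta> where "\<zeta> = (\<lambda>i. (-1) ^ i * q ^ (2 * i + 1))"
  have n\<zeta>: "norm (\<zeta> i) < 1" for i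
  proof -
    have "norm (\<zeta> i) = r ^ (2 * i + 1)" by (simp add: \<zeta>_def norm_mult norm_power nq)
    also have "\<dots> < 1" using r01 by (subst power_less_one_iff) auto
    finally show ?thesis .
  qed
  have fac: "inverse (1 + (-1) ^ (i + 1) * q ^ (2 * i + 1)) = exp (- Ln (1 - \<zeta> i))" for i
  proof -
    have "1 - \<zeta> i \<noteq> 0" using n\<zeta>[of i] by auto
    hence "exp (- Ln (1 - \<zeta> i)) = inverse (1 - \<zeta> i)" by (simp add: exp_minus)
    thus ?thesis by (simp add: \<zeta>_def)
  qed
  have lns: "(\<lambda>n. \<zeta> i ^ n / of_nat n) sums (- Ln (1 - \<zeta> i))" for i
    using sums_minus[OF Ln_series'[of "- \<zeta> i"]] n\<zeta>[of i] by simp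
  have "(\<lambda>n. \<Sum>i<N. \<zeta> i ^ n / of_nat n) sums (\<Sum>i<N. - Ln (1 - \<zeta> i))"
    by (intro sums_sum lns)
  moreover have "(\<Sum>i<N. \<zeta> i ^ n / of_nat n) = l n - l n * R n ^ N" for n
  proof (cases "n = 0")
    case False
    have "(\<Sum>i<N. \<zeta> i ^ n) = (\<Sum>i<N. q ^ n * R n ^ i)"
    proof (intro sum.cong refl)
      fix i
      have "\<zeta> i ^ n = ((-1) ^ i) ^ n * (q ^ (2 * i + 1)) ^ n" unfolding \<zeta>_def by (rule power_mult_distrib)
      also have "((-1::complex) ^ i) ^ n = ((-1) ^ n) ^ i" by (simp add: mult.commute flip: power_mult)
      also have "(q ^ (2 * i + 1)) ^ n = q ^ n * (q ^ (2 * n)) ^ i" 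
        by (simp add: algebra_simps flip: power_mult power_add)
      finally show "\<zeta> i ^ n = q ^ n * R n ^ i" unfolding R_def power_mult_distrib by simp
    qed
    also have "\<dots> = q ^ n * ((1 - R n ^ N) / (1 - R n))"
      using R1[of n] False by (simp add: sum_gp_strict flip: sum_distrib_left)
    finally have "(\<Sum>i<N. \<zeta> i ^ n / of_nat n) = q ^ n * ((1 - R n ^ N) / (1 - R n)) / of_nat n"
      by (simp add: sum_divide_distrib[symmetric])
    thus ?thesis unfolding le by (simp add: right_diff_distrib diff_divide_distrib)
  qed (simp add: le)
  ultimately have S: "(\<lambda>n. l n - l n * R n ^ N) sums (\<Sum>i<N. - Ln (1 - \<zeta> i))" by simp
  have D: "(\<lambda>n. - (l n * R n ^ N)) sums ((\<Sum>i<N. - Ln (1 - \<zeta> i)) - log_gf z)"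
    using sums_diff[OF S ls] by simp
  define d where "d = (\<Sum>i<N. - Ln (1 - \<zeta> i)) - log_gf z"
  have "gf_prod N (exp (- z)) = exp (log_gf z + d)"
    unfolding gf_prod_def q_def[symmetric] fac by (simp add: d_def exp_sum)
  moreover have "norm d \<le> r ^ N / (1 - r)\<^sup>2"
  proof -
    have b: "norm (- (l n * R n ^ N)) \<le> r ^ N / (1 - r) * r ^ n" for n
    proof (cases "n = 0")
      case False
      have "norm (R n ^ N) \<le> r ^ N"
      proof -
        have "norm (R n ^ N) = r ^ (2 * n * N)" by (simp add: norm_power nR flip: power_mult)
        also have "\<dots> \<le> r ^ N" using r01 False by (intro power_decreasing) auto
        finally show ?thesis .
      qed
      moreover have "norm (l n) \<le> r ^ n / (1 - r)" unfolding l_def by (rule log_gf_terms(1)[OF z r])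
      ultimately have "norm (l n) * norm (R n ^ N) \<le> r ^ n / (1 - r) * r ^ N"
        using r01 by (intro mult_mono) auto
      thus ?thesis by (simp add: norm_mult mult_ac)
    qed (use r01 in \<open>simp add: le\<close>)
    have g: "(\<lambda>n. r ^ N / (1 - r) * r ^ n) sums (r ^ N / (1 - r) * (1 / (1 - r)))"
      using r01 by (intro sums_mult geometric_sums) auto
    have "norm (\<Sum>n. - (l n * R n ^ N)) \<le> (\<Sum>n. r ^ N / (1 - r) * r ^ n)"
      using b g by (intro norm_suminf_le) (auto simp: sums_iff)
    thus ?thesis using D g by (simp add: d_def sums_iff power2_eq_square)
  qed
  ultimately show ?thesis using that by blast
qed

lemma norm_exp_minus_1_le: "norm (exp d - 1) \<le> norm d * exp (norm (d::complex))"
proof -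
  have "norm (exp d - (\<Sum>i\<le>0. d ^ i / fact i)) \<le> exp \<bar>Re d\<bar> * norm d ^ Suc 0 / fact 0" by (rule Taylor_exp)
  hence "norm (exp d - 1) \<le> exp \<bar>Re d\<bar> * norm d" by simp
  also have "\<dots> \<le> exp (norm d) * norm d" using abs_Re_le_cmod[of d] by (intro mult_right_mono) auto
  finally show ?thesis by (simp add: mult.commute)
qed

text \<open>The integrands of the finite products converge uniformly on the circle while their
  integrals are eventually constant.\<close>

lemma coeff_integral_0_2pi:
  assumes a: "is_coeff_seq a" and t: "t > 0"
  shows "((\<lambda>\<theta>. exp (log_gf (Complex t (- \<theta>)) + of_nat n * Complex t (- \<theta>))) has_integral of_real (2 * pi * of_int (a n))) {0..2*pi}"
proof -
  define r where "r = exp (- t)"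
  have r: "0 < r" "r < 1" using t by (auto simp: r_def)
  define M where "M = 1 / (1 - r)\<^sup>2 + real n * t"
  let ?z = "\<lambda>\<theta>. Complex t (- \<theta>)"
  let ?f = "\<lambda>N \<theta>. gf_prod N (exp (- ?z \<theta>)) * exp (of_nat n * ?z \<theta>)"
  let ?g = "\<lambda>\<theta>. exp (log_gf (?z \<theta>) + of_nat n * ?z \<theta>)"
  define e where "e = (\<lambda>N. r ^ N / (1 - r)\<^sup>2)"
  have e0: "e \<longlonglongrightarrow> 0" unfolding e_def using r by (intro tendsto_divide_zero LIMSEQ_realpow_zero) auto
  have gb: "norm (?g \<theta>) \<le> exp M" for \<theta>
  proof -
    have z: "Re (?z \<theta>) > 0" "r = exp (- Re (?z \<theta>))" using t by (simp_all add: r_def)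
    have "norm (log_gf (?z \<theta>)) \<le> (\<Sum>m. r ^ m / (1 - r))"
      unfolding log_gf_def using r by (intro norm_suminf_le log_gf_terms(1)[OF z] summable_divide summable_geometric) auto
    also have "\<dots> = 1 / (1 - r) / (1 - r)" using r by (subst suminf_divide) (auto simp: suminf_geometric)
    finally have "norm (log_gf (?z \<theta>)) \<le> 1 / (1 - r)\<^sup>2" by (simp add: power2_eq_square)
    hence "Re (log_gf (?z \<theta>)) \<le> 1 / (1 - r)\<^sup>2" using complex_Re_le_cmod order_trans by blast
    thus ?thesis by (simp add: M_def)
  qed
  have diff: "norm (?f N \<theta> - ?g \<theta>) \<le> exp M * (e N * exp (e N))" for N \<theta>
  proof -
    have z: "Re (?z \<theta>) > 0" "r = exp (- Re (?z \<theta>))" using t by (simp_all add: r_def)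
    from gf_prod_exp[OF z] obtain d where d: "gf_prod N (exp (- ?z \<theta>)) = exp (log_gf (?z \<theta>) + d)" "norm d \<le> e N"
      unfolding e_def by blast
    have "?f N \<theta> - ?g \<theta> = ?g \<theta> * (exp d - 1)" unfolding d(1) by (simp add: exp_add algebra_simps)
    also have "norm \<dots> \<le> exp M * (norm d * exp (norm d))"
      unfolding norm_mult by (intro mult_mono gb norm_exp_minus_1_le) auto
    also have "\<dots> \<le> exp M * (e N * exp (e N))" using d(2) by (intro mult_left_mono mult_mono) (auto intro: order_trans[OF norm_ge_zero])
    finally show ?thesis .
  qed
  have lim: "(\<lambda>N. exp M * (e N * exp (e N))) \<longlonglongrightarrow> 0"
    using tendsto_mult[OF tendsto_const[of "exp M"] tendsto_mult[OF e0 tendsto_exp[OF e0]]] by simp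
  have u: "uniform_limit {0..2*pi} ?f ?g sequentially"
  proof (rule uniform_limitI)
    fix \<epsilon> :: real assume "\<epsilon> > 0"
    from order_tendstoD(2)[OF lim this] show "\<forall>\<^sub>F N in sequentially. \<forall>\<theta>\<in>{0..2*pi}. dist (?f N \<theta>) (?g \<theta>) < \<epsilon>"
      by eventually_elim (use diff in \<open>auto simp: dist_norm intro: le_less_trans\<close>)
  qed
  have cont: "continuous_on {0..2*pi} (?f N)" for N
  proof (rule continuous_on_mult)
    have "continuous_on (ball 0 1) (gf_prod N)" by (intro holomorphic_on_imp_continuous_on gf_prod_holomorphic)
    moreover have "continuous_on {0..2*pi} (\<lambda>\<theta>. exp (- ?z \<theta>))"
      unfolding Complex_eq by (intro continuous_intros)
    moreover have "(\<lambda>\<theta>. exp (- ?z \<theta>)) ` {0..2*pi} \<subseteq> ball 0 1" using t by auto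
    ultimately show "continuous_on {0..2*pi} (\<lambda>\<theta>. gf_prod N (exp (- ?z \<theta>)))"
      by (rule continuous_on_compose2)
    show "continuous_on {0..2*pi} (\<lambda>\<theta>. exp (of_nat n * ?z \<theta>))" unfolding Complex_eq by (intro continuous_intros)
  qed
  obtain I J where IJ: "\<And>N. (?f N has_integral I N) {0..2*pi}" "(?g has_integral J) {0..2*pi}" "I \<longlonglongrightarrow> J"
    using uniform_limit_integral[OF u cont] by auto
  have "\<forall>\<^sub>F N in sequentially. I N = of_real (2 * pi * of_int (a n))"
    using is_coeff_seq_eventually[OF a, of n]
  proof eventually_elim
    case (elim N)
    have "I N = of_real (2 * pi * fps_nth (\<Prod>i<N. gf_factor i) n)"
      using has_integral_unique[OF IJ(1) Cauchy_gf_prod[OF t]] .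
    thus ?case by (simp add: elim)
  qed
  hence "I \<longlonglongrightarrow> of_real (2 * pi * of_int (a n))" by (rule tendsto_eventually)
  with IJ(3) have "J = of_real (2 * pi * of_int (a n))" by (rule LIMSEQ_unique)
  thus ?thesis using IJ(2) by simp
qed

lemma exp_shift_pi:
  "exp (of_nat m * (z - \<i> * pi)) = (-1) ^ m * exp (of_nat m * z)"
  "exp (- (of_nat m * (z - \<i> * pi))) = (-1) ^ m * exp (- (of_nat m * z))"
proof -
  have "exp (of_nat m * (\<i> * of_real pi)) = (-1) ^ m"
    unfolding exp_of_nat_mult by (simp add: mult.commute)
  thus 1: "exp (of_nat m * (z - \<i> * pi)) = (-1) ^ m * exp (of_nat m * z)"
    unfolding right_diff_distrib exp_diff by (simp add: divide_inverse mult.commute flip: power_inverse)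
  show "exp (- (of_nat m * (z - \<i> * pi))) = (-1) ^ m * exp (- (of_nat m * z))"
    unfolding exp_minus 1 by (simp flip: power_inverse)
qed

lemma Lev_Lod_shift:
  assumes "Re z > 0"
  shows "Lev (z - \<i> * pi) = Lev z" "Lod (z - \<i> * pi) = - Lod z"
proof -
  note p = exp_shift_pi[of _ z]
  have "lev_term j (z - \<i> * pi) = lev_term j z" for j
  proof -
    have "sinh (of_nat (2 * Suc j) * (z - \<i> * pi)) = sinh (of_nat (2 * Suc j) * z)"
      unfolding sinh_field_def p by simp
    thus ?thesis unfolding lev_term_def by (simp only: of_nat_mult of_nat_numeral)
  qed
  thus "Lev (z - \<i> * pi) = Lev z" by (simp add: Lev_def)
  have "lod_term j (z - \<i> * pi) = - lod_term j z" for j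
  proof -
    have "cosh (of_nat (2 * j + 1) * (z - \<i> * pi)) = - cosh (of_nat (2 * j + 1) * z)"
      unfolding cosh_field_def p by (simp add: field_simps)
    thus ?thesis unfolding lod_term_def by (simp only:) simp
  qed
  hence "Lod (z - \<i> * pi) = (\<Sum>j. - lod_term j z)" by (simp add: Lod_def)
  also have "\<dots> = - Lod z" unfolding Lod_def using assms by (intro suminf_minus Lod_deriv(1))
  finally show "Lod (z - \<i> * pi) = - Lod z" .
qed

lemma continuous_on_Lod: "continuous_on {z. Re z > 0} Lod"
  using Lod_deriv(2) by (intro continuous_at_imp_continuous_on) (auto intro!: DERIV_isCont)

lemma continuous_on_Lev: "continuous_on {z. Re z > 0} Lev"
proof -
  have 1: "continuous_on {z. Re z > 0} Lcoth"
    using Lcoth_deriv(3) by (intro continuous_at_imp_continuous_on) (auto intro!: DERIV_isCont)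
  have "continuous_on {z. Re z > 0} (\<lambda>z. Lcoth z - Lcoth (2 * z))"
    by (intro continuous_intros 1 continuous_on_compose2[OF 1]) auto
  thus ?thesis by (rule continuous_on_cong[THEN iffD1, rotated -1]) (auto simp: Lev_eq_Lcoth)
qed

lemma coeff_integral:
  assumes a: "is_coeff_seq a" and t: "t > 0"
  shows "((\<lambda>\<theta>. exp (Lev (Complex t (-\<theta>)) + Lod (Complex t (-\<theta>)) + of_nat n * Complex t (-\<theta>))
            + (-1) ^ n * exp (Lev (Complex t (-\<theta>)) - Lod (Complex t (-\<theta>)) + of_nat n * Complex t (-\<theta>)))
          has_integral of_real (2 * pi * of_int (a n))) {-(pi/2)..pi/2}"
proof -
  let ?z = "\<lambda>\<theta>. Complex t (- \<theta>)"
  define F where "F = (\<lambda>\<theta>. exp (Lev (?z \<theta>) + Lod (?z \<theta>) + of_nat n * ?z \<theta>))"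
  have contz: "continuous_on A ?z" for A unfolding Complex_eq by (intro continuous_intros)
  have contF: "continuous_on A F" for A
    unfolding F_def using t
    by (intro continuous_intros contz continuous_on_compose2[OF continuous_on_Lev contz] continuous_on_compose2[OF continuous_on_Lod contz]) auto
  have int: "F integrable_on {x..y}" for x y by (intro integrable_continuous_real contF)
  have shift: "F (\<theta> + pi) = (-1) ^ n * exp (Lev (?z \<theta>) - Lod (?z \<theta>) + of_nat n * ?z \<theta>)" for \<theta>
  proof -
    have z: "?z (\<theta> + pi) = ?z \<theta> - \<i> * pi" by (simp add: complex_eq_iff)
    show ?thesis unfolding F_def z exp_add[of _ "of_nat n * _"] exp_shift_pi using t
      by (simp add: Lev_Lod_shift)
  qed
  have F2: "F (\<theta> + 2 * pi) = F \<theta>" for \<theta>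
  proof -
    have "F (\<theta> + 2 * pi) = F ((\<theta> + pi) + pi)" by (simp add: add.assoc)
    also have "\<dots> = (-1) ^ n * exp (Lev (?z (\<theta> + pi)) - Lod (?z (\<theta> + pi)) + of_nat n * ?z (\<theta> + pi))" by (rule shift)
    also have "?z (\<theta> + pi) = ?z \<theta> - \<i> * pi" by (simp add: complex_eq_iff)
    also have "(-1) ^ n * exp (Lev (?z \<theta> - \<i> * pi) - Lod (?z \<theta> - \<i> * pi) + of_nat n * (?z \<theta> - \<i> * pi)) = F \<theta>"
      unfolding F_def exp_add[of _ "of_nat n * _"] exp_shift_pi using t
      by (simp add: Lev_Lod_shift)
    finally show ?thesis .
  qed
  have "integral {0..2*pi} F = of_real (2 * pi * of_int (a n))"
    using coeff_integral_0_2pi[OF a t, of n] t unfolding F_def by (simp add: log_gf_eq integral_unique)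
  \<comment> \<open>The circle is cut at \<pi>/2 and 3 \<pi>/2. The last quarter returns by
    periodicity, and the middle half is folded onto the right half by q -> -q.\<close>
  also have "integral {0..2*pi} F = integral {0..3*pi/2} F + integral {3*pi/2..2*pi} F"
    by (rule Henstock_Kurzweil_Integration.integral_combine[symmetric]) (auto intro: int)
  also have "integral {3*pi/2..2*pi} F = integral {3*pi/2 - 2*pi..2*pi - 2*pi} (\<lambda>\<theta>. F (\<theta> + 2 * pi))"
    by (rule integral_shift_real_ivl[symmetric])
  also have "\<dots> = integral {-(pi/2)..0} F" by (simp add: F2)
  also have "integral {0..3*pi/2} F = integral {0..pi/2} F + integral {pi/2..3*pi/2} F"
    by (rule Henstock_Kurzweil_Integration.integral_combine[symmetric]) (auto intro: int)
  also have "integral {pi/2..3*pi/2} F = integral {pi/2 - pi..3*pi/2 - pi} (\<lambda>\<theta>. F (\<theta> + pi))"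
    by (rule integral_shift_real_ivl[symmetric])
  also have "{pi/2 - pi..3*pi/2 - pi} = {-(pi/2)..pi/2}" by simp
  finally have "integral {-(pi/2)..0} F + integral {0..pi/2} F + integral {-(pi/2)..pi/2} (\<lambda>\<theta>. F (\<theta> + pi)) = of_real (2 * pi * of_int (a n))"
    by (simp add: add_ac)
  also have "integral {-(pi/2)..0} F + integral {0..pi/2} F = integral {-(pi/2)..pi/2} F"
    by (rule Henstock_Kurzweil_Integration.integral_combine) (auto intro: int)
  finally have I: "integral {-(pi/2)..pi/2} F + integral {-(pi/2)..pi/2} (\<lambda>\<theta>. F (\<theta> + pi)) = of_real (2 * pi * of_int (a n))" .
  have int2: "(\<lambda>\<theta>. F (\<theta> + pi)) integrable_on {-(pi/2)..pi/2}"
    by (intro integrable_continuous_real continuous_on_compose2[OF contF[of UNIV]] continuous_intros) auto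
  have "((\<lambda>\<theta>. F \<theta> + F (\<theta> + pi)) has_integral (integral {-(pi/2)..pi/2} F + integral {-(pi/2)..pi/2} (\<lambda>\<theta>. F (\<theta> + pi)))) {-(pi/2)..pi/2}"
    by (intro has_integral_add integrable_integral int int2)
  thus ?thesis unfolding I unfolding shift by (simp add: F_def)
qed

subsection \<open>The constant term of the odd series\<close>

lemma tanh_le_self: "x \<ge> 0 \<Longrightarrow> tanh x \<le> (x::real)"
proof -
  assume x: "x \<ge> 0"
  have "(\<lambda>x. x - tanh x) 0 \<le> (\<lambda>x. x - tanh x) x"
  proof (rule DERIV_nonneg_imp_nondecreasing[OF x])
    fix y :: real
    have "((\<lambda>x. x - tanh x) has_real_derivative (1 - (1 - (tanh y)\<^sup>2))) (at y)"
      by (auto intro!: derivative_eq_intros)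
    thus "\<exists>d. ((\<lambda>x. x - tanh x) has_real_derivative d) (at y) \<and> 0 \<le> d"
      by (intro exI[of _ "1 - (1 - (tanh y)\<^sup>2)"]) auto
  qed
  thus ?thesis by simp
qed

lemma tanh_ge_cubic: "x \<ge> 0 \<Longrightarrow> x * (1 - x\<^sup>2 / 3) \<le> tanh (x::real)"
proof -
  assume x: "x \<ge> 0"
  have "(\<lambda>x. tanh x - x + x ^ 3 / 3) 0 \<le> (\<lambda>x. tanh x - x + x ^ 3 / 3) x"
  proof (rule DERIV_nonneg_imp_nondecreasing[OF x])
    fix y :: real assume y: "0 \<le> y"
    have "((\<lambda>x. tanh x - x + x ^ 3 / 3) has_real_derivative ((1 - (tanh y)\<^sup>2) - 1 + y\<^sup>2)) (at y)"
      by (auto intro!: derivative_eq_intros simp: power2_eq_square)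
    moreover have "(tanh y)\<^sup>2 \<le> y\<^sup>2" using tanh_le_self[OF y] y by (intro power_mono) auto
    ultimately show "\<exists>d. ((\<lambda>x. tanh x - x + x ^ 3 / 3) has_real_derivative d) (at y) \<and> 0 \<le> d"
      by (intro exI[of _ "(1 - (tanh y)\<^sup>2) - 1 + y\<^sup>2"]) auto
  qed
  thus ?thesis by (simp add: power2_eq_square power3_eq_cube algebra_simps)
qed

text \<open>By the product formulas, sinh (a - d) sinh (a + d) is sinh^2 a minus sinh^2 d, and cosh
  (a - d) cosh (a + d) is cosh^2 a plus sinh^2 d; both changes lower the quotient.\<close>

lemma tanh_log_concave:
  assumes "0 < d" "d < (a::real)"
  shows "tanh (a - d) * tanh (a + d) \<le> (tanh a)\<^sup>2"
proof -
  have 1: "sinh (a - d) * sinh (a + d) = (sinh a)\<^sup>2 - (sinh d)\<^sup>2"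
    by (simp add: sinh_add sinh_diff algebra_simps cosh_square_eq flip: power2_eq_square)
  have 2: "cosh (a - d) * cosh (a + d) = (cosh a)\<^sup>2 + (sinh d)\<^sup>2"
    by (simp add: cosh_add cosh_diff algebra_simps flip: power2_eq_square)
       (simp add: cosh_square_eq power_mult_distrib algebra_simps)
  have "tanh (a - d) * tanh (a + d) = ((sinh a)\<^sup>2 - (sinh d)\<^sup>2) / ((cosh a)\<^sup>2 + (sinh d)\<^sup>2)"
    unfolding tanh_def times_divide_times_eq 1 2 ..
  also have "\<dots> \<le> (sinh a)\<^sup>2 / (cosh a)\<^sup>2"
    using assms by (intro frac_le) auto
  finally show ?thesis by (simp add: tanh_def power_divide)
qed

text \<open>With q = exp (- 2 s) this is a partial product of the generating function at q divided
  by the one at -q. The even series cancels in the quotient, so the limit is exp (2 Lod (2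
  s)).\<close>

definition tanh_prod :: "nat \<Rightarrow> real \<Rightarrow> real" where
  "tanh_prod M s = (\<Prod>j<M. tanh (real (4 * j + 3) * s) / tanh (real (4 * j + 1) * s))"

lemma gf_prod_ratio:
  assumes s: "s > 0"
  shows "gf_prod (2 * M) (exp (- of_real (2 * s))) / gf_prod (2 * M) (- exp (- of_real (2 * s))) = of_real (tanh_prod M s)"
proof -
  define q where "q = exp (- (2 * s))"
  have q: "0 < q" "q < 1" using s by (auto simp: q_def)
  have cq: "exp (- of_real (2 * s)) = (of_real q :: complex)" 
    unfolding q_def exp_of_real[symmetric] by simp
  have th: "tanh (real m * s) = (1 - q ^ m) / (1 + q ^ m)" for m
    by (simp add: tanh_real_altdef q_def flip: exp_of_nat_mult) (simp add: mult_ac)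
  have lt: "q ^ m < 1" if "m > 0" for m using q that by (subst power_less_one_iff) auto
  have "gf_prod (2 * M) (of_real q) / gf_prod (2 * M) (- of_real q) = of_real (\<Prod>j<M. tanh (real (4 * j + 3) * s) / tanh (real (4 * j + 1) * s))"
  proof (induction M)
    case 0
    show ?case by (simp add: gf_prod_def)
  next
    case (Suc M)
    define x where "x = q ^ (4 * M + 1)"
    define y where "y = q ^ (4 * M + 3)"
    have xy: "0 < x" "x < 1" "0 < y" "y < 1" using q lt[of "4 * M + 1"] lt[of "4 * M + 3"] by (auto simp: x_def y_def)
    have step: "gf_prod (2 * Suc M) z = gf_prod (2 * M) z * inverse (1 - z ^ (4 * M + 1)) * inverse (1 + z ^ (4 * M + 3))" for z
      by (simp add: gf_prod_def numeral_3_eq_3)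
    have "gf_prod (2 * Suc M) (of_real q) / gf_prod (2 * Suc M) (- of_real q) =
       gf_prod (2 * M) (of_real q) / gf_prod (2 * M) (- of_real q) *
        of_real ((inverse (1 - x) * inverse (1 + y)) / (inverse (1 + x) * inverse (1 - y)))"
    proof -
      have p: "(of_real q :: complex) ^ (4 * M + 1) = of_real x" "(- of_real q :: complex) ^ (4 * M + 1) = - of_real x"
        "(of_real q :: complex) ^ (4 * M + 3) = of_real y" "(- of_real q :: complex) ^ (4 * M + 3) = - of_real y"
        by (simp_all add: x_def y_def)
      show ?thesis unfolding step p by (simp add: divide_inverse mult_ac)
    qed
    also have "(inverse (1 - x) * inverse (1 + y)) / (inverse (1 + x) * inverse (1 - y)) =
        tanh (real (4 * M + 3) * s) / tanh (real (4 * M + 1) * s)"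
      unfolding th x_def[symmetric] y_def[symmetric] using xy by (simp add: divide_simps)
    finally show ?case unfolding Suc.IH by simp
  qed
  thus ?thesis unfolding cq tanh_prod_def .
qed

lemma gf_prod_tendsto:
  assumes "Re z > 0"
  shows "(\<lambda>N. gf_prod N (exp (- z))) \<longlonglongrightarrow> exp (log_gf z)"
proof -
  define r where "r = exp (- Re z)"
  have r: "0 < r" "r < 1" using assms by (auto simp: r_def)
  have "\<exists>d. gf_prod N (exp (- z)) = exp (log_gf z + d) \<and> norm d \<le> r ^ N / (1 - r)\<^sup>2" for N
    using gf_prod_exp[OF assms r_def, of N] by blast
  then obtain d where d: "\<And>N. gf_prod N (exp (- z)) = exp (log_gf z + d N)" "\<And>N. norm (d N) \<le> r ^ N / (1 - r)\<^sup>2"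
    by metis
  have "d \<longlonglongrightarrow> 0"
  proof (rule Lim_null_comparison)
    show "\<forall>\<^sub>F N in sequentially. norm (d N) \<le> r ^ N / (1 - r)\<^sup>2" using d(2) by auto
    show "(\<lambda>N. r ^ N / (1 - r)\<^sup>2) \<longlonglongrightarrow> 0" using r by (intro tendsto_divide_zero LIMSEQ_realpow_zero) auto
  qed
  hence "(\<lambda>N. exp (log_gf z + d N)) \<longlonglongrightarrow> exp (log_gf z + 0)" by (intro tendsto_intros)
  thus ?thesis by (simp add: d(1))
qed

definition lod :: "real \<Rightarrow> real" where
  "lod t = (\<Sum>j. 1 / (2 * real (2 * j + 1) * cosh (real (2 * j + 1) * t)))"

lemma Lod_of_real: "t > 0 \<Longrightarrow> Lod (of_real t) = of_real (lod t)"
proof -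
  assume t: "t > 0"
  have e: "lod_term j (of_real t) = of_real (1 / (2 * real (2 * j + 1) * cosh (real (2 * j + 1) * t)))" for j
  proof -
    have "cosh (of_nat (2 * j + 1) * complex_of_real t) = of_real (cosh (real (2 * j + 1) * t))"
      by (simp add: complex_eq_iff Re_cosh Im_cosh)
    thus ?thesis unfolding lod_term_def by simp
  qed
  have "summable (\<lambda>j. lod_term j (of_real t))" using t by (intro Lod_deriv(1)) auto
  hence "summable (\<lambda>j. 1 / (2 * real (2 * j + 1) * cosh (real (2 * j + 1) * t)))"
    unfolding e summable_of_real_iff .
  thus ?thesis unfolding Lod_def lod_def e by (rule suminf_of_real[symmetric])
qed

lemma tanh_prod_tendsto:
  assumes s: "s > 0"
  shows "(\<lambda>M. tanh_prod M s) \<longlonglongrightarrow> exp (2 * lod (2 * s))"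
proof -
  let ?z = "complex_of_real (2 * s)"
  have z: "Re ?z > 0" "Re (?z - \<i> * pi) > 0" using s by auto
  have mq: "exp (- (?z - \<i> * pi)) = - exp (- ?z)"
    using exp_shift_pi(2)[of 1 ?z] by simp
  have "(\<lambda>N. gf_prod N (exp (- ?z)) / gf_prod N (exp (- (?z - \<i> * pi)))) \<longlonglongrightarrow> exp (log_gf ?z) / exp (log_gf (?z - \<i> * pi))"
    using z by (intro tendsto_divide gf_prod_tendsto) auto
  also have "exp (log_gf ?z) / exp (log_gf (?z - \<i> * pi)) = of_real (exp (2 * lod (2 * s)))"
  proof -
    have "log_gf ?z - log_gf (?z - \<i> * pi) = of_real (2 * lod (2 * s))"
      unfolding log_gf_eq[OF z(1)] log_gf_eq[OF z(2)] Lev_Lod_shift[OF z(1)] using s Lod_of_real[of "2 * s"] by simp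
    thus ?thesis unfolding exp_diff[symmetric] by (simp only: exp_of_real)
  qed
  finally have "(\<lambda>N. gf_prod N (exp (- ?z)) / gf_prod N (- exp (- ?z))) \<longlonglongrightarrow> of_real (exp (2 * lod (2 * s)))"
    unfolding mq .
  hence "(\<lambda>M. gf_prod (2 * M) (exp (- ?z)) / gf_prod (2 * M) (- exp (- ?z))) \<longlonglongrightarrow> of_real (exp (2 * lod (2 * s)))"
    by (rule LIMSEQ_subseq_LIMSEQ[unfolded o_def]) (auto intro!: strict_monoI)
  hence "(\<lambda>M. complex_of_real (tanh_prod M s)) \<longlonglongrightarrow> of_real (exp (2 * lod (2 * s)))"
    unfolding gf_prod_ratio[OF s] .
  thus ?thesis by (simp only: tendsto_of_real_iff)
qed

lemma tanh_prod_pos: "s > 0 \<Longrightarrow> tanh_prod M s > 0"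
  unfolding tanh_prod_def by (intro prod_pos) auto

text \<open>Log-concavity compares each factor of the tail with the geometric mean of two consecutive
  ratios, which makes the squared tail telescope from both sides.\<close>

lemma tanh_prod_tail:
  assumes s: "s > 0" and NM: "1 \<le> N" "N \<le> M"
  shows "(tanh_prod N s)\<^sup>2 * (tanh (real (4 * M + 1) * s) / tanh (real (4 * N + 1) * s)) \<le> (tanh_prod M s)\<^sup>2"
    "(tanh_prod M s)\<^sup>2 \<le> (tanh_prod N s)\<^sup>2 * (tanh (real (4 * M - 1) * s) / tanh (real (4 * N - 1) * s))"
proof -
  define T where "T = (\<lambda>m::nat. tanh (real m * s))"
  have pos: "T m > 0" if "m > 0" for m using that s by (simp add: T_def)
  have lc: "T m * T (m + 4) \<le> (T (m + 2))\<^sup>2" if "m \<ge> 1" for m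
  proof -
    have "tanh (real (m + 2) * s - 2 * s) * tanh (real (m + 2) * s + 2 * s) \<le> (tanh (real (m + 2) * s))\<^sup>2"
      using s that by (intro tanh_log_concave mult_strict_right_mono) auto
    moreover have "real (m + 2) * s - 2 * s = real m * s" "real (m + 2) * s + 2 * s = real (m + 4) * s"
      by (simp_all add: algebra_simps)
    ultimately show ?thesis by (simp only: T_def)
  qed
  have st1: "T (4 * j + 5) / T (4 * j + 1) \<le> (T (4 * j + 3) / T (4 * j + 1))\<^sup>2" for j
  proof -
    have "T (4 * j + 1) * T (4 * j + 1 + 4) \<le> (T (4 * j + 1 + 2))\<^sup>2" by (rule lc) simp
    hence "T (4 * j + 1) * T (4 * j + 5) \<le> (T (4 * j + 3))\<^sup>2" by (simp add: numeral_eq_Suc)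
    thus ?thesis using pos[of "4 * j + 1"] by (simp add: divide_simps power2_eq_square mult.commute)
  qed
  have st2: "(T (4 * j + 3) / T (4 * j + 1))\<^sup>2 \<le> T (4 * j + 3) / T (4 * j - 1)" if "j \<ge> 1" for j
  proof -
    have "T (4 * j - 1) * T (4 * j - 1 + 4) \<le> (T (4 * j - 1 + 2))\<^sup>2" using that by (intro lc) simp
    moreover have "4 * j - 1 + 4 = 4 * j + 3" "4 * j - 1 + 2 = 4 * j + 1" using that by simp_all
    ultimately have "T (4 * j - 1) * T (4 * j + 3) \<le> (T (4 * j + 1))\<^sup>2" by (simp only:)
    hence "T (4 * j - 1) * T (4 * j + 3) * T (4 * j + 3) \<le> (T (4 * j + 1))\<^sup>2 * T (4 * j + 3)"
      using pos[of "4 * j + 3"] by (intro mult_right_mono) auto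
    moreover have "C * C * A \<le> C * (B * B) \<Longrightarrow> A > 0 \<Longrightarrow> B > 0 \<Longrightarrow> (C / B)\<^sup>2 \<le> C / A" for A B C :: real
      by (simp add: divide_simps power2_eq_square mult_ac)
    ultimately show ?thesis using pos[of "4 * j + 1"] pos[of "4 * j - 1"] that
      by (simp add: power2_eq_square mult_ac)
  qed
  have suc: "tanh_prod (Suc m) s = tanh_prod m s * (T (4 * m + 3) / T (4 * m + 1))" for m
    by (simp add: tanh_prod_def T_def)
  have "(tanh_prod N s)\<^sup>2 * (T (4 * M + 1) / T (4 * N + 1)) \<le> (tanh_prod M s)\<^sup>2"
    using NM(2)
  proof (induction rule: dec_induct)
    case base
    show ?case using pos[of "4 * N + 1"] by simp
  next
    case (step m)
    have idx: "4 * Suc m + 1 = 4 * m + 5" by simp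
    have "(tanh_prod N s)\<^sup>2 * (T (4 * Suc m + 1) / T (4 * N + 1)) =
       (tanh_prod N s)\<^sup>2 * (T (4 * m + 1) / T (4 * N + 1)) * (T (4 * m + 5) / T (4 * m + 1))"
      unfolding idx using pos[of "4 * m + 1"] by simp
    also have "\<dots> \<le> (tanh_prod m s)\<^sup>2 * (T (4 * m + 3) / T (4 * m + 1))\<^sup>2"
      using step.IH st1[of m] pos[of "4 * m + 5"] pos[of "4 * m + 1"] by (intro mult_mono) auto
    finally show ?case by (simp only: suc power_mult_distrib)
  qed
  thus "(tanh_prod N s)\<^sup>2 * (tanh (real (4 * M + 1) * s) / tanh (real (4 * N + 1) * s)) \<le> (tanh_prod M s)\<^sup>2"
    by (simp only: T_def)
  have "(tanh_prod M s)\<^sup>2 \<le> (tanh_prod N s)\<^sup>2 * (T (4 * M - 1) / T (4 * N - 1))"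
    using NM(2)
  proof (induction rule: dec_induct)
    case base
    show ?case using pos[of "4 * N - 1"] NM by simp
  next
    case (step m)
    have m1: "m \<ge> 1" using step.hyps NM by simp
    have idx: "4 * Suc m - 1 = 4 * m + 3" by simp
    have p: "T (4 * m - 1) > 0" "T (4 * N - 1) > 0" using NM m1 by (auto intro!: pos)
    have "(tanh_prod (Suc m) s)\<^sup>2 = (tanh_prod m s)\<^sup>2 * (T (4 * m + 3) / T (4 * m + 1))\<^sup>2"
      by (simp only: suc power_mult_distrib)
    also have "\<dots> \<le> (tanh_prod N s)\<^sup>2 * (T (4 * m - 1) / T (4 * N - 1)) * (T (4 * m + 3) / T (4 * m - 1))"
    proof (rule mult_mono[OF step.IH st2[OF m1]])
      show "0 \<le> (tanh_prod N s)\<^sup>2 * (T (4 * m - 1) / T (4 * N - 1))"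
        using p by (intro mult_nonneg_nonneg divide_nonneg_nonneg) auto
    qed simp
    also have "\<dots> = (tanh_prod N s)\<^sup>2 * (T (4 * Suc m - 1) / T (4 * N - 1))"
      unfolding idx using p(1) by (simp only: times_divide_times_eq times_divide_eq_left times_divide_eq_right) (simp add: divide_simps)
    finally show ?case .
  qed
  thus "(tanh_prod M s)\<^sup>2 \<le> (tanh_prod N s)\<^sup>2 * (tanh (real (4 * M - 1) * s) / tanh (real (4 * N - 1) * s))"
    by (simp only: T_def)
qed

text \<open>The tail estimates as M tends to infinity, where tanh tends to 1. They enclose the
  infinite product for each fixed N, so that N may afterwards be coupled to s.\<close>

lemma exp_lod_bounds:
  assumes s: "s > 0" and N: "1 \<le> N"
  shows "(tanh_prod N s)\<^sup>2 / tanh (real (4 * N + 1) * s) \<le> exp (4 * lod (2 * s))"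
    "exp (4 * lod (2 * s)) \<le> (tanh_prod N s)\<^sup>2 / tanh (real (4 * N - 1) * s)"
proof -
  define T where "T = (\<lambda>m::nat. tanh (real m * s))"
  have pos: "T m > 0" if "m > 0" for m using that s by (simp add: T_def)
  have L: "(\<lambda>M. (tanh_prod M s)\<^sup>2) \<longlonglongrightarrow> exp (4 * lod (2 * s))"
  proof -
    have "(\<lambda>M. (tanh_prod M s)\<^sup>2) \<longlonglongrightarrow> (exp (2 * lod (2 * s)))\<^sup>2" by (intro tendsto_power tanh_prod_tendsto s)
    also have "(exp (2 * lod (2 * s)))\<^sup>2 = exp (4 * lod (2 * s))" by (simp add: power2_eq_square flip: exp_add)
    finally show ?thesis .
  qed
  have T: "(\<lambda>M. T (4 * M + 1)) \<longlonglongrightarrow> 1"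
    unfolding T_def by (rule filterlim_compose[OF tanh_real_at_top]) (use s in real_asymp)
  have "(\<lambda>M. (tanh_prod N s)\<^sup>2 * (T (4 * M + 1) / T (4 * N + 1))) \<longlonglongrightarrow> (tanh_prod N s)\<^sup>2 * (1 / T (4 * N + 1))"
    using pos[of "4 * N + 1"] by (intro tendsto_intros T) auto
  moreover have "\<forall>M\<ge>N. (tanh_prod N s)\<^sup>2 * (T (4 * M + 1) / T (4 * N + 1)) \<le> (tanh_prod M s)\<^sup>2"
    unfolding T_def using tanh_prod_tail(1)[OF s N] by blast
  ultimately have "(tanh_prod N s)\<^sup>2 * (1 / T (4 * N + 1)) \<le> exp (4 * lod (2 * s))"
    using LIMSEQ_le[OF _ L] by blast
  thus "(tanh_prod N s)\<^sup>2 / tanh (real (4 * N + 1) * s) \<le> exp (4 * lod (2 * s))"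
    by (simp only: T_def times_divide_eq_right mult_1_right)
  have "(tanh_prod M s)\<^sup>2 \<le> (tanh_prod N s)\<^sup>2 / T (4 * N - 1)" if "M \<ge> N" for M
  proof -
    have p: "T (4 * N - 1) > 0" using N by (intro pos) simp
    have "T (4 * M - 1) \<le> 1" unfolding T_def using tanh_real_lt_1 less_imp_le by blast
    hence "T (4 * M - 1) / T (4 * N - 1) \<le> 1 / T (4 * N - 1)"
      using p by (intro divide_right_mono) auto
    hence "(tanh_prod N s)\<^sup>2 * (T (4 * M - 1) / T (4 * N - 1)) \<le> (tanh_prod N s)\<^sup>2 * (1 / T (4 * N - 1))"
      by (intro mult_left_mono) auto
    moreover have "(tanh_prod M s)\<^sup>2 \<le> (tanh_prod N s)\<^sup>2 * (T (4 * M - 1) / T (4 * N - 1))"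
      using tanh_prod_tail(2)[OF s N that] by (simp only: T_def)
    ultimately show ?thesis by simp
  qed
  hence "exp (4 * lod (2 * s)) \<le> (tanh_prod N s)\<^sup>2 / T (4 * N - 1)"
    by (intro LIMSEQ_le_const2[OF L]) auto
  thus "exp (4 * lod (2 * s)) \<le> (tanh_prod N s)\<^sup>2 / tanh (real (4 * N - 1) * s)" by (simp only: T_def)
qed

text \<open>For 0 <= y <= \<delta> the value tanh y lies between (1 - \<delta>^2/3) y and y. In each
  quotient of two such values s cancels, leaving the ratio of the odd multipliers.\<close>

lemma tanh_prod_bounds:
  assumes s: "s > 0" and small: "4 * real N * s \<le> \<delta>" "\<delta> \<le> 1"
  defines "R \<equiv> (\<Prod>j<N. (real j + 3/4) / (real j + 1/4))"
  shows "R * (1 - \<delta>\<^sup>2 / 3) ^ N \<le> tanh_prod N s" "tanh_prod N s \<le> R / (1 - \<delta>\<^sup>2 / 3) ^ N"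
proof -
  have d0: "\<delta> \<ge> 0" using s small(1) by (intro order_trans[OF _ small(1)]) auto
  have dd: "\<delta>\<^sup>2 \<le> 1" using small d0 by (simp add: power_le_one)
  have fac: "(real j + 3/4) / (real j + 1/4) * (1 - \<delta>\<^sup>2 / 3) \<le> tanh (real (4 * j + 3) * s) / tanh (real (4 * j + 1) * s)"
    "tanh (real (4 * j + 3) * s) / tanh (real (4 * j + 1) * s) \<le> (real j + 3/4) / (real j + 1/4) * (1 / (1 - \<delta>\<^sup>2 / 3))"
    if "j < N" for j
  proof -
    define a where "a = real (4 * j + 1) * s"
    define b where "b = real (4 * j + 3) * s"
    have ab: "0 < a" "0 < b" using s by (auto simp: a_def b_def intro!: mult_pos_pos)
    have "real (4 * j + 3) * s \<le> 4 * real N * s" "real (4 * j + 1) * s \<le> 4 * real N * s"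
      using s that by (intro mult_right_mono; simp)+
    hence le: "a \<le> \<delta>" "b \<le> \<delta>" using small by (auto simp: a_def b_def)
    have rat: "(real j + 3/4) / (real j + 1/4) = b / a"
    proof -
      have "b = 4 * s * (real j + 3/4)" "a = 4 * s * (real j + 1/4)" by (simp_all add: a_def b_def algebra_simps)
      thus ?thesis using s by simp
    qed
    have sq: "a\<^sup>2 \<le> \<delta>\<^sup>2" "b\<^sup>2 \<le> \<delta>\<^sup>2" using ab le by (auto intro!: power_mono)
    have tb: "b * (1 - \<delta>\<^sup>2 / 3) \<le> tanh b" "tanh b \<le> b"
    proof -
      have "b * (1 - \<delta>\<^sup>2 / 3) \<le> b * (1 - b\<^sup>2 / 3)" using ab sq by (intro mult_left_mono) auto
      thus "b * (1 - \<delta>\<^sup>2 / 3) \<le> tanh b" using tanh_ge_cubic[of b] ab by linarith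
    qed (use tanh_le_self[of b] ab in auto)
    have ta: "a * (1 - \<delta>\<^sup>2 / 3) \<le> tanh a" "tanh a \<le> a"
    proof -
      have "a * (1 - \<delta>\<^sup>2 / 3) \<le> a * (1 - a\<^sup>2 / 3)" using ab sq by (intro mult_left_mono) auto
      thus "a * (1 - \<delta>\<^sup>2 / 3) \<le> tanh a" using tanh_ge_cubic[of a] ab by linarith
    qed (use tanh_le_self[of a] ab in auto)
    have "b * (1 - \<delta>\<^sup>2 / 3) / a \<le> tanh b / tanh a" using tb ta ab dd by (intro frac_le) auto
    thus "(real j + 3/4) / (real j + 1/4) * (1 - \<delta>\<^sup>2 / 3) \<le> tanh (real (4 * j + 3) * s) / tanh (real (4 * j + 1) * s)"
      unfolding rat a_def[symmetric] b_def[symmetric] by simp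
    have "tanh b / tanh a \<le> b / (a * (1 - \<delta>\<^sup>2 / 3))" using tb ta ab dd by (intro frac_le mult_pos_pos) auto
    thus "tanh (real (4 * j + 3) * s) / tanh (real (4 * j + 1) * s) \<le> (real j + 3/4) / (real j + 1/4) * (1 / (1 - \<delta>\<^sup>2 / 3))"
      unfolding rat a_def[symmetric] b_def[symmetric] by simp
  qed
  have "(\<Prod>j<N. (real j + 3/4) / (real j + 1/4) * (1 - \<delta>\<^sup>2 / 3)) \<le> tanh_prod N s"
    unfolding tanh_prod_def using fac(1) dd by (intro prod_mono) auto
  thus "R * (1 - \<delta>\<^sup>2 / 3) ^ N \<le> tanh_prod N s" by (simp only: R_def prod.distrib prod_constant card_lessThan)
  have "tanh_prod N s \<le> (\<Prod>j<N. (real j + 3/4) / (real j + 1/4) * (1 / (1 - \<delta>\<^sup>2 / 3)))"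
    unfolding tanh_prod_def using fac(2) s by (intro prod_mono) auto
  also have "\<dots> = R * (1 / (1 - \<delta>\<^sup>2 / 3)) ^ N" by (simp only: R_def prod.distrib prod_constant card_lessThan)
  finally show "tanh_prod N s \<le> R / (1 - \<delta>\<^sup>2 / 3) ^ N" by (simp add: power_one_over)
qed

section \<open>The limit at the origin and the quotient of Gamma values\<close>

definition gamma_ratio :: real where "gamma_ratio = Gamma (1/4) / Gamma (3/4)"

lemma gamma_ratio_pos: "gamma_ratio > 0"
  unfolding gamma_ratio_def by (intro divide_pos_pos Gamma_real_pos) auto

text \<open>The product is a quotient of two Pochhammer symbols, and Euler's limit formula is
  applied to both Gamma values; the powers n^(1/4) and n^(3/4) leave a factor sqrt n, which squaring
  removes.\<close>

lemma quarter_prod_tendsto: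
  "(\<lambda>n. (\<Prod>j<Suc n. (real j + 3/4) / (real j + 1/4))\<^sup>2 / real n) \<longlonglongrightarrow> gamma_ratio\<^sup>2"
proof -
  have "(\<lambda>n. (Gamma_series (1/4) n / Gamma_series (3/4) n)\<^sup>2) \<longlonglongrightarrow> (Gamma (1/4) / Gamma (3/4 :: real))\<^sup>2"
    by (intro tendsto_intros) (auto simp: Gamma_eq_zero_iff elim!: nonpos_Ints_cases)
  moreover have "\<forall>\<^sub>F n in sequentially. (Gamma_series (1/4) n / Gamma_series (3/4) n)\<^sup>2 = (\<Prod>j<Suc n. (real j + 3/4) / (real j + 1/4))\<^sup>2 / real n"
  proof (rule eventually_mono[OF eventually_gt_at_top[of 0]])
    fix n :: nat assume n: "n > 0"
    have p: "pochhammer x (n + 1) > 0" if "x > 0" for x :: real using that by (rule pochhammer_pos)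
    have "(\<Prod>j<Suc n. (real j + 3/4) / (real j + 1/4)) = pochhammer (3/4) (n + 1) / pochhammer (1/4) (n + 1)"
    proof -
      have "pochhammer x (n + 1) = (\<Prod>j<Suc n. real j + x)" for x :: real
        unfolding pochhammer_prod by (intro prod.cong) auto
      thus ?thesis by (simp only: prod_dividef)
    qed
    moreover have "Gamma_series (1/4) n / Gamma_series (3/4) n = exp (- 1/2 * ln (real n)) * (pochhammer (3/4) (n + 1) / pochhammer (1/4) (n + 1))"
    proof -
      define L where "L = ln (real n)"
      define P Q where "P = pochhammer (1/4 :: real) (n + 1)" and "Q = pochhammer (3/4 :: real) (n + 1)"
      have e: "exp (1/4 * L) = exp (- 1/2 * L) * exp (3/4 * L)" unfolding exp_add[symmetric] by simp
      have PQ: "P > 0" "Q > 0" using p[of "1/4"] p[of "3/4"] by (simp_all only: P_def Q_def zero_less_divide_iff zero_less_numeral zero_less_one simp_thms)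
      have c: "f * (e * g) / P / (f * g / Q) = e * (Q / P)" if "f > 0" "g > 0" for f e g :: real
        using that PQ by simp
      have "Gamma_series (1/4) n = fact n * exp (1/4 * L) / P" "Gamma_series (3/4) n = fact n * exp (3/4 * L) / Q"
        by (simp_all add: Gamma_series_def L_def P_def Q_def)
      thus ?thesis unfolding L_def[symmetric] P_def[symmetric] Q_def[symmetric]
        by (simp only: e c fact_gt_zero exp_gt_zero)
    qed
    ultimately have "Gamma_series (1/4) n / Gamma_series (3/4) n = exp (- 1/2 * ln (real n)) * (\<Prod>j<Suc n. (real j + 3/4) / (real j + 1/4))"
      by (simp only:)
    moreover have "(exp (- 1/2 * ln (real n)))\<^sup>2 = 1 / real n"
    proof -
      define L where "L = ln (real n)"
      have "exp L = real n" using n by (simp add: L_def)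
      moreover have "(exp (- 1/2 * L))\<^sup>2 = inverse (exp L)"
      proof -
        have "2 * (- 1/2 * L) = - L" by (simp only: times_divide_eq_left times_divide_eq_right)
        thus ?thesis by (simp only: exp_double[symmetric] exp_minus)
      qed
      ultimately show ?thesis unfolding L_def[symmetric] by (simp only: inverse_eq_divide)
    qed
    ultimately show "(Gamma_series (1/4) n / Gamma_series (3/4) n)\<^sup>2 = (\<Prod>j<Suc n. (real j + 3/4) / (real j + 1/4))\<^sup>2 / real n"
      by (simp only: power_mult_distrib times_divide_eq_left mult_1_left)
  qed
  ultimately show ?thesis unfolding gamma_ratio_def by (rule Lim_transform_eventually)
qed

text \<open>With s = 1/N^2 and N factors all arguments of tanh stay below \<delta> = 4/N. Then
  \<delta> tends to 0 and so does N \<delta>^2, the accumulated relative error of the product. A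
  single sequence suffices, because \<open>Lod_Lipschitz\<close> controls all other points.\<close>

lemma exp_lod_limit:
  defines "s \<equiv> \<lambda>n. 1 / (real (Suc n))\<^sup>2"
  shows "(\<lambda>n. exp (4 * lod (2 * s n)) * (4 * s n)) \<longlonglongrightarrow> gamma_ratio\<^sup>2"
proof -
  define R where "R = (\<lambda>n. (\<Prod>j<Suc n. (real j + 3/4) / (real j + 1/4)))"
  have R0: "R n > 0" for n unfolding R_def by (intro prod_pos) (auto intro!: divide_pos_pos)
  have RL: "(\<lambda>n. (R n)\<^sup>2 / real n) \<longlonglongrightarrow> gamma_ratio\<^sup>2" unfolding R_def by (rule quarter_prod_tendsto)
  define lo where "lo = (\<lambda>n. (R n)\<^sup>2 / real n * (4 * real n / (4 * real n + 5) * (1 - 32 / (3 * (real n + 1)))))"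
  define hi where "hi = (\<lambda>n. (R n)\<^sup>2 / real n * (4 * real n / (4 * real n + 3) / ((1 - 32 / (3 * (real n + 1))) * (1 - 16 / (3 * (real n + 1)\<^sup>2)))))"
  have "(\<lambda>n. 4 * real n / (4 * real n + 5) * (1 - 32 / (3 * (real n + 1)))) \<longlonglongrightarrow> 1"
    by real_asymp
  from tendsto_mult[OF RL this] have lolim: "lo \<longlonglongrightarrow> gamma_ratio\<^sup>2" by (simp add: lo_def)
  have "(\<lambda>n. 4 * real n / (4 * real n + 3) / ((1 - 32 / (3 * (real n + 1))) * (1 - 16 / (3 * (real n + 1)\<^sup>2)))) \<longlonglongrightarrow> 1"
    by real_asymp
  from tendsto_mult[OF RL this] have hilim: "hi \<longlonglongrightarrow> gamma_ratio\<^sup>2" by (simp add: hi_def)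
  have bounds: "lo n \<le> exp (4 * lod (2 * s n)) * (4 * s n) \<and> exp (4 * lod (2 * s n)) * (4 * s n) \<le> hi n" if n: "n \<ge> 11" for n
  proof -
    define N where "N = Suc n"
    define \<delta> where "\<delta> = 4 / real N"
    have N: "real N = real n + 1" "real N \<ge> 12" using n by (auto simp: N_def)
    have s0: "s n > 0" by (simp add: s_def)
    have sN: "s n = 1 / (real N)\<^sup>2" by (simp add: s_def N_def)
    have small: "4 * real N * s n \<le> \<delta>" "\<delta> \<le> 1" using N(2) by (auto simp: sN \<delta>_def power2_eq_square)
    have d2: "\<delta>\<^sup>2 / 3 = 16 / (3 * (real N)\<^sup>2)" by (simp add: \<delta>_def power_divide)
    have d3: "\<delta>\<^sup>2 / 3 \<le> 1 / 3" using small N by (auto simp: \<delta>_def power_le_one)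
    \<comment> \<open>Bernoulli's inequality for 2 N factors; N >= 12 keeps its lower bound
      positive, so that it may also be divided by.\<close>
    have bern: "1 - 32 / (3 * real N) \<le> ((1 - \<delta>\<^sup>2 / 3) ^ N)\<^sup>2"
    proof -
      have "1 + real (2 * N) * (- (\<delta>\<^sup>2 / 3)) \<le> (1 + - (\<delta>\<^sup>2 / 3)) ^ (2 * N)"
        using d3 by (intro Bernoulli_inequality) auto
      moreover have "real (2 * N) * (\<delta>\<^sup>2 / 3) = 32 / (3 * real N)" unfolding d2 using N(2) by (simp add: power2_eq_square)
      ultimately show ?thesis by (simp add: power_mult mult.commute)
    qed
    have b0: "1 - 32 / (3 * real N) > 0" using N by (simp add: field_simps)
    have tp: "R n * (1 - \<delta>\<^sup>2 / 3) ^ N \<le> tanh_prod N (s n)" "tanh_prod N (s n) \<le> R n / (1 - \<delta>\<^sup>2 / 3) ^ N"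
      using tanh_prod_bounds[OF s0 small] by (simp_all add: R_def N_def)
    have lo1: "(R n)\<^sup>2 * (1 - 32 / (3 * real N)) \<le> (tanh_prod N (s n))\<^sup>2"
    proof -
      have "(R n)\<^sup>2 * (1 - 32 / (3 * real N)) \<le> (R n)\<^sup>2 * ((1 - \<delta>\<^sup>2 / 3) ^ N)\<^sup>2" using bern by (intro mult_left_mono) auto
      also have "\<dots> = (R n * (1 - \<delta>\<^sup>2 / 3) ^ N)\<^sup>2" by (simp add: power_mult_distrib)
      also have "\<dots> \<le> (tanh_prod N (s n))\<^sup>2" using tp R0[of n] d3 by (intro power_mono) auto
      finally show ?thesis .
    qed
    have hi1: "(tanh_prod N (s n))\<^sup>2 \<le> (R n)\<^sup>2 / (1 - 32 / (3 * real N))"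
    proof -
      have "(tanh_prod N (s n))\<^sup>2 \<le> (R n / (1 - \<delta>\<^sup>2 / 3) ^ N)\<^sup>2"
        using tp tanh_prod_pos[OF s0, of N] by (intro power_mono) auto
      also have "\<dots> = (R n)\<^sup>2 / ((1 - \<delta>\<^sup>2 / 3) ^ N)\<^sup>2" by (simp add: power_divide)
      also have "\<dots> \<le> (R n)\<^sup>2 / (1 - 32 / (3 * real N))" using bern b0 by (intro frac_le) auto
      finally show ?thesis .
    qed
    have N1: "1 \<le> N" by (simp add: N_def)
    have lo2: "lo n \<le> exp (4 * lod (2 * s n)) * (4 * s n)"
    proof -
      have tpos: "0 < tanh (real (4 * N + 1) * s n)" using s0 by simp
      have "tanh (real (4 * N + 1) * s n) \<le> real (4 * N + 1) * s n" using s0 by (intro tanh_le_self) simp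
      hence "(R n)\<^sup>2 * (1 - 32 / (3 * real N)) / (real (4 * N + 1) * s n) \<le> (tanh_prod N (s n))\<^sup>2 / tanh (real (4 * N + 1) * s n)"
        using lo1 tpos by (intro frac_le) auto
      also have "\<dots> \<le> exp (4 * lod (2 * s n))" by (rule exp_lod_bounds(1)[OF s0 N1])
      finally have "(R n)\<^sup>2 * (1 - 32 / (3 * real N)) / (real (4 * N + 1) * s n) * (4 * s n) \<le> exp (4 * lod (2 * s n)) * (4 * s n)"
        using s0 by (intro mult_right_mono) auto
      also have "(R n)\<^sup>2 * (1 - 32 / (3 * real N)) / (real (4 * N + 1) * s n) * (4 * s n) = (R n)\<^sup>2 * (1 - 32 / (3 * real N)) * 4 / real (4 * N + 1)"
      proof -
        have "A / (B * c) * (4 * c) = A * 4 / B" if "c > 0" for A B c :: real using that by simp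
        from this[OF s0] show ?thesis .
      qed
      also have "\<dots> = lo n"
      proof -
        have e: "real (4 * N + 1) = 4 * real n + 5" by (simp add: N_def)
        have "r * u * 4 / d = r / m * (4 * m / d * u)" if "m > 0" for r u d m :: real using that by simp
        thus ?thesis unfolding lo_def N(1)[symmetric] e using n by simp
      qed
      finally show ?thesis .
    qed
    have hi2: "exp (4 * lod (2 * s n)) * (4 * s n) \<le> hi n"
    proof -
      define y where "y = real (4 * N - 1) * s n"
      have y0: "y > 0" using s0 N1 by (simp add: y_def)
      have y1: "y \<le> \<delta>" using small(1) s0 by (intro order_trans[OF _ small(1)]) (auto simp: y_def intro!: mult_right_mono)
      have "y\<^sup>2 \<le> \<delta>\<^sup>2" using y0 y1 by (intro power_mono) auto
      hence "y * (1 - \<delta>\<^sup>2 / 3) \<le> y * (1 - y\<^sup>2 / 3)" using y0 by (intro mult_left_mono) auto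
      also have "\<dots> \<le> tanh y" using y0 by (intro tanh_ge_cubic) auto
      finally have ty: "y * (1 - \<delta>\<^sup>2 / 3) \<le> tanh y" .
      have "exp (4 * lod (2 * s n)) \<le> (tanh_prod N (s n))\<^sup>2 / tanh y" unfolding y_def by (rule exp_lod_bounds(2)[OF s0 N1])
      also have "\<dots> \<le> ((R n)\<^sup>2 / (1 - 32 / (3 * real N))) / (y * (1 - \<delta>\<^sup>2 / 3))"
        using hi1 ty y0 d3 b0 by (intro frac_le mult_pos_pos) auto
      finally have "exp (4 * lod (2 * s n)) * (4 * s n) \<le> ((R n)\<^sup>2 / (1 - 32 / (3 * real N))) / (y * (1 - \<delta>\<^sup>2 / 3)) * (4 * s n)"
        using s0 by (intro mult_right_mono) auto
      also have "\<dots> = (R n)\<^sup>2 * (4 / (4 * real n + 3)) / ((1 - 32 / (3 * real N)) * (1 - \<delta>\<^sup>2 / 3))"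
      proof -
        have "y = (4 * real n + 3) * s n" by (simp add: y_def N_def)
        thus ?thesis using s0 by (simp add: mult_ac)
      qed
      also have "\<dots> = hi n" unfolding d2 hi_def N(1)[symmetric] using n by simp
      finally show ?thesis .
    qed
    show ?thesis using lo2 hi2 ..
  qed
  have ev: "\<forall>\<^sub>F n in sequentially. n \<ge> (11::nat)" by (rule eventually_ge_at_top)
  show ?thesis
  proof (rule tendsto_sandwich[OF _ _ lolim hilim])
    show "\<forall>\<^sub>F n in sequentially. lo n \<le> exp (4 * lod (2 * s n)) * (4 * s n)"
      by (rule eventually_mono[OF ev]) (use bounds in blast)
    show "\<forall>\<^sub>F n in sequentially. exp (4 * lod (2 * s n)) * (4 * s n) \<le> hi n"
      by (rule eventually_mono[OF ev]) (use bounds in blast)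
  qed
qed

definition lod_const :: real where "lod_const = ln gamma_ratio / 2 - ln 2 / 4"

text \<open>The second point of \<open>Lod_Lipschitz\<close> runs to 0 along 2/(n + 1)^2, twice the
  sequence of \<open>exp_lod_limit\<close>. Taking logarithms of that limit gives
  \<open>lod_const\<close>.\<close>

lemma Lod_expansion:
  assumes "z \<in> sector" "norm z \<le> 1/10"
  shows "norm (Lod z + Ln z / 4 - of_real lod_const) \<le> 25/2 * norm z"
proof -
  define t where "t = (\<lambda>n. 2 / (real (Suc n))\<^sup>2)"
  have t0: "t n > 0" for n by (simp add: t_def)
  have tl: "t \<longlonglongrightarrow> 0" unfolding t_def by real_asymp
  have "(\<lambda>n. ln (exp (4 * lod (t n)) * (2 * t n))) \<longlonglongrightarrow> ln (gamma_ratio\<^sup>2)"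
    using exp_lod_limit gamma_ratio_pos by (intro tendsto_ln) (auto simp: t_def)
  moreover have "ln (exp (4 * lod (t n)) * (2 * t n)) = 4 * (lod (t n) + ln (t n) / 4) + ln 2" for n
    using t0[of n] by (simp add: ln_mult)
  ultimately have "(\<lambda>n. 4 * (lod (t n) + ln (t n) / 4) + ln 2) \<longlonglongrightarrow> ln (gamma_ratio\<^sup>2)" by simp
  from tendsto_divide[OF tendsto_diff[OF this tendsto_const[of "ln 2"]] tendsto_const[of 4]]
  have "(\<lambda>n. lod (t n) + ln (t n) / 4) \<longlonglongrightarrow> (ln (gamma_ratio\<^sup>2) - ln 2) / 4" by (simp add: add_divide_distrib)
  also have "(ln (gamma_ratio\<^sup>2) - ln 2) / 4 = lod_const"
    using gamma_ratio_pos by (simp add: lod_const_def ln_realpow field_simps)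
  finally have "(\<lambda>n. complex_of_real (lod (t n) + ln (t n) / 4)) \<longlonglongrightarrow> of_real lod_const" by (rule tendsto_of_real)
  moreover have "complex_of_real (lod (t n) + ln (t n) / 4) = Lod (of_real (t n)) + Ln (of_real (t n)) / 4" for n
    using t0[of n] by (simp add: Lod_of_real Ln_of_real)
  ultimately have L: "(\<lambda>n. Lod (of_real (t n)) + Ln (of_real (t n)) / 4) \<longlonglongrightarrow> of_real lod_const" by simp
  have L1: "(\<lambda>n. norm ((Lod z + Ln z / 4) - (Lod (of_real (t n)) + Ln (of_real (t n)) / 4))) \<longlonglongrightarrow> norm ((Lod z + Ln z / 4) - of_real lod_const)"
    by (intro tendsto_intros L)
  have L2: "(\<lambda>n. 25/2 * norm (z - of_real (t n))) \<longlonglongrightarrow> 25/2 * norm (z - of_real 0)"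
    by (intro tendsto_intros tl)
  have ev: "\<forall>\<^sub>F n in sequentially. norm ((Lod z + Ln z / 4) - (Lod (of_real (t n)) + Ln (of_real (t n)) / 4)) \<le> 25/2 * norm (z - of_real (t n))"
  proof -
    have "\<forall>\<^sub>F n in sequentially. t n < 1/10" using order_tendstoD(2)[OF tl, of "1/10"] by simp
    thus ?thesis
    proof eventually_elim
      case (elim n)
      show ?case using t0[of n] elim by (intro Lod_Lipschitz assms) (auto simp: sector_def)
    qed
  qed
  from tendsto_le[OF _ L2 L1 ev] show ?thesis by simp
qed

subsection \<open>Numerical bounds for Gamma values\<close>

text \<open>Log-convexity between the equal values at 1 and 2.\<close>

lemma Gamma_le_1:
  assumes "1 \<le> x" "x \<le> (2::real)"
  shows "Gamma x \<le> 1"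
proof -
  have "(ln \<circ> Gamma) ((1 - (x - 1)) *\<^sub>R 1 + (x - 1) *\<^sub>R 2) \<le> (1 - (x - 1)) * (ln \<circ> Gamma) 1 + (x - 1) * (ln \<circ> Gamma) (2 :: real)"
    using assms by (intro convex_onD[OF log_convex_Gamma_real]) auto
  moreover have "Gamma (2 :: real) = 1" using Gamma_fact[of 1, where 'a = real] by simp
  ultimately have "ln (Gamma x) \<le> 0" by (simp add: algebra_simps)
  thus ?thesis using assms by (subst (asm) ln_le_zero_iff) (auto intro: Gamma_real_pos)
qed

lemma Gamma_quarter_bounds:
  "Gamma (1/4 :: real) \<le> 4" "Gamma (3/4 :: real) \<le> 4/3" "Gamma (1/4) * Gamma (3/4 :: real) = pi * sqrt 2"
proof -
  show "Gamma (1/4 :: real) \<le> 4" using Gamma_plus1_pos[of "1/4"] Gamma_le_1[of "5/4"] by simp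
  show "Gamma (3/4 :: real) \<le> 4/3" using Gamma_plus1_pos[of "3/4"] Gamma_le_1[of "7/4"] by simp
  have "Gamma (1/4 :: complex) * Gamma (1 - 1/4) = of_real pi / sin (of_real pi * (1/4))"
    by (rule Gamma_reflection_complex)
  also have "sin (of_real pi * (1/4) :: complex) = of_real (sin (pi / 4))" by (simp flip: sin_of_real)
  also have "Gamma (1/4 :: complex) = of_real (Gamma (1/4))" using Gamma_complex_of_real[of "1/4"] by simp
  also have "Gamma (1 - 1/4 :: complex) = of_real (Gamma (3/4))" using Gamma_complex_of_real[of "3/4"] by simp
  finally have "complex_of_real (Gamma (1/4) * Gamma (3/4)) = of_real (pi / sin (pi / 4))" by simp
  hence "Gamma (1/4) * Gamma (3/4) = pi / (sqrt 2 / 2)" unfolding of_real_eq_iff by (simp add: sin_45)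
  also have "\<dots> = pi * sqrt 2" by (simp add: field_simps flip: power2_eq_square)
  finally show "Gamma (1/4) * Gamma (3/4 :: real) = pi * sqrt 2" .
qed

text \<open>The product of the two values is known from the reflection formula, so the upper bound
  for either one is a lower bound for the other.\<close>

lemma gamma_ratio_bounds: "1 \<le> gamma_ratio" "gamma_ratio \<le> 4"
proof -
  have s2: "sqrt 2 \<ge> (7/5 :: real)" by (rule real_le_rsqrt) (simp add: power2_eq_square)
  have p: "Gamma (1/4 :: real) > 0" "Gamma (3/4 :: real) > 0" by (auto intro: Gamma_real_pos)
  have "21/5 \<le> pi * sqrt 2" using mult_mono[of 3 pi "7/5" "sqrt 2"] s2 pi_gt3 by simp
  hence 1: "21/5 \<le> Gamma (1/4) * Gamma (3/4 :: real)" by (simp only: Gamma_quarter_bounds)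
  have "Gamma (1/4) * Gamma (3/4 :: real) \<le> Gamma (1/4) * (4/3)" using p Gamma_quarter_bounds by (intro mult_left_mono) auto
  with 1 have "Gamma (1/4 :: real) \<ge> 4/3" by linarith
  thus "1 \<le> gamma_ratio" unfolding gamma_ratio_def using p Gamma_quarter_bounds by (simp add: le_divide_eq)
  have "Gamma (1/4) * Gamma (3/4 :: real) \<le> 4 * Gamma (3/4)" using p Gamma_quarter_bounds by (intro mult_right_mono) auto
  with 1 have "Gamma (3/4 :: real) \<ge> 1" by linarith
  thus "gamma_ratio \<le> 4" unfolding gamma_ratio_def using p Gamma_quarter_bounds by (simp add: divide_le_eq)
qed

lemma abs_lod_const: "\<bar>lod_const\<bar> \<le> 1"
proof -
  have "0 \<le> ln gamma_ratio" using gamma_ratio_bounds by simp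
  moreover have "ln gamma_ratio \<le> ln (2 ^ 2)" using gamma_ratio_bounds by (subst ln_le_cancel_iff) auto
  moreover have "ln (2 ^ 2 :: real) = 2 * ln 2" by (subst ln_realpow) auto
  ultimately show ?thesis using ln_2_less_1 ln_gt_zero[of 2] unfolding lod_const_def by (auto simp: abs_le_iff)
qed

subsection \<open>The arc next to the major arc\<close>

lemma pi_sq_bounds: "9869/1000 \<le> pi\<^sup>2" "pi\<^sup>2 \<le> 98697/10000"
proof -
  have "(31415/10000)\<^sup>2 \<le> pi\<^sup>2" using pi_approx by (intro power_mono) auto
  thus "9869/1000 \<le> pi\<^sup>2" by (simp add: power2_eq_square)
  have "pi\<^sup>2 \<le> (31416/10000)\<^sup>2" using pi_approx by (intro power_mono) auto
  thus "pi\<^sup>2 \<le> 98697/10000" by (simp add: power2_eq_square)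
qed

lemma Re_of_real_divide: "Re (of_real a / z) = a * Re z / (norm z)\<^sup>2"
  by (simp add: Re_divide cmod_power2)

lemma Re_complex_of_real_mult: "Re (of_real a * z) = a * Re z"
  by simp

lemma Re_Lev_sector:
  assumes "z \<in> sector" "norm z \<le> 1/20"
  shows "Re (Lev z) \<le> pi\<^sup>2 / 48 * Re z / (norm z)\<^sup>2 - ln 2 / 4 + 11 * norm z"
proof -
  have "Re (Lev z - of_real (pi\<^sup>2 / 48) / z + of_real (ln 2 / 4)) \<le> 11 * norm z"
    using Lev_expansion[OF assms] complex_Re_le_cmod order_trans by blast
  moreover have "Re (of_real (pi\<^sup>2 / 48) / z) = pi\<^sup>2 / 48 * Re z / (norm z)\<^sup>2" by (rule Re_of_real_divide)
  ultimately show ?thesis by simp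
qed

lemma abs_Re_Lod_sector:
  assumes "z \<in> sector" "norm z \<le> 1/10"
  shows "\<bar>Re (Lod z) + ln (norm z) / 4 - lod_const\<bar> \<le> 25/2 * norm z"
proof -
  have "z \<noteq> 0" using assms by (auto simp: sector_def)
  hence "Re (Lod z + Ln z / 4 - of_real lod_const) = Re (Lod z) + ln (norm z) / 4 - lod_const" by simp
  thus ?thesis using Lod_expansion[OF assms] abs_Re_le_cmod order_trans by metis
qed

text \<open>From |\<theta>| >= t on, |\<tau>|^2 >= 2 t^2 halves the leading term of the even series,
  to less than 0.1031/t; the odd series is only logarithmic in t. Halving is far more than the bound
  1/(5 t) asks for.\<close>

lemma minor_arc_1:
  assumes t: "0 < t" "t \<le> 131/20000" and \<theta>: "t \<le> \<bar>\<theta>\<bar>" "\<bar>\<theta>\<bar> \<le> 5/4 * t"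
  shows "Re (Lev (Complex t \<theta>)) + \<bar>Re (Lod (Complex t \<theta>))\<bar> \<le> 1 / (5 * t) + 7/4"
proof -
  define z where "z = Complex t \<theta>"
  have Rz: "Re z = t" by (simp add: z_def)
  have zs: "z \<in> sector" using t \<theta> by (auto simp: z_def sector_def)
  have nsq: "(norm z)\<^sup>2 = t\<^sup>2 + \<theta>\<^sup>2" by (simp add: z_def cmod_power2)
  have th2: "t\<^sup>2 \<le> \<theta>\<^sup>2" using \<theta> t by (subst abs_le_square_iff[symmetric]) auto
  have n2: "2 * t\<^sup>2 \<le> (norm z)\<^sup>2" using nsq th2 by simp
  have nt: "t \<le> norm z" using abs_Re_le_cmod[of z] t by (simp add: z_def)
  have nz: "norm z \<le> 9/4 * t" using cmod_le[of z] t \<theta> by (simp add: z_def)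
  have n20: "norm z \<le> 3/200" using nz t by simp
  have "pi\<^sup>2 / 48 * t / (norm z)\<^sup>2 \<le> pi\<^sup>2 / 48 * t / (2 * t\<^sup>2)"
    using n2 t by (intro divide_left_mono mult_pos_pos) (auto intro: less_le_trans)
  also have "\<dots> = pi\<^sup>2 / 96 * (1 / t)" using t by (simp add: power2_eq_square)
  also have "\<dots> \<le> 103/1000 * (1 / t)" using pi_sq_bounds t by (intro mult_right_mono) auto
  finally have c1: "pi\<^sup>2 / 48 * t / (norm z)\<^sup>2 \<le> 103/1000 * (1 / t)" .
  have 1: "Re (Lev z) \<le> 103/1000 * (1 / t) + 11 * (3/200)"
  proof -
    have "norm z \<le> 1/20" using n20 by simp
    from Re_Lev_sector[OF zs this] have "Re (Lev z) \<le> pi\<^sup>2 / 48 * t / (norm z)\<^sup>2 - ln 2 / 4 + 11 * norm z"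
      by (simp only: Rz)
    with c1 n20 ln_gt_zero[of "2::real"] show ?thesis by linarith
  qed
  have lnb: "\<bar>ln (norm z)\<bar> \<le> ln (1 / t)"
  proof -
    have "ln t \<le> ln (norm z)" using nt t by (subst ln_le_cancel_iff) linarith+
    moreover have "ln (norm z) \<le> 0" using nt n20 t by (subst ln_le_zero_iff) linarith+
    ultimately
    show ?thesis using t by (simp add: ln_div)
  qed
  \<comment> \<open>The tangent of the logarithm at 4, which bounds (ln (1/t))/4 by 1/(16 t) plus a
    constant.\<close>
  have "ln (1 / t / 4) \<le> 1 / t / 4 - 1" using t by (intro ln_le_minus_one) auto
  moreover have "ln (1 / t / 4) = ln (1 / t) - 2 * ln 2"
  proof -
    have "ln (1 / t / 4) = ln (1 / t) - ln (2 ^ 2)" using t by (subst ln_div) auto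
    thus ?thesis by (subst (asm) ln_realpow) auto
  qed
  ultimately have l4: "ln (1 / t) \<le> 1/4 * (1 / t) + 1" using ln_2_less_1 by simp
  define y where "y = 1 / t"
  have "\<bar>Re (Lod z)\<bar> \<le> 3/16 + ln y / 4 + 1"
    using abs_Re_Lod_sector[OF zs] n20 lnb abs_lod_const unfolding y_def by linarith
  moreover have "y \<ge> 152" using t by (simp add: field_simps y_def)
  moreover note 1[folded y_def] l4[folded y_def]
  ultimately have "Re (Lev z) + \<bar>Re (Lod z)\<bar> \<le> 1/5 * y + 7/4" by linarith
  hence "Re (Lev z) + \<bar>Re (Lod z)\<bar> \<le> 1/5 * (1 / t) + 7/4" unfolding y_def .
  thus ?thesis by (simp add: z_def)
qed

subsection \<open>Arguments of intermediate size\<close>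

lemma odd_squares_sums: "(\<lambda>j. 1 / (2 * real j + 1)\<^sup>2) sums (pi\<^sup>2 / 8)"
  and alternating_squares_sums: "(\<lambda>j. (-1) ^ j / (real j + 1)\<^sup>2) sums (pi\<^sup>2 / 12)"
proof -
  have S: "(\<lambda>n. 1 / (real n + 1)\<^sup>2) sums (pi\<^sup>2 / 6)"
    using inverse_squares_sums by (simp add: add.commute)
  have E: "(\<lambda>j. 1 / (2 * real j + 2)\<^sup>2) sums (pi\<^sup>2 / 24)"
  proof -
    have "(\<lambda>j. 1/4 * (1 / (real j + 1)\<^sup>2)) sums (1/4 * (pi\<^sup>2 / 6))" by (rule sums_mult[OF S])
    moreover have "1/4 * (1 / (real j + 1)\<^sup>2) = 1 / (2 * real j + 2)\<^sup>2" for j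
    proof -
      have "2 * real j + 2 = 2 * (real j + 1)" by simp
      thus ?thesis by (simp only: power_mult_distrib) simp
    qed
    ultimately show ?thesis by simp
  qed
  have grp: "sum f {j * 2..<j * 2 + 2} = f (2 * j) + f (2 * j + 1)" for f :: "nat \<Rightarrow> real" and j
  proof -
    have "{j * 2..<j * 2 + 2} = {2 * j, 2 * j + 1}" by auto
    thus ?thesis by simp
  qed
  from sums_group[OF S, of 2] have "(\<lambda>j. 1 / (2 * real j + 1)\<^sup>2 + 1 / (2 * real j + 2)\<^sup>2) sums (pi\<^sup>2 / 6)"
    unfolding grp by (simp add: add_ac)
  from sums_diff[OF this E] show O: "(\<lambda>j. 1 / (2 * real j + 1)\<^sup>2) sums (pi\<^sup>2 / 8)" by simp
  have "summable (\<lambda>j. (-1) ^ j / (real j + 1)\<^sup>2)"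
    by (rule summable_comparison_test'[OF sums_summable[OF S]]) simp
  hence A: "(\<lambda>j. (-1) ^ j / (real j + 1)\<^sup>2) sums (\<Sum>j. (-1) ^ j / (real j + 1)\<^sup>2)" by (rule summable_sums)
  from sums_group[OF A, of 2]
  have "(\<lambda>j. 1 / (2 * real j + 1)\<^sup>2 - 1 / (2 * real j + 2)\<^sup>2) sums (\<Sum>j. (-1) ^ j / (real j + 1)\<^sup>2)"
    unfolding grp by (simp add: add_ac)
  with sums_diff[OF O E] have "(\<Sum>j. (-1) ^ j / (real j + 1)\<^sup>2) = pi\<^sup>2 / 12" using sums_unique2 by fastforce
  with A show "(\<lambda>j. (-1) ^ j / (real j + 1)\<^sup>2) sums (pi\<^sup>2 / 12)" by simp
qed

lemma coth_le_real:
  assumes "0 < x" "x \<le> (1::real)"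
  shows "cosh x / sinh x \<le> 1 / x + x"
proof -
  have ch: "cosh (of_real x) = (of_real (cosh x) :: complex)" "sinh (of_real x) = (of_real (sinh x) :: complex)"
    by (simp_all add: complex_eq_iff Re_cosh Im_cosh Re_sinh Im_sinh)
  have "norm (coth_reg (of_real x)) \<le> norm (complex_of_real x)" using assms by (intro norm_coth_reg_le) auto
  moreover have "coth_reg (of_real x) = of_real (cosh x / sinh x - 1 / x)" unfolding coth_reg_def ch by simp
  ultimately have "\<bar>cosh x / sinh x - 1 / x\<bar> \<le> x" using assms by (simp only: norm_of_real abs_of_pos)
  thus ?thesis by linarith
qed

text \<open>Up to real part 1 the arithmetic-geometric mean inequality bounds the real part by (coth
  x)/4, with half the pole that the modulus bound 1/(2 sinh x) has. This factor 2 is needed in the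
  termwise estimate. The second summand has the shape required by the arctangent bound.\<close>

lemma Re_half_sech_le:
  assumes x: "Re z > 0"
  shows "\<bar>Re (1 / (2 * cosh z))\<bar> \<le> 1 / (4 * Re z) + 1/2 * (Re z / (1 + (Re z)\<^sup>2))"
proof -
  define x where "x = Re z"
  have x0: "x > 0" using x by (simp add: x_def)
  have sx: "sinh x > 0" "x \<le> sinh x" using x0 le_sinh[of x] by auto
  show ?thesis
  proof (cases "x \<le> 1")
    case True
    define c where "c = cos (Im z)"
    have "Re (1 / (2 * cosh z)) = cosh x * c / (2 * ((sinh x)\<^sup>2 + c\<^sup>2))"
    proof -
      have "1 / (2 * cosh z) = of_real (1/2) / cosh z" by simp
      hence "Re (1 / (2 * cosh z)) = 1/2 * Re (cosh z) / (norm (cosh z))\<^sup>2" by (simp only: Re_of_real_divide)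
      thus ?thesis by (simp add: norm_cosh_sq Re_cosh x_def c_def)
    qed
    hence "\<bar>Re (1 / (2 * cosh z))\<bar> = cosh x * \<bar>c\<bar> / (2 * ((sinh x)\<^sup>2 + c\<^sup>2))"
      by (simp add: abs_mult abs_divide)
    also have "\<dots> \<le> cosh x * 1 / (2 * (2 * sinh x))"
    proof -
      have "0 \<le> (sinh x - \<bar>c\<bar>)\<^sup>2" by simp
      hence "2 * sinh x * \<bar>c\<bar> \<le> (sinh x)\<^sup>2 + c\<^sup>2" by (simp add: power2_eq_square algebra_simps)
      hence "\<bar>c\<bar> / ((sinh x)\<^sup>2 + c\<^sup>2) \<le> 1 / (2 * sinh x)"
        using sx by (simp add: divide_simps add_pos_nonneg sum_power2_eq_zero_iff) (auto simp: mult_ac)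
      hence "cosh x / 2 * (\<bar>c\<bar> / ((sinh x)\<^sup>2 + c\<^sup>2)) \<le> cosh x / 2 * (1 / (2 * sinh x))"
        by (intro mult_left_mono) auto
      thus ?thesis by simp
    qed
    also have "\<dots> = 1/4 * (cosh x / sinh x)" by simp
    also have "\<dots> \<le> 1/4 * (1 / x + x)" using coth_le_real[OF x0 True] by simp
    also have "\<dots> = 1 / (4 * x) + 1/2 * (x / 2)" by simp
    also have "x / 2 \<le> x / (1 + x\<^sup>2)" using x0 True by (intro divide_left_mono) (auto simp: add_pos_nonneg power_le_one)
    finally show ?thesis by (simp add: x_def)
  next
    case False
    have "\<bar>Re (1 / (2 * cosh z))\<bar> \<le> norm (1 / (2 * cosh z))" by (rule abs_Re_le_cmod)
    also have "\<dots> = 1 / (2 * norm (cosh z))" by (simp add: norm_divide norm_mult)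
    also have "\<dots> \<le> 1 / (2 * x)" using sinh_le_norm_cosh[of z] sx x0 by (intro frac_le) (auto simp: x_def)
    also have "\<dots> = 1 / (4 * x) + 1/2 * (x / (x\<^sup>2 + x\<^sup>2))" using x0 by (simp add: field_simps power2_eq_square)
    also have "x / (x\<^sup>2 + x\<^sup>2) \<le> x / (1 + x\<^sup>2)"
      using False x0 by (intro divide_left_mono) (auto simp: add_pos_nonneg one_le_power)
    finally show ?thesis by (simp add: x_def)
  qed
qed

text \<open>From the second term on, the even series is bounded by moduli and the odd one by
  \<open>Re_half_sech_le\<close>. The sums of inverse squares leave 5 \<pi>^2/96 - 3/8 < 0.1391, so
  about 0.06/t remains for the two first terms; \<pi>/4 is half the arctangent limit.\<close>

lemma Lev_Lod_termwise:
  fixes t \<theta> :: real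
  assumes t: "0 < t"
  defines "z \<equiv> Complex t \<theta>"
  shows "Re (Lev z) + \<bar>Re (Lod z)\<bar> \<le> Re (lev_term 0 z) + \<bar>Re (lod_term 0 z)\<bar> + 1391/10000 * (1 / t) + pi / 4"
proof -
  have Rz: "Re z > 0" using t by (simp add: z_def)
  define A where "A = (\<lambda>j. 1 / (8 * t) * (1 / (real (Suc j) + 1)\<^sup>2))"
  define B where "B = (\<lambda>j. 1 / (4 * t) * (1 / (2 * real (Suc j) + 1)\<^sup>2))"
  define C where "C = (\<lambda>j. 1/2 * (t / (1 + (real (Suc j) * t)\<^sup>2)))"
  have As: "A sums (1 / (8 * t) * (pi\<^sup>2 / 6 - 1))"
  proof -
    have S: "(\<lambda>n. 1 / (real n + 1)\<^sup>2) sums (pi\<^sup>2 / 6)"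
      using inverse_squares_sums by (simp add: add.commute)
    have "(\<lambda>n. 1 / (real (Suc n) + 1)\<^sup>2) sums (pi\<^sup>2 / 6 - 1)"
      by (subst sums_Suc_iff) (use S in simp)
    thus ?thesis unfolding A_def by (rule sums_mult)
  qed
  have Bs: "B sums (1 / (4 * t) * (pi\<^sup>2 / 8 - 1))"
  proof -
    have "(\<lambda>n. 1 / (2 * real (Suc n) + 1)\<^sup>2) sums (pi\<^sup>2 / 8 - 1)"
      by (subst sums_Suc_iff) (use odd_squares_sums in simp)
    thus ?thesis unfolding B_def by (rule sums_mult)
  qed
  have Cb: "norm (C k) \<le> 1/2 * (t / (1 + (real (Suc k) * t)\<^sup>2))" for k
    using t by (simp add: C_def add_nonneg_nonneg)
  have Cs: "summable C" and Cle: "suminf C \<le> 1/2 * (pi / 2)"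
    using norm_suminf_le_arctan[OF t _ Cb] abs_ge_self[of "suminf C"] by (auto intro: order_trans)
  have lev: "(\<lambda>j. Re (lev_term j z)) sums Re (Lev z)"
    unfolding Lev_def by (intro sums_Re summable_sums Lev_eq_Lcoth(1) Rz)
  have lod: "(\<lambda>j. Re (lod_term j z)) sums Re (Lod z)"
    unfolding Lod_def by (intro sums_Re summable_sums Lod_deriv(1) Rz)
  have levb: "Re (lev_term (Suc j) z) \<le> A j" for j
  proof -
    have "Re (lev_term (Suc j) z) \<le> norm (lev_term (Suc j) z)" by (rule complex_Re_le_cmod)
    also have "\<dots> = 1 / (4 * (real j + 2) * norm (sinh (2 * of_nat (Suc (Suc j)) * z)))"
      unfolding lev_term_def norm_divide norm_mult norm_of_nat by simp
    also have "\<dots> \<le> 1 / (4 * (real j + 2) * (2 * (real j + 2) * t))"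
    proof -
      have "2 * (real j + 2) * t \<le> sinh (2 * (real j + 2) * t)" using t by (intro le_sinh) auto
      also have ReX: "2 * (real j + 2) * t = Re (2 * of_nat (Suc (Suc j)) * z)" by (simp add: z_def)
      also have "sinh \<dots> \<le> norm (sinh (2 * of_nat (Suc (Suc j)) * z))"
        using Rz by (intro sinh_le_norm_sinh) simp
      finally have "2 * (real j + 2) * t \<le> norm (sinh (2 * of_nat (Suc (Suc j)) * z))" by (simp only: ReX)
      thus ?thesis using t by (intro frac_le mult_left_mono mult_pos_pos) auto
    qed
    also have "\<dots> = A j" by (simp add: A_def power2_eq_square field_simps)
    finally show ?thesis .
  qed
  have lodb: "\<bar>Re (lod_term (Suc j) z)\<bar> \<le> B j + C j" for j
  proof -
    define k where "k = 2 * real (Suc j) + 1"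
    have k: "k > 0" "k \<ge> real (Suc j)" by (auto simp: k_def)
    have ck: "of_nat (2 * Suc j + 1) = complex_of_real k" by (simp add: k_def)
    have "lod_term (Suc j) z = of_real (1 / k) * (1 / (2 * cosh (of_real k * z)))"
      unfolding lod_term_def ck by simp
    hence "\<bar>Re (lod_term (Suc j) z)\<bar> = 1 / k * \<bar>Re (1 / (2 * cosh (of_real k * z)))\<bar>"
      using k by (simp only: Re_complex_of_real_mult abs_mult) simp
    also have "\<dots> \<le> 1 / k * (1 / (4 * (k * t)) + 1/2 * (k * t / (1 + (k * t)\<^sup>2)))"
      using Re_half_sech_le[of "of_real k * z"] k t by (intro mult_left_mono) (auto simp: z_def)
    also have "\<dots> = B j + 1/2 * (t / (1 + (k * t)\<^sup>2))"
    proof -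
      have "1 / k * (k * t / D) = t / D" for D using k by simp
      moreover have "1 / k * (1 / (4 * (k * t))) = B j"
        by (simp only: B_def k_def[symmetric]) (simp add: power2_eq_square)
      ultimately show ?thesis by (simp only: distrib_left mult.left_commute[of "1 / k" "1 / 2"])
    qed
    also have "t / (1 + (k * t)\<^sup>2) \<le> t / (1 + (real (Suc j) * t)\<^sup>2)"
      using k t by (intro divide_left_mono add_left_mono power_mono mult_right_mono mult_pos_pos) (auto simp: add_pos_nonneg)
    finally show ?thesis by (simp add: C_def)
  qed
  have 1: "Re (Lev z) \<le> Re (lev_term 0 z) + 1 / (8 * t) * (pi\<^sup>2 / 6 - 1)"
  proof -
    have "(\<lambda>j. Re (lev_term (Suc j) z)) sums (Re (Lev z) - Re (lev_term 0 z))" using lev by (subst sums_Suc_iff) simp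
    from sums_le[OF levb this As] show ?thesis by simp
  qed
  have 2: "\<bar>Re (Lod z)\<bar> \<le> \<bar>Re (lod_term 0 z)\<bar> + (1 / (4 * t) * (pi\<^sup>2 / 8 - 1) + suminf C)"
  proof -
    have s: "(\<lambda>j. Re (lod_term (Suc j) z)) sums (Re (Lod z) - Re (lod_term 0 z))" using lod by (subst sums_Suc_iff) simp
    have BC: "(\<lambda>j. B j + C j) sums (1 / (4 * t) * (pi\<^sup>2 / 8 - 1) + suminf C)" by (intro sums_add Bs summable_sums Cs)
    have "norm (\<Sum>j. Re (lod_term (Suc j) z)) \<le> (\<Sum>j. B j + C j)"
      using lodb BC by (intro norm_suminf_le) (auto simp: sums_iff)
    hence "\<bar>Re (Lod z) - Re (lod_term 0 z)\<bar> \<le> 1 / (4 * t) * (pi\<^sup>2 / 8 - 1) + suminf C"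
      using s BC by (simp add: sums_iff)
    thus ?thesis by linarith
  qed
  have "1 / (8 * t) * (pi\<^sup>2 / 6 - 1) + 1 / (4 * t) * (pi\<^sup>2 / 8 - 1) = (5/96 * pi\<^sup>2 - 3/8) * (1 / t)"
    using t by (simp add: field_simps)
  also have "\<dots> \<le> 1391/10000 * (1 / t)" using pi_sq_bounds t by (intro mult_right_mono) auto
  finally show ?thesis using 1 2 Cle by linarith
qed

lemma sin_ge_cubic: "x \<ge> 0 \<Longrightarrow> x * (1 - x\<^sup>2 / 6) \<le> sin (x::real)"
proof -
  assume x: "x \<ge> 0"
  have "(\<lambda>x. sin x - x + x ^ 3 / 6) 0 \<le> (\<lambda>x. sin x - x + x ^ 3 / 6) x"
  proof (rule DERIV_nonneg_imp_nondecreasing[OF x])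
    fix y :: real
    have "((\<lambda>x. sin x - x + x ^ 3 / 6) has_real_derivative (cos y - 1 + y\<^sup>2 / 2)) (at y)"
      by (auto intro!: derivative_eq_intros simp: power2_eq_square)
    thus "\<exists>d. ((\<lambda>x. sin x - x + x ^ 3 / 6) has_real_derivative d) (at y) \<and> 0 \<le> d"
      using cos_ge_quadratic[of y] by (intro exI[of _ "cos y - 1 + y\<^sup>2 / 2"]) auto
  qed
  thus ?thesis by (simp add: power2_eq_square power3_eq_cube algebra_simps)
qed

lemma lod_term_0_le:
  assumes "t > 0" "cos \<theta> \<ge> c" "c > 0"
  shows "\<bar>Re (lod_term 0 (Complex t \<theta>))\<bar> \<le> 1 / (2 * c)"
proof -
  have "c \<le> norm (cosh (Complex t \<theta>))"
  proof (rule power2_le_imp_le)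
    have "c\<^sup>2 \<le> (cos \<theta>)\<^sup>2" using assms by (intro power_mono) auto
    thus "c\<^sup>2 \<le> (norm (cosh (Complex t \<theta>)))\<^sup>2" by (simp add: norm_cosh_sq add_increasing)
  qed simp
  hence "norm (lod_term 0 (Complex t \<theta>)) \<le> 1 / (2 * c)"
    using assms by (simp add: lod_term_def norm_divide norm_mult frac_le)
  thus ?thesis using abs_Re_le_cmod order_trans by blast
qed

lemma Re_lev_term_0:
  "Re (lev_term 0 (Complex t \<theta>)) = sinh (2 * t) * cos (2 * \<theta>) / (4 * ((sinh (2 * t))\<^sup>2 + (sin (2 * \<theta>))\<^sup>2))"
proof -
  have "lev_term 0 (Complex t \<theta>) = of_real (1/4) / sinh (2 * Complex t \<theta>)" by (simp add: lev_term_def)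
  hence "Re (lev_term 0 (Complex t \<theta>)) = 1/4 * Re (sinh (2 * Complex t \<theta>)) / (norm (sinh (2 * Complex t \<theta>)))\<^sup>2"
    by (simp only: Re_of_real_divide)
  thus ?thesis by (simp add: norm_sinh_sq Re_sinh)
qed

text \<open>For |\<theta>| >= \<pi>/4 the first even term has nonpositive real part, and the
  distance 10 t from the right angle keeps the first odd term below 0.0501/t. For smaller |\<theta>|
  the first odd term is bounded by a constant, and |\<theta>| >= 5 t/4 keeps the first even term
  below 0.0491/t. Both fit into the 0.06/t left over.\<close>

lemma minor_arc_2:
  assumes t: "0 < t" "t \<le> 131/20000" and \<theta>: "5/4 * t \<le> \<bar>\<theta>\<bar>" "\<bar>\<theta>\<bar> \<le> pi/2 - 10 * t"
  shows "Re (Lev (Complex t \<theta>)) + \<bar>Re (Lod (Complex t \<theta>))\<bar> \<le> 1 / (5 * t) + 7/4"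
proof -
  have T: "Re (Lev (Complex t \<theta>)) + \<bar>Re (Lod (Complex t \<theta>))\<bar> \<le>
      Re (lev_term 0 (Complex t \<theta>)) + \<bar>Re (lod_term 0 (Complex t \<theta>))\<bar> + 1391/10000 * (1 / t) + pi / 4"
    by (rule Lev_Lod_termwise) fact
  have ca: "cos \<theta> = cos \<bar>\<theta>\<bar>" "cos (2 * \<theta>) = cos (2 * \<bar>\<theta>\<bar>)" "(sin (2 * \<theta>))\<^sup>2 = (sin (2 * \<bar>\<theta>\<bar>))\<^sup>2"
    by (auto simp: abs_if)
  have p4: "pi / 4 \<le> 786/1000" using pi_approx by simp
  have t152: "1 / t \<ge> 152" using t by (simp add: field_simps)
  have S0: "sinh (2 * t) > 0" using t by simp
  show ?thesis
  proof (cases "\<bar>\<theta>\<bar> \<ge> pi / 4")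
    case True
    have "cos (2 * \<bar>\<theta>\<bar>) \<le> cos (pi / 2)"
      using True \<theta> t pi_gt_zero by (intro cos_monotone_0_pi_le) auto
    hence "cos (2 * \<theta>) \<le> 0" using ca by simp
    hence 1: "Re (lev_term 0 (Complex t \<theta>)) \<le> 0" unfolding Re_lev_term_0 using S0
      by (intro divide_nonpos_nonneg mult_nonneg_nonpos) auto
    have "999/1000 * (10 * t) \<le> sin (10 * t)"
    proof -
      have "(10 * t)\<^sup>2 \<le> (131/2000)\<^sup>2" using t by (intro power_mono) auto
      hence "10 * t * (999/1000) \<le> 10 * t * (1 - (10 * t)\<^sup>2 / 6)" using t by (intro mult_left_mono) (auto simp: power2_eq_square)
      also have "\<dots> \<le> sin (10 * t)" using t by (intro sin_ge_cubic) auto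
      finally show ?thesis by simp
    qed
    also have "sin (10 * t) = cos (pi/2 - 10 * t)" by (simp add: cos_diff)
    also have "\<dots> \<le> cos \<bar>\<theta>\<bar>" using \<theta> t pi_gt_zero by (intro cos_monotone_0_pi_le) auto
    finally have "\<bar>Re (lod_term 0 (Complex t \<theta>))\<bar> \<le> 1 / (2 * (999/1000 * (10 * t)))"
      using t ca(1) by (intro lod_term_0_le) linarith+
    also have "\<dots> \<le> 501/10000 * (1 / t)" using t by (simp add: field_simps)
    finally show ?thesis using T 1 p4 t152 by simp
  next
    case False
    have s1: "4 * t\<^sup>2 \<le> (sinh (2 * t))\<^sup>2"
    proof -
      have "(2 * t)\<^sup>2 \<le> (sinh (2 * t))\<^sup>2" using t le_sinh[of "2 * t"] by (intro power_mono) auto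
      thus ?thesis by (simp add: power_mult_distrib)
    qed
    have s2: "sinh (2 * t) \<le> 201/100 * t"
    proof -
      have sh: "sinh (of_real (2 * t)) = (of_real (sinh (2 * t)) :: complex)"
        by (simp add: complex_eq_iff Re_sinh Im_sinh)
      have "norm (sinh (of_real (2 * t)) - complex_of_real (2 * t)) \<le> 9/50 * norm (complex_of_real (2 * t)) ^ 3"
        using t by (intro norm_sinh_lower(2)) auto
      hence "\<bar>sinh (2 * t) - 2 * t\<bar> \<le> 9/50 * (2 * t) ^ 3"
        using t unfolding sh of_real_diff[symmetric] norm_of_real by simp
      moreover have "(2 * t) ^ 3 \<le> 1/100 * t"
      proof -
        have "t * t \<le> 131/20000 * (131/20000)" using t by (intro mult_mono) auto
        hence "8 * (t * t) * t \<le> 1/100 * t" using t by (intro mult_right_mono) auto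
        thus ?thesis by (simp add: power3_eq_cube)
      qed
      ultimately show ?thesis by linarith
    qed
    have s3: "6245/1000 * t\<^sup>2 \<le> (sin (2 * \<bar>\<theta>\<bar>))\<^sup>2"
    proof -
      have "(5/2 * t)\<^sup>2 \<le> (1/50)\<^sup>2" using t by (intro power_mono) auto
      hence "5/2 * t * (9999/10000) \<le> 5/2 * t * (1 - (5/2 * t)\<^sup>2 / 6)" using t by (intro mult_left_mono) (auto simp: power2_eq_square)
      also have "\<dots> \<le> sin (5/2 * t)" using t by (intro sin_ge_cubic) auto
      also have "\<dots> \<le> sin (2 * \<bar>\<theta>\<bar>)" using False \<theta> t pi_gt_zero by (intro sin_monotone_2pi_le) auto
      finally have "(5/2 * t * (9999/10000))\<^sup>2 \<le> (sin (2 * \<bar>\<theta>\<bar>))\<^sup>2" using t by (intro power_mono) auto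
      moreover have "6245/1000 * t\<^sup>2 \<le> (5/2 * t * (9999/10000))\<^sup>2" by (simp add: power_mult_distrib power2_eq_square)
      ultimately show ?thesis by linarith
    qed
    have "Re (lev_term 0 (Complex t \<theta>)) \<le> sinh (2 * t) * 1 / (4 * ((sinh (2 * t))\<^sup>2 + (sin (2 * \<theta>))\<^sup>2))"
      unfolding Re_lev_term_0 using S0 by (intro divide_right_mono mult_left_mono) auto
    also have "\<dots> \<le> (201/100 * t) / (4 * (4 * t\<^sup>2 + 6245/1000 * t\<^sup>2))"
      using s1 s2 s3 t S0 unfolding ca by (intro frac_le mult_left_mono add_mono mult_pos_pos) auto
    also have "\<dots> = 201/4098 * (1 / t)" using t by (simp add: power2_eq_square)
    finally have 1: "Re (lev_term 0 (Complex t \<theta>)) \<le> 201/4098 * (1 / t)" .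
    have "7/10 \<le> cos (pi / 4)"
    proof -
      have "7/5 \<le> sqrt (2::real)" by (rule real_le_rsqrt) (simp add: power2_eq_square)
      thus ?thesis by (simp add: cos_45)
    qed
    also have "\<dots> \<le> cos \<bar>\<theta>\<bar>" using False pi_gt_zero by (intro cos_monotone_0_pi_le) auto
    finally have "\<bar>Re (lod_term 0 (Complex t \<theta>))\<bar> \<le> 1 / (2 * (7/10))"
      using t ca(1) by (intro lod_term_0_le) linarith+
    thus ?thesis using T 1 p4 t152 by simp
  qed
qed

subsection \<open>Arguments close to a right angle\<close>

text \<open>After a shift by i \<pi>/2 both series consist of reciprocals of sinh. The poles split
  off here are summed exactly, to a multiple of \<pi>^2 and to Catalan's constant; the regular parts
  sum to a bounded quantity.\<close>

definition csch_reg :: "complex \<Rightarrow> complex" where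
  "csch_reg z = 1 / (2 * sinh z) - 1 / (2 * z)"

text \<open>The doubling formula carries the Taylor bound from radius 1 to radius 2.\<close>

lemma norm_sinh_minus_le:
  assumes "norm (z::complex) \<le> 2"
  shows "norm (sinh z - z) \<le> 43/200 * norm z ^ 3"
proof -
  define h where "h = z / 2"
  have h: "norm h \<le> 1" "norm h = norm z / 2" using assms by (auto simp: h_def norm_divide)
  have c1: "norm (cosh h - 1) \<le> 17/30 * (norm h)\<^sup>2"
  proof -
    have "norm (cosh h - 1) \<le> norm (cosh h - 1 - h\<^sup>2 / 2) + norm (h\<^sup>2 / 2)"
      using norm_triangle_ineq[of "cosh h - 1 - h\<^sup>2 / 2" "h\<^sup>2 / 2"] by simp
    also have "\<dots> \<le> norm h ^ 4 / 15 + (norm h)\<^sup>2 / 2"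
      using norm_cosh_Taylor[OF h(1)] by (intro add_mono) (auto simp: norm_divide norm_power)
    also have "norm h ^ 4 \<le> (norm h)\<^sup>2" using h by (intro power_decreasing) auto
    finally show ?thesis by simp
  qed
  have c2: "norm (cosh h) \<le> 47/30"
  proof -
    have "norm (cosh h) \<le> norm (cosh h - 1) + 1" using norm_triangle_ineq[of "cosh h - 1" 1] by simp
    moreover have "(norm h)\<^sup>2 \<le> 1" using h by (simp add: power_le_one)
    ultimately show ?thesis using c1 by simp
  qed
  have "sinh z - z = 2 * (sinh h - h) * cosh h + 2 * h * (cosh h - 1)"
    using sinh_double[of h] by (simp add: h_def algebra_simps)
  also have "norm \<dots> \<le> 2 * (9/50 * norm h ^ 3) * (47/30) + 2 * norm h * (17/30 * (norm h)\<^sup>2)"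
  proof (rule order_trans[OF norm_triangle_ineq], rule add_mono)
    show "norm (2 * (sinh h - h) * cosh h) \<le> 2 * (9/50 * norm h ^ 3) * (47/30)"
      unfolding norm_mult using norm_sinh_lower(2)[OF h(1)] c2 by (intro mult_mono) auto
    show "norm (2 * h * (cosh h - 1)) \<le> 2 * norm h * (17/30 * (norm h)\<^sup>2)"
      unfolding norm_mult using c1 by (intro mult_mono) auto
  qed
  also have "\<dots> = (423/750 + 17/15) * norm h ^ 3" by (simp add: power2_eq_square power3_eq_cube)
  also have "\<dots> \<le> 43/25 * norm h ^ 3" by (intro mult_right_mono) auto
  also have "\<dots> = 43/200 * norm z ^ 3" unfolding h(2) by (simp add: power_divide)
  finally show ?thesis .
qed

text \<open>Near the right angle the arguments leave the sector, so the aperture q = |z| / Re z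
  enters the bound. Taylor's bound is used up to |z| = 5/4 and separate bounds of the two summands
  beyond; 25/16 is the square of this radius.\<close>

lemma norm_csch_reg_le:
  assumes x: "Re z > 0" and q: "norm z \<le> q * Re z"
  shows "norm (csch_reg z) \<le> (q + 1) * (norm z / (25/16 + (norm z)\<^sup>2))"
proof -
  have nz: "norm z > 0" "z \<noteq> 0" using x by auto
  have q1: "q \<ge> 1"
  proof -
    have "1 * Re z \<le> q * Re z" using q complex_Re_le_cmod[of z] by simp
    thus ?thesis using x by simp
  qed
  have snz: "sinh z \<noteq> 0" using x by (rule sinh_nonzero)
  show ?thesis
  proof (cases "norm z \<le> 5/4")
    case True
    have s: "norm (sinh z - z) \<le> 43/200 * norm z ^ 3" using True by (intro norm_sinh_minus_le) auto
    have n2: "(norm z)\<^sup>2 \<le> 25/16"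
    proof -
      have "(norm z)\<^sup>2 \<le> (5/4)\<^sup>2" using True by (intro power_mono) auto
      thus ?thesis by (simp add: power2_eq_square)
    qed
    have "norm z ^ 3 = (norm z)\<^sup>2 * norm z" by (simp add: power2_eq_square power3_eq_cube)
    also have "\<dots> \<le> 25/16 * norm z" using n2 by (intro mult_right_mono) auto
    finally have "norm (sinh z - z) \<le> 2/5 * norm z" using s norm_ge_zero[of z] by linarith
    hence sl: "norm (sinh z) \<ge> 3/5 * norm z"
      using norm_triangle_ineq4[of "sinh z" "sinh z - z"] by simp
    have "csch_reg z = (z - sinh z) / (2 * z * sinh z)"
      using snz nz by (simp add: csch_reg_def field_simps)
    hence "norm (csch_reg z) = norm (sinh z - z) / (2 * norm z * norm (sinh z))"
      by (simp add: norm_divide norm_mult norm_minus_commute)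
    also have "\<dots> \<le> (43/200 * norm z ^ 3) / (2 * norm z * (3/5 * norm z))"
      using s sl nz by (intro frac_le mult_left_mono mult_pos_pos) auto
    also have "\<dots> = 43/240 * norm z" using nz by (simp add: power3_eq_cube)
    also have "\<dots> \<le> 2 * (8/25) * norm z" by (intro mult_right_mono) auto
    also have "\<dots> \<le> (q + 1) * (1 / (25/16 + (norm z)\<^sup>2)) * norm z"
    proof (intro mult_right_mono mult_mono)
      have "0 < 25/16 + (norm z)\<^sup>2" by (simp add: add_pos_nonneg)
      thus "8/25 \<le> 1 / (25/16 + (norm z)\<^sup>2)" using n2 by (simp add: divide_simps)
    qed (use q1 in auto)
    finally show ?thesis by simp
  next
    case False
    have n2: "25/16 \<le> (norm z)\<^sup>2"
    proof -
      have "(5/4)\<^sup>2 \<le> (norm z)\<^sup>2" using False by (intro power_mono) auto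
      thus ?thesis by (simp add: power2_eq_square)
    qed
    have "norm (csch_reg z) \<le> 1 / (2 * norm (sinh z)) + 1 / (2 * norm z)"
      unfolding csch_reg_def by (rule order_trans[OF norm_triangle_ineq4]) (simp add: norm_divide norm_mult)
    also have "\<dots> \<le> 1 / (2 * (norm z / q)) + 1 / (2 * norm z)"
    proof -
      have "norm z / q \<le> Re z" using q q1 by (simp add: divide_le_eq mult.commute)
      also have "\<dots> \<le> norm (sinh z)" using le_sinh[of "Re z"] sinh_le_norm_sinh[of z] x by linarith
      finally show ?thesis using nz q1 by (intro add_mono frac_le) auto
    qed
    also have "\<dots> = (q + 1) * (norm z / ((norm z)\<^sup>2 + (norm z)\<^sup>2))"
      using nz q1 by (simp add: field_simps power2_eq_square)
    also have "\<dots> \<le> (q + 1) * (norm z / (25/16 + (norm z)\<^sup>2))"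
      using n2 nz q1 by (intro mult_left_mono divide_left_mono mult_pos_pos) (auto simp: add_pos_nonneg)
    finally show ?thesis .
  qed
qed

lemma csch_reg_sum_bounds:
  assumes w: "Re w > 0" "norm w \<le> q * Re w"
  shows "(\<Sum>j. norm (csch_reg (of_nat (2 * Suc j) * w) / of_nat (2 * Suc j))) \<le> (q + 1) * (pi / 5)"
    "summable (\<lambda>j. norm (csch_reg (of_nat (2 * Suc j) * w) / of_nat (2 * Suc j)))"
    "(\<Sum>j. norm (csch_reg (of_nat (2 * j + 1) * w) / of_nat (2 * j + 1))) \<le> (q + 1) * (pi / 5 + 16/25 * norm w)"
    "summable (\<lambda>j. norm (csch_reg (of_nat (2 * j + 1) * w) / of_nat (2 * j + 1)))"
proof -
  define r where "r = norm w"
  have r: "r > 0" using w by (auto simp: r_def)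
  have q1: "q \<ge> 1"
  proof -
    have "1 * Re w \<le> q * Re w" using order_trans[OF complex_Re_le_cmod w(2)] by simp
    thus ?thesis using w by simp
  qed
  \<comment> \<open>With this mesh, 1 + (k h)^2 is 16/25 times 25/16 + (2 k r)^2, the denominator
    belonging to the even multiple 2 k.\<close>
  define h where "h = 8/5 * r"
  have h: "h > 0" using r by (simp add: h_def)
  have gen: "norm (csch_reg (of_nat m * w) / of_nat m) \<le> (q + 1) * (r / (25/16 + (real m * r)\<^sup>2))" if m: "m > 0" for m :: nat
  proof -
    have "norm (csch_reg (of_nat m * w)) \<le> (q + 1) * (norm (of_nat m * w) / (25/16 + (norm (of_nat m * w))\<^sup>2))"
      using w m by (intro norm_csch_reg_le) (auto simp: norm_mult)
    hence "norm (csch_reg (of_nat m * w)) \<le> (q + 1) * (real m * r / (25/16 + (real m * r)\<^sup>2))"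
      by (simp add: norm_mult r_def)
    hence "norm (csch_reg (of_nat m * w)) / real m \<le> (q + 1) * (real m * r / (25/16 + (real m * r)\<^sup>2)) / real m"
      by (rule divide_right_mono) simp
    thus ?thesis using m by (simp add: norm_divide)
  qed
  have conv: "(q + 1) * (r / (25/16 + (real m * r)\<^sup>2)) \<le> (q + 1) * (2/5) * (h / (1 + (real (Suc j) * h)\<^sup>2))" if m: "m \<ge> 2 * Suc j" for m j :: nat
  proof -
    have "real (2 * Suc j) * r \<le> real m * r" using m r by (intro mult_right_mono) auto
    hence "(real (2 * Suc j) * r)\<^sup>2 \<le> (real m * r)\<^sup>2" using r by (intro power_mono) auto
    hence "r / (25/16 + (real m * r)\<^sup>2) \<le> r / (25/16 + (real (2 * Suc j) * r)\<^sup>2)"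
      using r by (intro divide_left_mono mult_pos_pos) (auto simp: add_pos_nonneg)
    also have "\<dots> = 2/5 * (h / (1 + (real (Suc j) * h)\<^sup>2))"
    proof -
      have "1 + (real (Suc j) * h)\<^sup>2 = 16/25 * (25/16 + (real (2 * Suc j) * r)\<^sup>2)"
        by (simp add: h_def power_mult_distrib algebra_simps power2_eq_square)
      moreover have "r / D = 2/5 * (h / (16/25 * D))" for D by (simp add: h_def)
      ultimately show ?thesis by (simp only:)
    qed
    finally have "(q + 1) * (r / (25/16 + (real m * r)\<^sup>2)) \<le> (q + 1) * (2/5 * (h / (1 + (real (Suc j) * h)\<^sup>2)))"
      using q1 by (intro mult_left_mono) auto
    thus ?thesis by (simp only: mult.assoc)
  qed
  have K: "(q + 1) * (2/5) \<ge> 0" using q1 by simp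
  have ev: "norm (csch_reg (of_nat (2 * Suc j) * w) / of_nat (2 * Suc j)) \<le> (q + 1) * (2/5) * (h / (1 + (real (Suc j) * h)\<^sup>2))" for j
    by (rule order_trans[OF gen conv]) auto
  have od: "norm (csch_reg (of_nat (2 * Suc j + 1) * w) / of_nat (2 * Suc j + 1)) \<le> (q + 1) * (2/5) * (h / (1 + (real (Suc j) * h)\<^sup>2))" for j
    by (rule order_trans[OF gen conv]) auto
  show "summable (\<lambda>j. norm (csch_reg (of_nat (2 * Suc j) * w) / of_nat (2 * Suc j)))"
    by (rule norm_suminf_le_arctan(3)[OF h K ev])
  have "(\<Sum>j. norm (csch_reg (of_nat (2 * Suc j) * w) / of_nat (2 * Suc j))) \<le> (q + 1) * (2/5) * (pi / 2)"
    by (rule norm_suminf_le_arctan(4)[OF h K ev])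
  also have qp: "(q + 1) * (2/5) * (pi / 2) = (q + 1) * (pi / 5)" by simp
  finally show "(\<Sum>j. norm (csch_reg (of_nat (2 * Suc j) * w) / of_nat (2 * Suc j))) \<le> (q + 1) * (pi / 5)" .
  \<comment> \<open>Each odd multiple is compared with the even one below it, which leaves the
    multiple 1 to be bounded by itself; it contributes the term with |w|.\<close>
  define f where "f = (\<lambda>j. norm (csch_reg (of_nat (2 * j + 1) * w) / of_nat (2 * j + 1)))"
  have fs: "summable (\<lambda>j. f (Suc j))" "(\<Sum>j. f (Suc j)) \<le> (q + 1) * (2/5) * (pi / 2)"
    unfolding f_def by (rule norm_suminf_le_arctan(3,4)[OF h K od])+
  have f: "summable f" using fs(1) by (subst (asm) summable_Suc_iff)
  have "f 0 \<le> (q + 1) * (r / (25/16 + (real 1 * r)\<^sup>2))" using gen[of 1] by (simp add: f_def)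
  also have "\<dots> \<le> (q + 1) * (r / (25/16))" using q1 r by (intro mult_left_mono divide_left_mono) (auto simp: add_pos_nonneg)
  finally have "f 0 \<le> (q + 1) * (16/25 * r)" by simp
  hence "suminf f \<le> (q + 1) * (pi / 5 + 16/25 * r)"
    using fs(2) suminf_split_head[OF f] unfolding qp distrib_left by linarith
  thus "(\<Sum>j. norm (csch_reg (of_nat (2 * j + 1) * w) / of_nat (2 * j + 1))) \<le> (q + 1) * (pi / 5 + 16/25 * norm w)"
    by (simp add: f_def r_def)
  show "summable (\<lambda>j. norm (csch_reg (of_nat (2 * j + 1) * w) / of_nat (2 * j + 1)))" using f by (simp add: f_def)
qed

text \<open>The sum is Catalan's constant. By Leibniz it lies below its first three terms, 1 - 1/9 +
  1/25 = 209/225.\<close>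

lemma Catalan_bounds:
  "summable (\<lambda>j. (-1) ^ j / (2 * real j + 1)\<^sup>2)"
  "0 \<le> (\<Sum>j. (-1) ^ j / (2 * real j + 1)\<^sup>2)"
  "(\<Sum>j. (-1) ^ j / (2 * real j + 1)\<^sup>2) \<le> 209/225"
proof -
  define a where "a = (\<lambda>j. 1 / (2 * real j + 1)\<^sup>2)"
  have a: "a \<longlonglongrightarrow> 0" unfolding a_def by real_asymp
  have nn: "0 \<le> a n" for n by (simp add: a_def)
  have dec: "a (Suc n) \<le> a n" for n
    unfolding a_def by (intro divide_left_mono power_mono mult_pos_pos) auto
  have e: "(-1) ^ j / (2 * real j + 1)\<^sup>2 = (-1) ^ j * a j" for j by (simp add: a_def)
  show "summable (\<lambda>j. (-1) ^ j / (2 * real j + 1)\<^sup>2)"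
    unfolding e by (rule summable_Leibniz'(1)[OF a nn dec])
  show "0 \<le> (\<Sum>j. (-1) ^ j / (2 * real j + 1)\<^sup>2)"
    unfolding e using summable_Leibniz'(2)[OF a nn dec, of 0] by simp
  have "(\<Sum>j. (-1) ^ j * a j) \<le> (\<Sum>i<2*1+1. (-1) ^ i * a i)"
    by (rule summable_Leibniz'(4)[OF a nn dec])
  also have "\<dots> = 209/225" by (simp add: a_def eval_nat_numeral)
  finally show "(\<Sum>j. (-1) ^ j / (2 * real j + 1)\<^sup>2) \<le> 209/225" unfolding e .
qed

lemma hyperbolic_quarter_shift:
  "cosh (of_nat (2 * j + 1) * (w + \<i> * (pi / 2))) = \<i> * (-1) ^ j * sinh (of_nat (2 * j + 1) * w)"
  "sinh (of_nat (2 * j) * (w + \<i> * (pi / 2))) = (-1) ^ j * sinh (of_nat (2 * j) * w)"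
proof -
  have E: "exp (of_nat m * (w + \<i> * (pi / 2))) = exp (of_nat m * w) * \<i> ^ m" for m :: nat
  proof -
    have "exp (\<i> * (pi / 2)) = \<i>" by (simp add: exp_eq_polar complex_eq_iff)
    thus ?thesis by (simp only: distrib_left exp_add exp_of_nat_mult)
  qed
  have E': "exp (- (of_nat m * (w + \<i> * (pi / 2)))) = exp (- (of_nat m * w)) * (- \<i>) ^ m" for m :: nat
  proof -
    have "inverse (\<i> ^ m) = (- \<i>) ^ m" by (simp flip: power_inverse)
    thus ?thesis unfolding exp_minus E by (simp add: exp_minus)
  qed
  have p: "\<i> ^ (2 * j) = (-1) ^ j" "(- \<i>) ^ (2 * j) = (-1) ^ j" by (simp_all add: power_mult)
  show "cosh (of_nat (2 * j + 1) * (w + \<i> * (pi / 2))) = \<i> * (-1) ^ j * sinh (of_nat (2 * j + 1) * w)"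
    unfolding cosh_field_def sinh_field_def E E' power_add p by (simp add: field_simps)
  show "sinh (of_nat (2 * j) * (w + \<i> * (pi / 2))) = (-1) ^ j * sinh (of_nat (2 * j) * w)"
    unfolding sinh_field_def E E' p by (simp add: field_simps)
qed

text \<open>At \<tau> = w + i \<pi>/2 the poles of the even series sum to -\<pi>^2/(96 w) and those
  of the odd series to -i G/(2 w), with Catalan's constant G. Owing to the factor i the odd
  contribution is proportional to \<psi> rather than to t, so the maximum is not on the ray \<psi> =
  0. The last summand collects the regular parts of both series.\<close>

lemma Re_near_right_angle:
  assumes t: "0 < t" and \<psi>: "0 \<le> \<psi>" and w: "w = Complex t (- \<psi>)" and q: "norm w = q * t"
  shows "Re (Lev (w + \<i> * (pi / 2))) + \<bar>Re (Lod (w + \<i> * (pi / 2)))\<bar> \<le>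
     (209/450 * \<psi> - pi\<^sup>2 / 96 * t) / (norm w)\<^sup>2 + (q + 1) * (2 * pi / 5 + 16/25 * norm w)"
proof -
  define z where "z = w + \<i> * (pi / 2)"
  have Rw: "Re w > 0" "w \<noteq> 0" using t by (auto simp: w complex_eq_iff)
  have Rz: "Re z > 0" using t by (simp add: z_def w)
  have q': "norm w \<le> q * Re w" using q by (simp add: w)
  define G where "G = (\<Sum>j. (-1) ^ j / (2 * real j + 1)\<^sup>2)"
  define e where "e = (\<lambda>j. csch_reg (of_nat (2 * Suc j) * w) / of_nat (2 * Suc j))"
  define o1 where "o1 = (\<lambda>j. csch_reg (of_nat (2 * j + 1) * w) / of_nat (2 * j + 1))"
  note cb = csch_reg_sum_bounds[OF Rw(1) q']
  have lev: "lev_term j z = - of_real ((-1) ^ j / (real j + 1)\<^sup>2) / (8 * w) + (-1) ^ Suc j * e j" for j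
  proof -
    define m :: complex where "m = of_nat (2 * Suc j)"
    have m0: "m \<noteq> 0" unfolding m_def of_nat_eq_0_iff by simp
    have "sinh (m * z) = (-1) ^ Suc j * sinh (m * w)"
      unfolding m_def z_def by (rule hyperbolic_quarter_shift(2))
    moreover have "lev_term j z = 1 / (2 * m * sinh (m * z))" unfolding lev_term_def m_def by (simp add: algebra_simps)
    ultimately have "lev_term j z = (-1) ^ Suc j * (1 / (2 * sinh (m * w)) / m)"
      by (simp add: minus_one_power_iff)
    also have "1 / (2 * sinh (m * w)) = csch_reg (m * w) + 1 / (2 * (m * w))" by (simp add: csch_reg_def)
    also have "(-1) ^ Suc j * ((csch_reg (m * w) + 1 / (2 * (m * w))) / m) = (-1) ^ Suc j * (1 / (2 * m * m * w)) + (-1) ^ Suc j * (csch_reg (m * w) / m)"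
      by (simp add: add_divide_distrib algebra_simps)
    also have "(-1) ^ Suc j * (1 / (2 * m * m * w)) = - of_real ((-1) ^ j / (real j + 1)\<^sup>2) / (8 * w)"
    proof -
      define c :: complex where "c = of_real (real j + 1)"
      have "m = 2 * c" by (simp add: m_def c_def)
      moreover have "(-1) ^ Suc j * (1 / (2 * (2 * c) * (2 * c) * w)) = - ((-1) ^ j / (c * c)) / (8 * w)" by (simp add: mult_ac)
      moreover have "of_real ((-1) ^ j / (real j + 1)\<^sup>2) = (-1) ^ j / (c * c)"
        by (simp add: power2_eq_square c_def)
      ultimately show ?thesis by (simp only:)
    qed
    finally show ?thesis unfolding e_def m_def .
  qed
  have lod: "lod_term j z = - \<i> * of_real ((-1) ^ j / (2 * real j + 1)\<^sup>2) / (2 * w) + - \<i> * (-1) ^ j * o1 j" for j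
  proof -
    define m :: complex where "m = of_nat (2 * j + 1)"
    have m0: "m \<noteq> 0" unfolding m_def of_nat_eq_0_iff by simp
    have "cosh (m * z) = \<i> * (-1) ^ j * sinh (m * w)"
      unfolding m_def z_def by (rule hyperbolic_quarter_shift(1))
    moreover have "lod_term j z = 1 / (2 * m * cosh (m * z))" unfolding lod_term_def m_def ..
    moreover have "1 / (2 * m * (\<i> * P * S)) = inverse \<i> * inverse P * (1 / (2 * S) / m)" for P S
      by (simp only: divide_inverse inverse_mult_distrib mult_1_left mult_ac)
    ultimately have "lod_term j z = - \<i> * (-1) ^ j * (1 / (2 * sinh (m * w)) / m)"
      by (simp only: power_inverse[symmetric]) simp
    also have "1 / (2 * sinh (m * w)) = csch_reg (m * w) + 1 / (2 * (m * w))" by (simp add: csch_reg_def)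
    also have "- \<i> * (-1) ^ j * ((csch_reg (m * w) + 1 / (2 * (m * w))) / m) = - \<i> * (-1) ^ j * (1 / (2 * m * m * w)) + - \<i> * (-1) ^ j * (csch_reg (m * w) / m)"
      by (simp add: add_divide_distrib algebra_simps)
    also have "- \<i> * (-1) ^ j * (1 / (2 * m * m * w)) = - \<i> * of_real ((-1) ^ j / (2 * real j + 1)\<^sup>2) / (2 * w)"
    proof -
      have "m = of_real (2 * real j + 1)" by (simp add: m_def)
      moreover have "of_real ((-1) ^ j / (2 * real j + 1)\<^sup>2) = (-1) ^ j / (of_real (2 * real j + 1) * of_real (2 * real j + 1) :: complex)"
        by (simp add: power2_eq_square)
      ultimately show ?thesis by (simp only:) simp
    qed
    finally show ?thesis unfolding o1_def m_def .
  qed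
  have ne: "norm ((-1) ^ Suc j * e j) = norm (e j)" "norm (- \<i> * (-1) ^ j * o1 j) = norm (o1 j)" for j
    by (simp_all add: norm_mult norm_power)
  have es: "summable (\<lambda>j. (-1) ^ Suc j * e j)"
    by (rule summable_norm_cancel) (use cb(2) in \<open>simp only: ne, simp only: e_def\<close>)
  have os: "summable (\<lambda>j. - \<i> * (-1) ^ j * o1 j)"
    by (rule summable_norm_cancel) (use cb(4) in \<open>simp only: ne, simp only: o1_def\<close>)
  have en: "norm (\<Sum>j. (-1) ^ Suc j * e j) \<le> (q + 1) * (pi / 5)"
  proof -
    have "norm (\<Sum>j. (-1) ^ Suc j * e j) \<le> (\<Sum>j. norm (e j))"
      by (rule norm_suminf_le) (simp only: ne order_refl, use cb(2) in \<open>simp only: e_def\<close>)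
    thus ?thesis using cb(1) by (simp only: e_def)
  qed
  have on: "norm (\<Sum>j. - \<i> * (-1) ^ j * o1 j) \<le> (q + 1) * (pi / 5 + 16/25 * norm w)"
  proof -
    have "norm (\<Sum>j. - \<i> * (-1) ^ j * o1 j) \<le> (\<Sum>j. norm (o1 j))"
      by (rule norm_suminf_le) (simp only: ne order_refl, use cb(4) in \<open>simp only: o1_def\<close>)
    thus ?thesis using cb(3) by (simp only: o1_def)
  qed
  have "(\<lambda>j. - of_real ((-1) ^ j / (real j + 1)\<^sup>2) / (8 * w) + (-1) ^ Suc j * e j) sums
      (- of_real (pi\<^sup>2 / 12) / (8 * w) + (\<Sum>j. (-1) ^ Suc j * e j))"
    by (intro sums_add sums_divide sums_minus sums_of_real alternating_squares_sums summable_sums es)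
  hence Lev: "Lev z = - of_real (pi\<^sup>2 / 12) / (8 * w) + (\<Sum>j. (-1) ^ Suc j * e j)"
    unfolding Lev_def lev by (simp add: sums_iff)
  have "(\<lambda>j. - \<i> * of_real ((-1) ^ j / (2 * real j + 1)\<^sup>2) / (2 * w) + - \<i> * (-1) ^ j * o1 j) sums
      (- \<i> * of_real G / (2 * w) + (\<Sum>j. - \<i> * (-1) ^ j * o1 j))"
    unfolding G_def
    by (intro sums_add sums_divide sums_mult sums_of_real summable_sums os Catalan_bounds(1))
  hence Lod: "Lod z = - \<i> * of_real G / (2 * w) + (\<Sum>j. - \<i> * (-1) ^ j * o1 j)"
    unfolding Lod_def lod by (simp add: sums_iff)
  have R1: "Re (- of_real (pi\<^sup>2 / 12) / (8 * w)) = - (pi\<^sup>2 / 96 * t / (norm w)\<^sup>2)"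
  proof -
    have "- of_real (pi\<^sup>2 / 12) / (8 * w) = of_real (- pi\<^sup>2 / 96) / w" by simp
    hence "Re (- of_real (pi\<^sup>2 / 12) / (8 * w)) = - pi\<^sup>2 / 96 * Re w / (norm w)\<^sup>2" by (simp only: Re_of_real_divide)
    thus ?thesis by (simp add: w)
  qed
  have R2: "Re (- \<i> * of_real G / (2 * w)) = G / 2 * \<psi> / (norm w)\<^sup>2"
  proof -
    have "- \<i> * of_real G / (2 * w) = of_real (G / 2) * (- \<i> / w)" by simp
    hence "Re (- \<i> * of_real G / (2 * w)) = G / 2 * Re (- \<i> / w)" by (simp only: Re_complex_of_real_mult)
    also have "Re (- \<i> / w) = \<psi> / (norm w)\<^sup>2" by (simp add: w Re_divide cmod_power2)
    finally show ?thesis by simp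
  qed
  have "Re (Lev z) \<le> - (pi\<^sup>2 / 96 * t / (norm w)\<^sup>2) + (q + 1) * (pi / 5)"
    unfolding Lev plus_complex.sel R1 using en complex_Re_le_cmod order_trans by (intro add_left_mono) blast
  moreover have "\<bar>Re (Lod z)\<bar> \<le> 209/450 * \<psi> / (norm w)\<^sup>2 + (q + 1) * (pi / 5 + 16/25 * norm w)"
  proof -
    have "\<bar>Re (\<Sum>j. - \<i> * (-1) ^ j * o1 j)\<bar> \<le> (q + 1) * (pi / 5 + 16/25 * norm w)"
      using on abs_Re_le_cmod order_trans by blast
    moreover have "0 \<le> G / 2 * \<psi> / (norm w)\<^sup>2"
      using Catalan_bounds(2) \<psi> by (simp add: G_def)
    moreover have "G / 2 * \<psi> / (norm w)\<^sup>2 \<le> 209/450 * \<psi> / (norm w)\<^sup>2"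
    proof (intro divide_right_mono mult_right_mono)
      show "G / 2 \<le> 209/450" using Catalan_bounds(3) by (simp add: G_def[symmetric])
    qed (use \<psi> in auto)
    ultimately show ?thesis unfolding Lod plus_complex.sel R2 by linarith
  qed
  moreover have "(209/450 * \<psi> - pi\<^sup>2 / 96 * t) / (norm w)\<^sup>2 = 209/450 * \<psi> / (norm w)\<^sup>2 - pi\<^sup>2 / 96 * t / (norm w)\<^sup>2"
    by (rule diff_divide_distrib)
  moreover have "(q + 1) * (2 * pi / 5 + 16/25 * norm w) = (q + 1) * (pi / 5) + (q + 1) * (pi / 5 + 16/25 * norm w)"
    by (simp add: algebra_simps)
  ultimately show ?thesis unfolding z_def[symmetric] by linarith
qed

text \<open>The inequality for the preceding bound in scaled form: v = \<psi>/t, q = |w|/t and y =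
  1/t.\<close>

lemma right_angle_polynomial:
  assumes v: "0 \<le> v" "v \<le> 10" and q: "0 \<le> q" "q\<^sup>2 = 1 + v\<^sup>2" and y: "y \<ge> (152::real)"
  shows "y * (209/450 * v - 1028/10000) / q\<^sup>2 + 13/10 * (q + 1) \<le> y / 5 + 7/4"
proof -
  \<comment> \<open>This is q^2/5 minus the numerator of the pole terms, that is q^2 times the gap
    below the exponent 1/5. Since it is nonnegative, only y = 152 has to be considered; 45/100 in
    the next claim is 7/4 - 13/10.\<close>
  define g where "g = 1/5 * v\<^sup>2 - 209/450 * v + 3028/10000"
  have g0: "g \<ge> 0"
  proof -
    have "0 \<le> (v - 209/180)\<^sup>2" by simp
    thus ?thesis by (simp add: g_def power2_eq_square field_simps)
  qed
  have q0: "q\<^sup>2 > 0" using q by (simp add: add_pos_nonneg)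
  have main: "q\<^sup>2 * (13/10 * q - 45/100) \<le> 152 * g"
  proof (cases "v \<ge> 1")
    case True
    \<comment> \<open>The difference sqrt (1 + v^2) - v decreases, and at v = 1 it is sqrt 2 - 1 <
      0.4143.\<close>
    have ql: "q \<le> v + 4143/10000"
    proof (rule power2_le_imp_le)
      show "q\<^sup>2 \<le> (v + 4143/10000)\<^sup>2" unfolding q using True by (simp add: power2_eq_square field_simps)
    qed (use v in simp)
    have "q\<^sup>2 * (13/10 * q - 45/100) \<le> (1 + v\<^sup>2) * (13/10 * v + 886/10000)"
      unfolding q(2) using ql by (intro mult_left_mono) auto
    also have "\<dots> \<le> 152 * g"
    proof -
      \<comment> \<open>The cubic difference nearly has a double root at 13/10. Splitting that
        square off leaves a quadratic with small nonnegative coefficients.\<close>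
      have "0 \<le> (v - 13/10)\<^sup>2 * (269/10 - 13/10 * v)" using v by (intro mult_nonneg_nonneg) auto
      moreover have "152 * g - (1 + v\<^sup>2) * (13/10 * v + 886/10000) = (v - 13/10)\<^sup>2 * (269/10 - 13/10 * v) +
          ((152/5 - 886/10000 - 269/10 - 26/10 * (13/10)) * v\<^sup>2 + (26/10 * (269/10) + 13/10 * (169/100) - 13/10 - 152 * 209/450) * v
            + (152 * 3028/10000 - 886/10000 - 169/100 * (269/10)))"
        by (simp add: g_def power2_eq_square field_simps)
      moreover have "0 \<le> (152/5 - 886/10000 - 269/10 - 26/10 * (13/10)) * v\<^sup>2" by simp
      moreover have "0 \<le> (26/10 * (269/10) + 13/10 * (169/100) - 13/10 - 152 * 209/450) * v" using v by simp
      ultimately have "0 \<le> 152 * g - (1 + v\<^sup>2) * (13/10 * v + 886/10000)" by simp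
      thus ?thesis by simp
    qed
    finally show ?thesis .
  next
    case False
    have ql: "q \<le> 14143/10000"
    proof (rule power2_le_imp_le)
      have "v\<^sup>2 \<le> 1" using False v by (simp add: power_le_one)
      thus "q\<^sup>2 \<le> (14143/10000)\<^sup>2" unfolding q by (simp add: power2_eq_square)
    qed simp
    have "q\<^sup>2 * (13/10 * q - 45/100) \<le> (1 + v\<^sup>2) * (139/100)"
      unfolding q(2) using ql by (intro mult_left_mono) auto
    also have "\<dots> \<le> 152 * g"
    proof -
      have "152 * g - (1 + v\<^sup>2) * (139/100) =
          (152/5 - 139/100) * (v - 122/100)\<^sup>2 + (244/100 * (152/5 - 139/100) - 152 * 209/450) * v
            + (152 * 3028/10000 - 139/100 - (122/100)\<^sup>2 * (152/5 - 139/100))"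
        by (simp add: g_def power2_eq_square field_simps)
      also have "\<dots> \<ge> 0" using v by (intro add_nonneg_nonneg mult_nonneg_nonneg) (auto simp: power2_eq_square)
      finally show ?thesis by simp
    qed
    finally show ?thesis .
  qed
  also have "\<dots> \<le> y * g" using y g0 by (intro mult_right_mono) auto
  finally have "q\<^sup>2 * (13/10 * q - 45/100) \<le> y * g" .
  moreover have "q\<^sup>2 * (y / 5 + 7/4 - 13/10 * (q + 1)) - y * (209/450 * v - 1028/10000) = y * g - q\<^sup>2 * (13/10 * q - 45/100)"
    unfolding g_def q(2) by (simp add: field_simps)
  ultimately have "y * (209/450 * v - 1028/10000) \<le> q\<^sup>2 * (y / 5 + 7/4 - 13/10 * (q + 1))"
    by (metis diff_ge_0_iff_ge)
  hence "y * (209/450 * v - 1028/10000) / q\<^sup>2 \<le> y / 5 + 7/4 - 13/10 * (q + 1)"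
    using q0 by (simp add: divide_le_eq mult.commute)
  thus ?thesis by simp
qed

lemma Lev_Lod_cnj:
  assumes "Re z > 0"
  shows "Lev (cnj z) = cnj (Lev z)" "Lod (cnj z) = cnj (Lod z)"
proof -
  have c: "sinh (cnj u) = cnj (sinh u)" "cosh (cnj u) = cnj (cosh u)" for u
    by (simp_all add: sinh_field_def cosh_field_def exp_cnj)
  have t: "lev_term j (cnj z) = cnj (lev_term j z)" "lod_term j (cnj z) = cnj (lod_term j z)" for j
    unfolding lev_term_def lod_term_def by (simp_all flip: c)
  show "Lev (cnj z) = cnj (Lev z)"
    unfolding Lev_def t by (rule bounded_linear.suminf[OF bounded_linear_cnj Lev_eq_Lcoth(1)[OF assms], symmetric])
  show "Lod (cnj z) = cnj (Lod z)"
    unfolding Lod_def t by (rule bounded_linear.suminf[OF bounded_linear_cnj Lod_deriv(1)[OF assms], symmetric])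
qed

lemma minor_arc_3:
  assumes t: "0 < t" "t \<le> 131/20000" and \<theta>: "pi/2 - 10 * t \<le> \<bar>\<theta>\<bar>" "\<bar>\<theta>\<bar> \<le> pi/2"
  shows "Re (Lev (Complex t \<theta>)) + \<bar>Re (Lod (Complex t \<theta>))\<bar> \<le> 1 / (5 * t) + 7/4"
proof -
  define \<psi> where "\<psi> = pi/2 - \<bar>\<theta>\<bar>"
  define w where "w = Complex t (- \<psi>)"
  define v where "v = \<psi> / t"
  define q where "q = sqrt (1 + v\<^sup>2)"
  have \<psi>: "0 \<le> \<psi>" "\<psi> \<le> 10 * t" using \<theta> by (auto simp: \<psi>_def)
  have v: "0 \<le> v" "v \<le> 10" "\<psi> = v * t" using \<psi> t by (auto simp: v_def divide_le_eq)
  have q: "0 \<le> q" "q\<^sup>2 = 1 + v\<^sup>2" by (auto simp: q_def add_nonneg_nonneg)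
  have nw: "norm w = q * t"
  proof (rule power2_eq_imp_eq)
    have "(q * t)\<^sup>2 = (1 + v\<^sup>2) * t\<^sup>2" by (simp only: power_mult_distrib q(2))
    thus "(norm w)\<^sup>2 = (q * t)\<^sup>2" by (simp add: w_def cmod_power2 v(3) power_mult_distrib algebra_simps)
  qed (use q t in auto)
  have zc: "Complex t \<bar>\<theta>\<bar> = w + \<i> * (pi / 2)" by (simp add: w_def \<psi>_def complex_eq_iff)
  have Re_eq: "Re (Lev (Complex t \<theta>)) = Re (Lev (Complex t \<bar>\<theta>\<bar>))" "Re (Lod (Complex t \<theta>)) = Re (Lod (Complex t \<bar>\<theta>\<bar>))"
  proof -
    have "\<theta> < 0 \<Longrightarrow> Complex t \<bar>\<theta>\<bar> = cnj (Complex t \<theta>)" by (simp add: complex_eq_iff)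
    thus "Re (Lev (Complex t \<theta>)) = Re (Lev (Complex t \<bar>\<theta>\<bar>))" "Re (Lod (Complex t \<theta>)) = Re (Lod (Complex t \<bar>\<theta>\<bar>))"
      using t by (cases "\<theta> < 0"; simp add: Lev_Lod_cnj)+
  qed
  have qb: "q \<le> 101/10"
  proof (rule power2_le_imp_le)
    have "v\<^sup>2 \<le> 10\<^sup>2" using v by (intro power_mono) auto
    thus "q\<^sup>2 \<le> (101/10)\<^sup>2" unfolding q by (simp add: power2_eq_square)
  qed simp
  have "16/25 * norm w \<le> 16/25 * (101/10 * (131/20000))"
    unfolding nw using qb t q by (intro mult_left_mono mult_mono) auto
  \<comment> \<open>Here 2 \<pi>/5 is below 1.2567 and the other summand below 0.0424.\<close>
  hence c: "2 * pi / 5 + 16/25 * norm w \<le> 13/10" using pi_approx by simp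
  have "Re (Lev (Complex t \<theta>)) + \<bar>Re (Lod (Complex t \<theta>))\<bar> \<le>
     (209/450 * \<psi> - pi\<^sup>2 / 96 * t) / (norm w)\<^sup>2 + (q + 1) * (2 * pi / 5 + 16/25 * norm w)"
    unfolding Re_eq zc by (rule Re_near_right_angle[OF t(1) \<psi>(1) w_def nw])
  also have "(209/450 * \<psi> - pi\<^sup>2 / 96 * t) / (norm w)\<^sup>2 \<le> (209/450 * \<psi> - 1028/10000 * t) / (norm w)\<^sup>2"
    using pi_sq_bounds t by (intro divide_right_mono diff_left_mono mult_right_mono) auto
  also have "(209/450 * \<psi> - 1028/10000 * t) / (norm w)\<^sup>2 = (1 / t) * (209/450 * v - 1028/10000) / q\<^sup>2"
  proof -
    have "209/450 * \<psi> - 1028/10000 * t = t * (209/450 * v - 1028/10000)" by (simp add: v(3) algebra_simps)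
    moreover have "(norm w)\<^sup>2 = t * (t * q\<^sup>2)" by (simp add: nw power2_eq_square)
    moreover have "t * P / (t * (t * Q)) = 1 / t * P / Q" for P Q using t by simp
    ultimately show ?thesis by (simp only:)
  qed
  also have "(q + 1) * (2 * pi / 5 + 16/25 * norm w) \<le> (q + 1) * (13/10)"
    using c q by (intro mult_left_mono) auto
  also have "(1 / t) * (209/450 * v - 1028/10000) / q\<^sup>2 + (q + 1) * (13/10) \<le> (1 / t) / 5 + 7/4"
    using right_angle_polynomial[OF v(1,2) q, of "1 / t"] t by (simp add: field_simps)
  finally show ?thesis by simp
qed

lemma minor_arc:
  assumes "0 < t" "t \<le> 131/20000" "t \<le> \<bar>\<theta>\<bar>" "\<bar>\<theta>\<bar> \<le> pi/2"
  shows "Re (Lev (Complex t \<theta>)) + \<bar>Re (Lod (Complex t \<theta>))\<bar> \<le> 1 / (5 * t) + 7/4"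
proof -
  consider "\<bar>\<theta>\<bar> \<le> 5/4 * t" | "5/4 * t \<le> \<bar>\<theta>\<bar>" "\<bar>\<theta>\<bar> \<le> pi/2 - 10 * t" | "pi/2 - 10 * t \<le> \<bar>\<theta>\<bar>" by linarith
  thus ?thesis
    by cases (use assms minor_arc_1 minor_arc_2 minor_arc_3 in blast)+
qed

subsection \<open>Truncated Gaussian integrals\<close>

lemma gaussian_has_integral:
  assumes b: "b > (0::real)"
  shows "((\<lambda>x. exp (- (b * x\<^sup>2))) has_integral sqrt (pi / b)) UNIV"
proof -
  define \<sigma> where "\<sigma> = sqrt (1 / (2 * b))"
  have \<sigma>: "\<sigma> > 0" "\<sigma>\<^sup>2 = 1 / (2 * b)" using b by (simp_all add: \<sigma>_def)
  have "(normal_density 0 \<sigma> has_integral 1) UNIV"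
    using has_integral_integral_lborel[OF integrable_normal_density[OF \<sigma>(1), of 0]]
    by (simp only: integral_normal_density[OF \<sigma>(1)])
  hence "((\<lambda>x. sqrt (pi / b) * normal_density 0 \<sigma> x) has_integral sqrt (pi / b) * 1) UNIV"
    by (rule has_integral_mult_right)
  moreover have "sqrt (pi / b) * normal_density 0 \<sigma> x = exp (- (b * x\<^sup>2))" for x
  proof -
    have "2 * pi * \<sigma>\<^sup>2 = pi / b" using \<sigma>(2) by simp
    moreover have "- (x - 0)\<^sup>2 / (2 * \<sigma>\<^sup>2) = - (b * x\<^sup>2)" unfolding \<sigma>(2) by simp
    moreover have "sqrt (pi / b) \<noteq> 0" using b by simp
    ultimately show ?thesis unfolding normal_density_def by (simp only:) simp
  qed
  ultimately show ?thesis by simp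
qed

lemma gaussian_integrable_on: "(\<lambda>x. exp (- (b * x\<^sup>2))) integrable_on {c..d::real}"
  by (intro integrable_continuous_real continuous_intros)

lemma gaussian_integral_le:
  assumes b: "b > 0"
  shows "integral {c..d::real} (\<lambda>x. exp (- (b * x\<^sup>2))) \<le> sqrt (pi / b)"
proof (rule has_integral_subset_le[OF _ integrable_integral[OF gaussian_integrable_on] gaussian_has_integral[OF b]])
qed auto

text \<open>Outside [-t, t] half of the exponent is at least b t^2 and supplies the small factor;
  the other half keeps the tail integrable.\<close>

lemma gaussian_integral_tail:
  assumes b: "b > 0" and t: "t \<ge> (0::real)"
  shows "\<bar>integral {-t..t} (\<lambda>x. exp (- (2 * b * x\<^sup>2))) - sqrt (pi / (2 * b))\<bar> \<le> exp (- (b * t\<^sup>2)) * sqrt (pi / b)"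
proof -
  define I where "I = integral {-t..t} (\<lambda>x. exp (- (2 * b * x\<^sup>2)))"
  have I: "((\<lambda>x. if x \<in> {-t..t} then exp (- (2 * b * x\<^sup>2)) else 0) has_integral I) UNIV"
    unfolding has_integral_restrict_UNIV I_def by (rule integrable_integral[OF gaussian_integrable_on])
  have G: "((\<lambda>x. exp (- (2 * b * x\<^sup>2))) has_integral sqrt (pi / (2 * b))) UNIV"
    using gaussian_has_integral[of "2 * b"] b by simp
  have "sqrt (pi / (2 * b)) - I \<le> exp (- (b * t\<^sup>2)) * sqrt (pi / b)"
  proof (rule has_integral_le[OF has_integral_diff[OF G I] has_integral_mult_right[OF gaussian_has_integral[OF b]]])
    fix x :: real
    show "exp (- (2 * b * x\<^sup>2)) - (if x \<in> {-t..t} then exp (- (2 * b * x\<^sup>2)) else 0) \<le> exp (- (b * t\<^sup>2)) * exp (- (b * x\<^sup>2))"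
    proof (cases "x \<in> {-t..t}")
      case False
      have "t\<^sup>2 \<le> x\<^sup>2" using False t by (auto simp: abs_le_square_iff[symmetric])
      hence "b * t\<^sup>2 \<le> b * x\<^sup>2" using b by (intro mult_left_mono) auto
      thus ?thesis using False
        by (auto simp: exp_add[symmetric])
    qed simp
  qed
  moreover have "I \<le> sqrt (pi / (2 * b))" unfolding I_def using gaussian_integral_le[of "2 * b" "-t" t] b by simp
  ultimately show ?thesis unfolding I_def by linarith
qed

lemma has_integral_even_real:
  fixes f :: "real \<Rightarrow> real"
  assumes "(f has_integral I) {0..t}" "\<And>x. f (- x) = f x" "t \<ge> 0"
  shows "(f has_integral 2 * I) {-t..t}"
proof -
  have "((\<lambda>x. f (- x)) has_integral I) {-t..-0}" using assms(1) by (subst has_integral_reflect_real)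
  hence "(f has_integral I) {-t..0}" by (simp add: assms(2))
  from has_integral_combine[OF _ _ this assms(1)] show ?thesis using assms(3) by simp
qed

text \<open>Both integrands have elementary antiderivatives on [0, t], and the contribution of the
  endpoint t is negative.\<close>

lemma gaussian_abs_moments:
  assumes b: "b > 0" and t: "t \<ge> (0::real)"
  shows "integral {-t..t} (\<lambda>x. \<bar>x\<bar> * exp (- (b * x\<^sup>2))) \<le> 1 / b"
    "integral {-t..t} (\<lambda>x. \<bar>x\<bar> ^ 3 * exp (- (b * x\<^sup>2))) \<le> 1 / b\<^sup>2"
proof -
  define F where "F = (\<lambda>x. - exp (- (b * x\<^sup>2)) / (2 * b))"
  define F3 where "F3 = (\<lambda>x. - (b * x\<^sup>2 + 1) * exp (- (b * x\<^sup>2)) / (2 * b\<^sup>2))"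
  have dF: "(F has_vector_derivative \<bar>x\<bar> * exp (- (b * x\<^sup>2))) (at x within {0..t})" if "x \<in> {0..t}" for x
    unfolding F_def has_real_derivative_iff_has_vector_derivative[symmetric] using b that
    by (auto intro!: derivative_eq_intros)
  have dF3: "(F3 has_vector_derivative \<bar>x\<bar> ^ 3 * exp (- (b * x\<^sup>2))) (at x within {0..t})" if "x \<in> {0..t}" for x
    unfolding F3_def has_real_derivative_iff_has_vector_derivative[symmetric] using b that
    by (auto intro!: derivative_eq_intros simp: field_simps power2_eq_square power3_eq_cube)
  have "((\<lambda>x. \<bar>x\<bar> * exp (- (b * x\<^sup>2))) has_integral 2 * (F t - F 0)) {-t..t}"
    by (intro has_integral_even_real fundamental_theorem_of_calculus dF t) auto
  hence "integral {-t..t} (\<lambda>x. \<bar>x\<bar> * exp (- (b * x\<^sup>2))) = 2 * (F t - F 0)" by (rule integral_unique)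
  also have "\<dots> = 1 / b - exp (- (b * t\<^sup>2)) / b" using b by (simp add: F_def field_simps)
  finally show "integral {-t..t} (\<lambda>x. \<bar>x\<bar> * exp (- (b * x\<^sup>2))) \<le> 1 / b" using b by simp
  have "((\<lambda>x. \<bar>x\<bar> ^ 3 * exp (- (b * x\<^sup>2))) has_integral 2 * (F3 t - F3 0)) {-t..t}"
    by (intro has_integral_even_real fundamental_theorem_of_calculus dF3 t) auto
  hence "integral {-t..t} (\<lambda>x. \<bar>x\<bar> ^ 3 * exp (- (b * x\<^sup>2))) = 2 * (F3 t - F3 0)" by (rule integral_unique)
  also have "\<dots> = 1 / b\<^sup>2 - (b * t\<^sup>2 + 1) * exp (- (b * t\<^sup>2)) / b\<^sup>2" using b by (simp add: F3_def field_simps)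
  finally show "integral {-t..t} (\<lambda>x. \<bar>x\<bar> ^ 3 * exp (- (b * x\<^sup>2))) \<le> 1 / b\<^sup>2" using b by simp
qed

subsection \<open>The major arc\<close>

lemma norm_Ln_le:
  assumes "Re c \<ge> 1"
  shows "norm (Ln c) \<le> norm (c - 1)"
proof -
  have "norm (Ln c - Ln 1) \<le> 1 * norm (c - 1)"
  proof (rule field_differentiable_bound[where S = "{z. Re z \<ge> 1}" and f' = inverse])
    show "convex {z. Re z \<ge> 1}" by (rule convex_halfspace_Re_ge)
    fix z assume z: "z \<in> {z. Re z \<ge> 1}"
    show "(Ln has_field_derivative inverse z) (at z within {z. Re z \<ge> 1})"
      by (rule has_field_derivative_at_within[OF has_field_derivative_Ln]) (use z in \<open>auto simp: complex_nonpos_Reals_iff\<close>)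
    have "1 \<le> norm z" using z complex_Re_le_cmod[of z] by simp
    thus "norm (inverse z) \<le> 1" by (simp add: norm_inverse inverse_le_1_iff)
  qed (use assms in auto)
  thus ?thesis by simp
qed

text \<open>Only the real part of w enters the exponential. On the major arc |w| may be large where
  the Gaussian factor absorbs exp (Re w) but not exp |w|.\<close>

lemma norm_exp_minus_1_le_Re:
  assumes "Re w \<le> M" "0 \<le> M"
  shows "norm (exp w - 1) \<le> norm w * exp M"
proof -
  have "norm (exp w - exp 0) \<le> exp M * norm (w - 0)"
    by (rule field_differentiable_bound[where S = "{z. Re z \<le> M}" and f' = exp])
      (use assms in \<open>auto simp: convex_halfspace_Re_le intro!: derivative_eq_intros\<close>)
  thus ?thesis by (simp add: mult.commute)
qed

text \<open>The constant 333/10 exceeds (11 + 25/2) sqrt 2, the sum of the errors of the two expansions on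
  the arc, where |\<tau>| \<le> t sqrt 2.\<close>

lemma arc_expansion:
  fixes t v x :: real and n :: nat
  assumes t: "0 < t" "t \<le> 131/20000" and v: "\<bar>v\<bar> \<le> 1" and n: "real n * t\<^sup>2 = pi\<^sup>2 / 48" and x: "x = 2 * real n * t"
  defines "c \<equiv> Complex 1 v" and "z \<equiv> Complex t (t * v)"
  obtains \<delta>1 \<delta>2 where
    "norm \<delta>1 + norm \<delta>2 \<le> 333/10 * t"
    "Lev z + of_nat n * z = of_real (x - ln 2 / 4) - of_real (x / 2) * (of_real (v\<^sup>2) / c) + \<delta>1"
    "Lod z = of_real (lod_const - ln t / 4) - Ln c / 4 + \<delta>2"
proof -
  have c0: "c \<noteq> 0" by (auto simp: c_def complex_eq_iff)
  have zc: "z = of_real t * c" by (simp add: z_def c_def complex_eq_iff)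
  have zs: "z \<in> sector" using t v by (auto simp: z_def sector_def abs_mult)
  have nz: "norm z \<le> 14143/10000 * t"
  proof (rule power2_le_imp_le)
    have "v\<^sup>2 \<le> 1" using v by (simp add: abs_square_le_1)
    hence "t\<^sup>2 * v\<^sup>2 \<le> t\<^sup>2 * 1" by (intro mult_left_mono) auto
    hence "(norm z)\<^sup>2 \<le> 2 * t\<^sup>2" by (simp add: z_def cmod_power2 power_mult_distrib)
    also have "\<dots> \<le> (14143/10000)\<^sup>2 * t\<^sup>2" by (intro mult_right_mono) (auto simp: power2_eq_square)
    finally show "(norm z)\<^sup>2 \<le> (14143/10000 * t)\<^sup>2" by (simp only: power_mult_distrib)
  qed (use t in auto)
  define \<delta>1 where "\<delta>1 = Lev z - of_real (pi\<^sup>2 / 48) / z + of_real (ln 2 / 4)"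
  define \<delta>2 where "\<delta>2 = Lod z + Ln z / 4 - of_real lod_const"
  have "norm \<delta>1 \<le> 11 * norm z" unfolding \<delta>1_def by (rule Lev_expansion[OF zs]) (use nz t in linarith)
  moreover have "norm \<delta>2 \<le> 25/2 * norm z" unfolding \<delta>2_def by (rule Lod_expansion[OF zs]) (use nz t in linarith)
  ultimately have 1: "norm \<delta>1 + norm \<delta>2 \<le> 333/10 * t" using nz t by linarith
  have "of_real (pi\<^sup>2 / 48) / z + of_nat n * z = of_real x - of_real (x / 2) * (of_real (v\<^sup>2) / c)"
  proof -
    have "of_real (pi\<^sup>2 / 48) / z = of_real (real n * t) / c"
      unfolding n[symmetric] zc using t by (simp add: power2_eq_square)
    moreover have "of_nat n * z = of_real (real n * t) * c" by (simp add: zc)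
    \<comment> \<open>An exact identity in place of a Taylor expansion at the saddle point: for z =
      t c the exponent is n t (1/c + c), whose value at c = 1 is x.\<close>
    moreover have "1 / c + c = 2 - of_real (v\<^sup>2) / c"
    proof -
      have "1 + c * c = 2 * c - of_real (v\<^sup>2)" by (simp add: c_def complex_eq_iff power2_eq_square)
      hence "(1 + c * c) / c = (2 * c - of_real (v\<^sup>2)) / c" by (simp only:)
      thus ?thesis using c0 by (simp add: add_divide_distrib diff_divide_distrib)
    qed
    ultimately have "of_real (pi\<^sup>2 / 48) / z + of_nat n * z = of_real (real n * t) * (2 - of_real (v\<^sup>2) / c)"
      by (metis distrib_left times_divide_eq_right mult.right_neutral)
    thus ?thesis by (simp add: x algebra_simps)
  qed
  hence 2: "Lev z + of_nat n * z = of_real (x - ln 2 / 4) - of_real (x / 2) * (of_real (v\<^sup>2) / c) + \<delta>1"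
    unfolding \<delta>1_def of_real_diff by (simp add: algebra_simps)
  have "Ln z = of_real (ln t) + Ln c" unfolding zc using Ln_times_of_real[OF t(1) c0] t by (simp add: Ln_of_real)
  hence 3: "Lod z = of_real (lod_const - ln t / 4) - Ln c / 4 + \<delta>2"
    by (simp add: \<delta>2_def add_divide_distrib)
  show ?thesis by (rule that[OF 1 2 3])
qed

text \<open>The exponent is its Gaussian part -x v^2/2 plus a remainder w with Re w <= x v^2/4 +
  \<epsilon>. Half of the Gaussian survives, and |w| is bounded by \<epsilon> and terms |v| and x
  |v|^3, whose moments are of order 1/x. For the summand with -Lod a bound by its size is
  enough.\<close>

lemma major_arc:
  fixes t v x :: real and n :: nat
  assumes t: "0 < t" "t \<le> 131/20000" and v: "\<bar>v\<bar> \<le> 1" and n: "real n * t\<^sup>2 = pi\<^sup>2 / 48" and x: "x = 2 * real n * t"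
  defines "z \<equiv> Complex t (t * v)" and "\<epsilon> \<equiv> 333/10 * t"
  defines "\<kappa> \<equiv> exp (lod_const - ln 2 / 4 - ln t / 4)"
  shows "norm (exp (Lev z + Lod z + of_nat n * z) - of_real (\<kappa> * exp x * exp (- (x * v\<^sup>2 / 2)))) \<le>
      \<kappa> * exp x * exp \<epsilon> * (exp (- (x * v\<^sup>2 / 4)) * (\<bar>v\<bar> / 4 + x / 2 * \<bar>v\<bar> ^ 3 + \<epsilon>))" (is ?A)
    and "norm (exp (Lev z - Lod z + of_nat n * z)) \<le>
      exp (ln t / 4 - lod_const - ln 2 / 8) * exp x * exp \<epsilon> * exp (- (x * v\<^sup>2 / 4))" (is ?B)
proof -
  define c where "c = Complex 1 v"
  obtain \<delta>1 \<delta>2 where \<delta>: "norm \<delta>1 + norm \<delta>2 \<le> \<epsilon>"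
    and Le: "Lev z + of_nat n * z = of_real (x - ln 2 / 4) - of_real (x / 2) * (of_real (v\<^sup>2) / c) + \<delta>1"
    and Lo: "Lod z = of_real (lod_const - ln t / 4) - Ln c / 4 + \<delta>2"
    using arc_expansion[OF t v n x] unfolding c_def z_def \<epsilon>_def by blast
  have x0: "x \<ge> 0" using t x by simp
  have \<epsilon>0: "\<epsilon> \<ge> 0" using t by (simp add: \<epsilon>_def)
  have R\<delta>: "\<bar>Re \<delta>1\<bar> \<le> norm \<delta>1" "\<bar>Re \<delta>2\<bar> \<le> norm \<delta>2" by (rule abs_Re_le_cmod)+
  have c0: "c \<noteq> 0" by (auto simp: c_def complex_eq_iff)
  have nc: "(norm c)\<^sup>2 = 1 + v\<^sup>2" by (simp add: c_def cmod_power2)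
  have nc1: "norm c \<ge> 1" using complex_Re_le_cmod[of c] by (simp add: c_def)
  have v1: "v\<^sup>2 \<le> 1" using v by (simp add: abs_square_le_1)
  have lnc: "0 \<le> Re (Ln c)" "Re (Ln c) \<le> ln 2 / 2"
  proof -
    have "2 * ln (norm c) = ln (1 + v\<^sup>2)" using nc nc1 by (metis ln_realpow of_nat_numeral less_le_trans zero_less_one)
    also have "\<dots> \<le> ln 2" using v1 by (subst ln_le_cancel_iff) (auto simp: add_pos_nonneg)
    finally show "Re (Ln c) \<le> ln 2 / 2" using c0 by simp
    show "0 \<le> Re (Ln c)" using c0 nc1 by simp
  qed
  have vv: "v\<^sup>2 / (1 + v\<^sup>2) \<ge> v\<^sup>2 / 2" using v1 by (intro divide_left_mono) (auto simp: add_pos_nonneg)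
  have Rq: "Re (of_real (v\<^sup>2) / c) = v\<^sup>2 / (1 + v\<^sup>2)"
    unfolding Re_of_real_divide nc by (simp add: c_def)
  \<comment> \<open>The error of replacing v^2/c by v^2: of third order in v, and of real part at
    most v^2/2 because |v| <= 1.\<close>
  define d where "d = of_real (v\<^sup>2) - of_real (v\<^sup>2) / c"
  have Rd: "Re d \<le> v\<^sup>2 / 2" using vv by (simp only: d_def minus_complex.sel Rq Re_complex_of_real)
  have nd: "norm d \<le> \<bar>v\<bar> ^ 3"
  proof -
    have "d = of_real (v\<^sup>2) * (c - 1) / c" using c0 by (simp add: d_def field_simps)
    moreover have "c - 1 = \<i> * of_real v" by (simp add: c_def complex_eq_iff)
    ultimately have "norm d = \<bar>v\<bar> ^ 3 / norm c"
      by (simp add: norm_divide norm_mult norm_power power2_eq_square power3_eq_cube)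
    also have "\<dots> \<le> \<bar>v\<bar> ^ 3 / 1" using nc1 by (intro divide_left_mono) auto
    finally show ?thesis by simp
  qed
  define w where "w = - Ln c / 4 + of_real (x / 2) * d + (\<delta>1 + \<delta>2)"
  have nw: "norm w \<le> \<bar>v\<bar> / 4 + x / 2 * \<bar>v\<bar> ^ 3 + \<epsilon>"
  proof -
    have "norm (Ln c) \<le> norm (c - 1)" by (rule norm_Ln_le) (simp add: c_def)
    moreover have "c - 1 = \<i> * of_real v" by (simp add: c_def complex_eq_iff)
    ultimately have "norm (- Ln c / 4) \<le> \<bar>v\<bar> / 4" by (simp add: norm_mult norm_divide)
    moreover have "norm (of_real (x / 2) * d) \<le> x / 2 * \<bar>v\<bar> ^ 3"
      unfolding norm_mult using nd x0 by (intro mult_mono) auto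
    moreover have "norm (\<delta>1 + \<delta>2) \<le> \<epsilon>" using \<delta> norm_triangle_ineq[of \<delta>1 \<delta>2] by linarith
    ultimately show ?thesis unfolding w_def
      using norm_triangle_ineq[of "- Ln c / 4 + of_real (x / 2) * d" "\<delta>1 + \<delta>2"]
        norm_triangle_ineq[of "- Ln c / 4" "of_real (x / 2) * d"] by linarith
  qed
  have Rw: "Re w \<le> x * v\<^sup>2 / 4 + \<epsilon>"
  proof -
    have "x / 2 * Re d \<le> x / 2 * (v\<^sup>2 / 2)" using Rd x0 by (intro mult_left_mono) auto
    moreover have "Re w = - Re (Ln c) / 4 + x / 2 * Re d + (Re \<delta>1 + Re \<delta>2)" by (simp add: w_def)
    ultimately show ?thesis using lnc R\<delta> \<delta> by simp
  qed
  have "Lev z + Lod z + of_nat n * z = of_real (lod_const - ln 2 / 4 - ln t / 4 + x + - (x * v\<^sup>2 / 2)) + w"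
  proof -
    have "Lev z + Lod z + of_nat n * z = (Lev z + of_nat n * z) + Lod z" by simp
    also have "\<dots> = of_real (lod_const - ln 2 / 4 - ln t / 4 + x + - (x * v\<^sup>2 / 2)) + w"
      unfolding Le Lo w_def d_def by (simp add: algebra_simps)
    finally show ?thesis .
  qed
  hence E: "exp (Lev z + Lod z + of_nat n * z) = of_real (\<kappa> * exp x * exp (- (x * v\<^sup>2 / 2))) * exp w"
    by (simp only: exp_add exp_of_real \<kappa>_def)
  have "norm (exp (Lev z + Lod z + of_nat n * z) - of_real (\<kappa> * exp x * exp (- (x * v\<^sup>2 / 2)))) =
      \<kappa> * exp x * exp (- (x * v\<^sup>2 / 2)) * norm (exp w - 1)"
  proof -
    have "exp (Lev z + Lod z + of_nat n * z) - of_real (\<kappa> * exp x * exp (- (x * v\<^sup>2 / 2))) =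
      of_real (\<kappa> * exp x * exp (- (x * v\<^sup>2 / 2))) * (exp w - 1)" unfolding E by (simp only: right_diff_distrib mult_1_right)
    thus ?thesis by (simp only: norm_mult norm_of_real) (simp add: \<kappa>_def)
  qed
  also have "\<dots> \<le> \<kappa> * exp x * exp (- (x * v\<^sup>2 / 2)) * ((\<bar>v\<bar> / 4 + x / 2 * \<bar>v\<bar> ^ 3 + \<epsilon>) * exp (x * v\<^sup>2 / 4 + \<epsilon>))"
  proof (rule mult_left_mono, rule order_trans[OF norm_exp_minus_1_le_Re[OF Rw]])
    show "norm w * exp (x * v\<^sup>2 / 4 + \<epsilon>) \<le> (\<bar>v\<bar> / 4 + x / 2 * \<bar>v\<bar> ^ 3 + \<epsilon>) * exp (x * v\<^sup>2 / 4 + \<epsilon>)"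
      using nw by (rule mult_right_mono) simp
    show "0 \<le> x * v\<^sup>2 / 4 + \<epsilon>" using x0 \<epsilon>0 by simp
    show "0 \<le> \<kappa> * exp x * exp (- (x * v\<^sup>2 / 2))" by (simp add: \<kappa>_def)
  qed
  also have "\<kappa> * exp x * exp (- (x * v\<^sup>2 / 2)) * ((\<bar>v\<bar> / 4 + x / 2 * \<bar>v\<bar> ^ 3 + \<epsilon>) * exp (x * v\<^sup>2 / 4 + \<epsilon>)) =
      \<kappa> * exp x * exp \<epsilon> * (exp (- (x * v\<^sup>2 / 4)) * (\<bar>v\<bar> / 4 + x / 2 * \<bar>v\<bar> ^ 3 + \<epsilon>))"
  proof -
    have "- (x * v\<^sup>2 / 2) + (x * v\<^sup>2 / 4 + \<epsilon>) = \<epsilon> + - (x * v\<^sup>2 / 4)" by simp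
    hence "exp (- (x * v\<^sup>2 / 2)) * exp (x * v\<^sup>2 / 4 + \<epsilon>) = exp \<epsilon> * exp (- (x * v\<^sup>2 / 4))"
      by (simp only: exp_add[symmetric])
    moreover have "p * q * (y * r) = p * (q * r) * y" for p q r y :: real by simp
    ultimately show ?thesis by (simp only:) simp
  qed
  finally show ?A .
  \<comment> \<open>With the sign of \<open>Lod\<close> reversed, Re (Ln c)/4 is added instead of
    subtracted; it is at most (ln 2)/8, which turns -(ln 2)/4 into -(ln 2)/8.\<close>
  have "Re (Lev z - Lod z + of_nat n * z) = Re (Lev z + of_nat n * z) - Re (Lod z)" by simp
  also have "\<dots> = x - ln 2 / 4 - x / 2 * (v\<^sup>2 / (1 + v\<^sup>2)) + Re \<delta>1 - (lod_const - ln t / 4 - Re (Ln c) / 4 + Re \<delta>2)"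
    unfolding Le Lo by (simp only: plus_complex.sel minus_complex.sel Re_complex_of_real Re_complex_of_real_mult Rq Re_divide_numeral)
  also have "\<dots> \<le> ln t / 4 - lod_const - ln 2 / 8 + x + \<epsilon> + - (x * v\<^sup>2 / 4)"
  proof -
    have "x / 2 * (v\<^sup>2 / 2) \<le> x / 2 * (v\<^sup>2 / (1 + v\<^sup>2))" using vv x0 by (intro mult_left_mono) auto
    moreover have "x / 2 * (v\<^sup>2 / 2) = x * v\<^sup>2 / 4" by simp
    ultimately show ?thesis using lnc R\<delta> \<delta> by linarith
  qed
  finally have "exp (Re (Lev z - Lod z + of_nat n * z)) \<le> exp (ln t / 4 - lod_const - ln 2 / 8 + x + \<epsilon> + - (x * v\<^sup>2 / 4))"
    unfolding exp_le_cancel_iff .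
  from this[unfolded exp_add] show ?B by (simp only: norm_exp_eq_Re)
qed

lemma norm_integral_le_length:
  fixes f :: "real \<Rightarrow> 'a::banach"
  assumes "f integrable_on {c..d}" "\<And>x. x \<in> {c..d} \<Longrightarrow> norm (f x) \<le> B" "0 \<le> B" "c \<le> d"
  shows "norm (integral {c..d} f) \<le> B * (d - c)"
  using has_integral_bound_real[OF assms(3) finite.emptyI integrable_integral[OF assms(1)]] assms by simp

section \<open>The coefficient as an integral over the major arc and the two outer arcs\<close>

context
  fixes a :: "nat \<Rightarrow> int" and n :: nat and t x :: real
  assumes a: "is_coeff_seq a" and t: "0 < t" "t \<le> 131/20000"
    and n: "real n * t\<^sup>2 = pi\<^sup>2 / 48" and x: "x = 2 * real n * t"
begin

definition arc_integrand :: "real \<Rightarrow> complex" where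
  "arc_integrand \<theta> = exp (Lev (Complex t (-\<theta>)) + Lod (Complex t (-\<theta>)) + of_nat n * Complex t (-\<theta>))
            + (-1) ^ n * exp (Lev (Complex t (-\<theta>)) - Lod (Complex t (-\<theta>)) + of_nat n * Complex t (-\<theta>))"

lemma arc_integrand_integral: "(arc_integrand has_integral of_real (2 * pi * of_int (a n))) {-(pi/2)..pi/2}"
  unfolding arc_integrand_def by (rule coeff_integral[OF a t(1)])

lemma t_less_half_pi: "t < pi / 2"
  using t pi_gt3 by simp

lemma arc_integrand_integrable:
  assumes "-(pi/2) \<le> c" "d \<le> pi/2"
  shows "arc_integrand integrable_on {c..d}"
  by (rule integrable_on_subinterval[OF has_integral_integrable[OF arc_integrand_integral]]) (use assms in auto)

lemma norm_arc_integrand_minor: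
  assumes "t \<le> \<bar>\<theta>\<bar>" "\<bar>\<theta>\<bar> \<le> pi/2"
  shows "norm (arc_integrand \<theta>) \<le> 2 * exp (1 / (5 * t) + 7/4 + real n * t)"
proof -
  define z where "z = Complex t (-\<theta>)"
  have m: "Re (Lev z) + \<bar>Re (Lod z)\<bar> \<le> 1 / (5 * t) + 7/4" unfolding z_def
    by (rule minor_arc) (use t assms in auto)
  have R: "Re (of_nat n * z) = real n * t" by (simp add: z_def)
  have "Re (Lev z + Lod z + of_nat n * z) \<le> 1 / (5 * t) + 7/4 + real n * t"
    using m by (simp only: plus_complex.sel R)
  moreover have "Re (Lev z - Lod z + of_nat n * z) \<le> 1 / (5 * t) + 7/4 + real n * t"
    using m by (simp only: plus_complex.sel minus_complex.sel R)
  ultimately have "norm (exp (Lev z + Lod z + of_nat n * z)) \<le> exp (1 / (5 * t) + 7/4 + real n * t)"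
    "norm ((-1) ^ n * exp (Lev z - Lod z + of_nat n * z)) \<le> exp (1 / (5 * t) + 7/4 + real n * t)"
    by (simp_all only: norm_mult norm_power norm_minus_cancel norm_one power_one mult_1_left norm_exp_eq_Re exp_le_cancel_iff)
  thus ?thesis unfolding arc_integrand_def z_def[symmetric]
    unfolding mult_2 by (intro order_trans[OF norm_triangle_ineq] add_mono)
qed

text \<open>The scaled variable is v = -\<theta>/t. The summand with -Lod may be counted entirely as
  error, because \<kappa>' is smaller than \<kappa> by a factor of order sqrt t.\<close>

lemma norm_arc_integrand_major:
  fixes \<epsilon> \<kappa> \<kappa>' :: real
  defines "\<epsilon> \<equiv> 333/10 * t" and "\<kappa> \<equiv> exp (lod_const - ln 2 / 4 - ln t / 4)" and "\<kappa>' \<equiv> exp (ln t / 4 - lod_const - ln 2 / 8)"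
    and "b \<equiv> x / (4 * t\<^sup>2)"
  assumes "\<bar>\<theta>\<bar> \<le> t"
  shows "norm (arc_integrand \<theta> - of_real (\<kappa> * exp x * exp (- (2 * b * \<theta>\<^sup>2)))) \<le>
    \<kappa> * exp x * exp \<epsilon> / (4 * t) * (\<bar>\<theta>\<bar> * exp (- (b * \<theta>\<^sup>2))) + \<kappa> * exp x * exp \<epsilon> * (x / (2 * t ^ 3)) * (\<bar>\<theta>\<bar> ^ 3 * exp (- (b * \<theta>\<^sup>2)))
      + (\<kappa> * exp x * exp \<epsilon> * \<epsilon> + \<kappa>' * exp x * exp \<epsilon>) * exp (- (b * \<theta>\<^sup>2))"
proof -
  define v where "v = - \<theta> / t"
  define z where "z = Complex t (-\<theta>)"
  have zv: "Complex t (t * v) = z" using t by (simp add: v_def z_def)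
  have v1: "\<bar>v\<bar> \<le> 1" using assms(5) t by (simp add: v_def abs_divide)
  have bv: "x * v\<^sup>2 / 2 = 2 * b * \<theta>\<^sup>2" "x * v\<^sup>2 / 4 = b * \<theta>\<^sup>2" using t by (simp_all add: b_def v_def power_divide)
  have av: "\<bar>v\<bar> = \<bar>\<theta>\<bar> / t" using t by (simp add: v_def abs_divide)
  note M = major_arc[OF t v1 n x, unfolded zv bv, folded \<epsilon>_def \<kappa>_def \<kappa>'_def]
  have M2: "norm ((-1) ^ n * exp (Lev z - Lod z + of_nat n * z)) \<le> \<kappa>' * exp x * exp \<epsilon> * exp (- (b * \<theta>\<^sup>2))"
    using M(2) by (simp only: norm_mult norm_power norm_minus_cancel norm_one power_one mult_1_left)
  have "arc_integrand \<theta> - of_real (\<kappa> * exp x * exp (- (2 * b * \<theta>\<^sup>2))) =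
      (exp (Lev z + Lod z + of_nat n * z) - of_real (\<kappa> * exp x * exp (- (2 * b * \<theta>\<^sup>2)))) + (-1) ^ n * exp (Lev z - Lod z + of_nat n * z)"
    unfolding arc_integrand_def z_def[symmetric] by simp
  hence "norm (arc_integrand \<theta> - of_real (\<kappa> * exp x * exp (- (2 * b * \<theta>\<^sup>2)))) \<le>
      \<kappa> * exp x * exp \<epsilon> * (exp (- (b * \<theta>\<^sup>2)) * (\<bar>v\<bar> / 4 + x / 2 * \<bar>v\<bar> ^ 3 + \<epsilon>)) + \<kappa>' * exp x * exp \<epsilon> * exp (- (b * \<theta>\<^sup>2))"
    using order_trans[OF norm_triangle_ineq add_mono[OF M(1) M2]] by (simp only:)
  also have "\<dots> = \<kappa> * exp x * exp \<epsilon> / (4 * t) * (\<bar>\<theta>\<bar> * exp (- (b * \<theta>\<^sup>2))) + \<kappa> * exp x * exp \<epsilon> * (x / (2 * t ^ 3)) * (\<bar>\<theta>\<bar> ^ 3 * exp (- (b * \<theta>\<^sup>2)))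
      + (\<kappa> * exp x * exp \<epsilon> * \<epsilon> + \<kappa>' * exp x * exp \<epsilon>) * exp (- (b * \<theta>\<^sup>2))"
  proof -
    have "P * (E * (h / t / 4 + x / 2 * (h / t) ^ 3 + \<epsilon>)) + Q * E = P / (4 * t) * (h * E) + P * (x / (2 * t ^ 3)) * (h ^ 3 * E) + (P * \<epsilon> + Q) * E"
      for P Q E h :: real using t by (simp add: field_simps power_divide)
    thus ?thesis unfolding av by (simp only:)
  qed
  finally show ?thesis .
qed

lemma coeff_arc_estimate:
  fixes \<epsilon> \<kappa> \<kappa>' :: real
  defines "\<epsilon> \<equiv> 333/10 * t" and "\<kappa> \<equiv> exp (lod_const - ln 2 / 4 - ln t / 4)" and "\<kappa>' \<equiv> exp (ln t / 4 - lod_const - ln 2 / 8)"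
  shows "\<bar>2 * pi * of_int (a n) - \<kappa> * exp x * (t * sqrt (2 * pi / x))\<bar> \<le>
    2 * pi * exp (1 / (5 * t) + 7/4 + real n * t) + \<kappa> * exp x * (exp (- (x / 4)) * (2 * t * sqrt (pi / x)))
     + \<kappa> * exp x * exp \<epsilon> * (9 * t / x + 2 * \<epsilon> * t * sqrt (pi / x)) + \<kappa>' * exp x * exp \<epsilon> * (2 * t * sqrt (pi / x))"
proof -
  have n0: "real n > 0" using n by (cases n) auto
  have x0: "x > 0" using n0 t x by simp
  define b where "b = x / (4 * t\<^sup>2)"
  have b: "b > 0" using x0 t by (simp add: b_def)
  define B where "B = 2 * exp (1 / (5 * t) + 7/4 + real n * t)"
  have t2: "t < pi / 2" by (rule t_less_half_pi)
  define P where "P = \<kappa> * exp x * exp \<epsilon>"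
  define Q where "Q = \<kappa>' * exp x * exp \<epsilon>"
  have PQ: "P \<ge> 0" "Q \<ge> 0" by (simp_all add: P_def Q_def \<kappa>_def \<kappa>'_def)
  have \<epsilon>0: "\<epsilon> \<ge> 0" using t by (simp add: \<epsilon>_def)
  define S where "S = 2 * t * sqrt (pi / x)"
  have sb: "sqrt (pi / b) = S"
  proof -
    have "pi / b = (2 * t)\<^sup>2 * (pi / x)" using t x0 by (simp add: b_def power_mult_distrib)
    hence "sqrt (pi / b) = sqrt ((2 * t)\<^sup>2) * sqrt (pi / x)" by (simp only: real_sqrt_mult)
    thus ?thesis using t by (simp only: S_def real_sqrt_abs abs_of_pos)
  qed
  have s2b: "sqrt (pi / (2 * b)) = t * sqrt (2 * pi / x)"
  proof -
    have "pi / (2 * b) = t\<^sup>2 * (2 * pi / x)" using t x0 by (simp add: b_def)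
    thus ?thesis using t by (simp only: real_sqrt_mult) simp
  qed
  have bt: "b * t\<^sup>2 = x / 4" using t by (simp add: b_def)
  have outer: "norm (integral {-(pi/2)..-t} arc_integrand) \<le> B * (pi / 2)" "norm (integral {t..pi/2} arc_integrand) \<le> B * (pi / 2)"
  proof -
    have "norm (integral {-(pi/2)..-t} arc_integrand) \<le> B * (- t - - (pi / 2))" using t t2
      by (intro norm_integral_le_length arc_integrand_integrable) (auto simp: B_def intro!: norm_arc_integrand_minor)
    also have "\<dots> \<le> B * (pi / 2)" using t by (intro mult_left_mono) (auto simp: B_def)
    finally show "norm (integral {-(pi/2)..-t} arc_integrand) \<le> B * (pi / 2)" .
    have "norm (integral {t..pi/2} arc_integrand) \<le> B * (pi / 2 - t)" using t t2
      by (intro norm_integral_le_length arc_integrand_integrable) (auto simp: B_def intro!: norm_arc_integrand_minor)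
    also have "\<dots> \<le> B * (pi / 2)" using t by (intro mult_left_mono) (auto simp: B_def)
    finally show "norm (integral {t..pi/2} arc_integrand) \<le> B * (pi / 2)" .
  qed
  define K where "K = integral {-t..t} (\<lambda>\<theta>. exp (- (2 * b * \<theta>\<^sup>2)))"
  have Kt: "\<bar>K - t * sqrt (2 * pi / x)\<bar> \<le> exp (- (x / 4)) * S"
    using gaussian_integral_tail[OF b, of t] t unfolding K_def[symmetric] sb s2b bt by simp
  define m1 m3 m0 where "m1 = integral {-t..t} (\<lambda>\<theta>. \<bar>\<theta>\<bar> * exp (- (b * \<theta>\<^sup>2)))"
    and "m3 = integral {-t..t} (\<lambda>\<theta>. \<bar>\<theta>\<bar> ^ 3 * exp (- (b * \<theta>\<^sup>2)))"
    and "m0 = integral {-t..t} (\<lambda>\<theta>. exp (- (b * \<theta>\<^sup>2)))"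
  have m: "m1 \<le> 1 / b" "m3 \<le> 1 / b\<^sup>2" "m0 \<le> S"
    using gaussian_abs_moments[OF b, of t] gaussian_integral_le[OF b, of "-t" t] t unfolding m1_def m3_def m0_def sb by auto
  define g where "g = (\<lambda>\<theta>. P / (4 * t) * (\<bar>\<theta>\<bar> * exp (- (b * \<theta>\<^sup>2))) + P * (x / (2 * t ^ 3)) * (\<bar>\<theta>\<bar> ^ 3 * exp (- (b * \<theta>\<^sup>2)))
      + (P * \<epsilon> + Q) * exp (- (b * \<theta>\<^sup>2)))"
  have g: "(g has_integral (P / (4 * t) * m1 + P * (x / (2 * t ^ 3)) * m3 + (P * \<epsilon> + Q) * m0)) {-t..t}"
    unfolding g_def m1_def m3_def m0_def
    by (intro has_integral_add has_integral_mult_right integrable_integral integrable_continuous_real continuous_intros)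
  have Kc: "((\<lambda>\<theta>. complex_of_real (\<kappa> * exp x * exp (- (2 * b * \<theta>\<^sup>2)))) has_integral of_real (\<kappa> * exp x * K)) {-t..t}"
    unfolding K_def by (intro has_integral_of_real has_integral_mult_right integrable_integral gaussian_integrable_on)
  have mid: "norm (integral {-t..t} arc_integrand - of_real (\<kappa> * exp x * K)) \<le> P * (9 * t / x + \<epsilon> * S) + Q * S"
  proof -
    have Fi: "arc_integrand integrable_on {-t..t}" using t2 t by (intro arc_integrand_integrable) auto
    note D = has_integral_diff[OF integrable_integral[OF Fi] Kc]
    have "norm (integral {-t..t} (\<lambda>\<theta>. arc_integrand \<theta> - of_real (\<kappa> * exp x * exp (- (2 * b * \<theta>\<^sup>2))))) \<le> integral {-t..t} g"
    proof (rule Henstock_Kurzweil_Integration.integral_norm_bound_integral[OF has_integral_integrable[OF D] has_integral_integrable[OF g]])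
      fix \<theta> assume "\<theta> \<in> {-t..t}"
      hence "\<bar>\<theta>\<bar> \<le> t" by auto
      from norm_arc_integrand_major[OF this]
      show "norm (arc_integrand \<theta> - of_real (\<kappa> * exp x * exp (- (2 * b * \<theta>\<^sup>2)))) \<le> g \<theta>"
        unfolding g_def P_def Q_def \<kappa>_def \<kappa>'_def \<epsilon>_def b_def .
    qed
    also have "integral {-t..t} g = P / (4 * t) * m1 + P * (x / (2 * t ^ 3)) * m3 + (P * \<epsilon> + Q) * m0"
      by (rule integral_unique[OF g])
    also have "\<dots> \<le> P / (4 * t) * (1 / b) + P * (x / (2 * t ^ 3)) * (1 / b\<^sup>2) + (P * \<epsilon> + Q) * S"
      using m PQ \<epsilon>0 t x0 by (intro add_mono mult_left_mono) auto
    \<comment> \<open>Since 1/b = 4 t^2/x, the first moment contributes t/x and the third 8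
      t/x.\<close>
    also have "\<dots> = P * (9 * t / x + \<epsilon> * S) + Q * S"
      using t x0 by (simp add: b_def field_simps power2_eq_square power3_eq_cube)
    finally show ?thesis unfolding integral_unique[OF D] .
  qed
  have "of_real (2 * pi * of_int (a n)) = integral {-(pi/2)..pi/2} arc_integrand"
    using arc_integrand_integral by (simp add: integral_unique)
  also have "\<dots> = integral {-(pi/2)..-t} arc_integrand + integral {-t..pi/2} arc_integrand"
    using t t2 by (intro Henstock_Kurzweil_Integration.integral_combine[symmetric] arc_integrand_integrable) auto
  also have "integral {-t..pi/2} arc_integrand = integral {-t..t} arc_integrand + integral {t..pi/2} arc_integrand"
    using t t2 by (intro Henstock_Kurzweil_Integration.integral_combine[symmetric] arc_integrand_integrable) auto
  finally have split: "complex_of_real (2 * pi * of_int (a n)) =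
      integral {-(pi/2)..-t} arc_integrand + (integral {-t..t} arc_integrand + integral {t..pi/2} arc_integrand)" .
  have "complex_of_real (2 * pi * of_int (a n) - \<kappa> * exp x * K) = integral {-(pi/2)..-t} arc_integrand
      + ((integral {-t..t} arc_integrand - of_real (\<kappa> * exp x * K)) + integral {t..pi/2} arc_integrand)"
    unfolding of_real_diff split by simp
  hence "norm (complex_of_real (2 * pi * of_int (a n) - \<kappa> * exp x * K)) \<le> B * (pi / 2) + ((P * (9 * t / x + \<epsilon> * S) + Q * S) + B * (pi / 2))"
    using outer mid by (simp only:) (intro order_trans[OF norm_triangle_ineq] add_mono)
  hence 1: "\<bar>2 * pi * of_int (a n) - \<kappa> * exp x * K\<bar> \<le> B * pi + P * (9 * t / x + \<epsilon> * S) + Q * S"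
    unfolding norm_of_real by simp
  have "\<bar>\<kappa> * exp x * K - \<kappa> * exp x * (t * sqrt (2 * pi / x))\<bar> = \<kappa> * exp x * \<bar>K - t * sqrt (2 * pi / x)\<bar>"
    unfolding right_diff_distrib[symmetric] abs_mult by (simp add: \<kappa>_def)
  also have "\<dots> \<le> \<kappa> * exp x * (exp (- (x / 4)) * S)" using Kt by (intro mult_left_mono) (auto simp: \<kappa>_def)
  finally have 2: "\<bar>\<kappa> * exp x * K - \<kappa> * exp x * (t * sqrt (2 * pi / x))\<bar> \<le> \<kappa> * exp x * (exp (- (x / 4)) * S)" .
  have "\<bar>2 * pi * of_int (a n) - \<kappa> * exp x * (t * sqrt (2 * pi / x))\<bar> \<le>
     B * pi + \<kappa> * exp x * (exp (- (x / 4)) * S) + P * (9 * t / x + \<epsilon> * S) + Q * S" using 1 2 by linarith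
  moreover have "\<epsilon> * S = 2 * \<epsilon> * t * sqrt (pi / x)" by (simp add: S_def)
  moreover have "B * pi = 2 * pi * exp (1 / (5 * t) + 7/4 + real n * t)" by (simp add: B_def)
  ultimately show ?thesis unfolding P_def Q_def S_def by (simp only:)
qed

end

subsection \<open>The error bound\<close>

text \<open>The fractional powers of t and n become integer powers of u = t^(1/4) and \<nu> =
  n^(1/8), so the final comparison is polynomial. Both \<open>k\<close> and \<open>k'\<close> are
  independent of n, coming from the constants of the two expansions.\<close>

lemma saddle_parameters:
  fixes n :: nat
  assumes n: "n > 4800"
  obtains t u k k' \<nu> x :: real where
    "u > 0" "u\<^sup>2 \<le> 81/1000" "t = u ^ 4" "t \<le> 131/20000" "real n * t\<^sup>2 = pi\<^sup>2 / 48" "x = 2 * real n * t"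
    "x = pi / 2 * sqrt (real n / 3)" "x \<ge> 60" "x * t = pi\<^sup>2 / 24"
    "exp (lod_const - ln 2 / 4 - ln t / 4) = k / u" "7/10 \<le> k" "k \<le> 14143/10000"
    "exp (ln t / 4 - lod_const - ln 2 / 8) = k' * u" "0 \<le> k'" "k' \<le> 11/10"
    "Gamma (1/4) * pi powr (1/4) / (2 powr (9/4) * 3 powr (3/8) * real n powr (3/8)) = k * u ^ 3"
    "0 \<le> Gamma (3/4) * pi powr (3/4) / (2 powr (11/4) * 3 powr (5/8) * real n powr (5/8))"
    "Gamma (3/4) * pi powr (3/4) / (2 powr (11/4) * 3 powr (5/8) * real n powr (5/8)) \<le> u ^ 5"
    "\<nu> > 0" "real n powr (7/8) = \<nu> ^ 7" "real n powr (5/8) = \<nu> ^ 5" "1/2 \<le> \<nu> * u" "\<nu> * u \<le> 83/100"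
    "1 / (5 * t) + real n * t = (pi / 4 + 12 / (5 * pi)) * sqrt (real n / 3)"
proof -
  define N where "N = real n"
  have N: "N > 4800" using n by (simp add: N_def)
  define w where "w = sqrt (N / 3)"
  have w2: "N = 3 * w\<^sup>2" using N by (simp add: w_def)
  \<comment> \<open>4800 = 3 * 40^2, so t stays below \<pi>/480, which is just under
    131/20000.\<close>
  have w: "w > 40" unfolding w_def by (rule real_less_rsqrt) (use N in simp)
  hence w0: "0 < w" by simp
  define t where "t = pi / (12 * w)"
  have t0: "t > 0" using w by (simp add: t_def)
  define u where "u = exp (ln t / 4)"
  have u0: "u > 0" by (simp add: u_def)
  have up: "u ^ m = exp (real m * (ln t / 4))" for m unfolding u_def by (simp only: exp_of_nat_mult)
  have tu: "t = u ^ 4" using t0 by (simp add: up)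
  have t1: "t \<le> 131/20000"
  proof -
    have "t \<le> pi / (12 * 40)" unfolding t_def using w by (intro divide_left_mono) auto
    also have "\<dots> \<le> 131/20000" using pi_approx by simp
    finally show ?thesis .
  qed
  have u2: "u\<^sup>2 \<le> 81/1000"
  proof (rule power2_le_imp_le)
    show "(u\<^sup>2)\<^sup>2 \<le> (81/1000)\<^sup>2" using t1 tu by (simp add: power2_eq_square eval_nat_numeral)
  qed simp
  define x where "x = pi / 2 * w"
  have nt: "N * t\<^sup>2 = pi\<^sup>2 / 48" unfolding w2 t_def using w by (simp add: power_divide power_mult_distrib)
  have xnt: "x = 2 * N * t" unfolding w2 t_def x_def using w by (simp add: power2_eq_square)
  have x60: "x \<ge> 60"
  proof -
    have "3 / 2 * 40 \<le> pi / 2 * w" using w pi_gt3 by (intro mult_mono) auto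
    thus ?thesis by (simp add: x_def)
  qed
  have xt: "x * t = pi\<^sup>2 / 24" unfolding t_def x_def using w by (simp add: power2_eq_square)
  define lg where "lg = ln gamma_ratio"
  have lg: "0 \<le> lg" "lg \<le> 2 * ln 2"
  proof -
    show "0 \<le> lg" unfolding lg_def using gamma_ratio_bounds by simp
    have "lg \<le> ln (2 ^ 2)" unfolding lg_def using gamma_ratio_bounds by (subst ln_le_cancel_iff) auto
    also have "\<dots> = 2 * ln 2" by (subst ln_realpow) auto
    finally show "lg \<le> 2 * ln 2" .
  qed
  define k where "k = exp (lod_const - ln 2 / 4)"
  define k' where "k' = exp (- lod_const - ln 2 / 8)"
  have e2: "(exp (ln 2 / 2))\<^sup>2 = (2::real)" by (simp flip: exp_of_nat_mult)
  have s2: "exp (ln 2 / 2) \<le> (14143/10000 :: real)"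
    by (rule power2_le_imp_le) (simp_all only: e2, simp_all add: power2_eq_square)
  have k1: "k \<le> 14143/10000"
  proof -
    have "k \<le> exp (ln 2 / 2)" unfolding k_def lod_const_def lg_def[symmetric] exp_le_cancel_iff using lg by linarith
    with s2 show ?thesis by linarith
  qed
  have k2: "7/10 \<le> k"
  proof -
    have "exp (- (ln 2 / 2)) \<le> k" unfolding k_def lod_const_def lg_def[symmetric] exp_le_cancel_iff using lg by linarith
    moreover have "7/10 \<le> exp (- (ln 2 / 2) :: real)" unfolding exp_minus using s2 by (simp add: inverse_eq_divide le_divide_eq)
    ultimately show ?thesis by linarith
  qed
  have k'1: "k' \<le> 11/10"
  proof -
    have "k' \<le> exp (ln 2 / 8)" unfolding k'_def lod_const_def lg_def[symmetric] exp_le_cancel_iff using lg by linarith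
    also have "\<dots> \<le> 11/10"
    proof (rule power_le_imp_le_base[where n = 7])
      have "exp (ln 2 / 8) ^ Suc 7 = exp (real (Suc 7) * (ln 2 / 8))" by (simp only: exp_of_nat_mult)
      also have "\<dots> = (2::real)" by simp
      finally show "exp (ln 2 / 8) ^ Suc 7 \<le> (11/10 :: real) ^ Suc 7" by (simp add: eval_nat_numeral)
    qed simp
    finally show ?thesis .
  qed
  have \<kappa>: "exp (lod_const - ln 2 / 4 - ln t / 4) = k / u" unfolding k_def u_def by (rule exp_diff)
  have \<kappa>': "exp (ln t / 4 - lod_const - ln 2 / 8) = k' * u"
    unfolding k'_def u_def exp_add[symmetric] by (simp add: algebra_simps)
  have lnt: "ln t = ln pi - 2 * ln 2 - ln 3 / 2 - ln N / 2"
  proof -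
    have "ln w = (ln N - ln 3) / 2" unfolding w_def using N by (simp add: ln_sqrt ln_div)
    moreover have "ln (12 * w) = ln 2 + (ln 2 + (ln 3 + ln w))"
    proof -
      have "12 * w = 2 * (2 * (3 * w))" by simp
      moreover have "ln (2 * (2 * (3 * w))) = ln 2 + (ln 2 + (ln 3 + ln w))" 
        by (simp only: ln_mult_pos mult_pos_pos zero_less_numeral w0)
      ultimately show ?thesis by (simp only:)
    qed
    moreover have "ln t = ln pi - ln (12 * w)" unfolding t_def using w by (simp add: ln_div)
    ultimately show ?thesis by (simp add: field_simps)
  qed
  have G: "Gamma (1/4 :: real) > 0" "Gamma (3/4 :: real) > 0" by (auto intro: Gamma_real_pos)
  have lgG: "lg = 2 * ln (Gamma (1/4)) - ln pi - ln 2 / 2" "lg = ln (Gamma (1/4)) - ln (Gamma (3/4))"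
  proof -
    have "ln (Gamma (1/4) * Gamma (3/4)) = ln (pi * sqrt 2)" by (simp only: Gamma_quarter_bounds)
    hence "ln (Gamma (1/4)) + ln (Gamma (3/4)) = ln pi + ln (2::real) / 2" using G by (simp add: ln_mult_pos ln_sqrt)
    moreover show "lg = ln (Gamma (1/4)) - ln (Gamma (3/4))" unfolding lg_def gamma_ratio_def using G by (simp add: ln_divide_pos)
    ultimately show "lg = 2 * ln (Gamma (1/4)) - ln pi - ln 2 / 2" by linarith
  qed
  have pw: "b powr c = exp (c * ln b)" if "b > 0" for b c :: real using that by (simp add: powr_def)
  \<comment> \<open>Here the value of \<open>lod_const\<close> is put to use: the coefficient of the
    first Bessel function is exactly t times the factor \<kappa> = k/u of the major arc. The
    reflection formula in \<open>lgG\<close> has eliminated Gamma (3/4).\<close>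
  have M1: "Gamma (1/4) * pi powr (1/4) / (2 powr (9/4) * 3 powr (3/8) * N powr (3/8)) = k * u ^ 3"
  proof -
    have "Gamma (1/4) * pi powr (1/4) / (2 powr (9/4) * 3 powr (3/8) * N powr (3/8))
        = exp (ln (Gamma (1/4)) + 1/4 * ln pi - (9/4 * ln 2 + 3/8 * ln 3 + 3/8 * ln N))"
      using N G by (simp only: exp_diff exp_add) (simp add: pw)
    also have "ln (Gamma (1/4)) + 1/4 * ln pi - (9/4 * ln 2 + 3/8 * ln 3 + 3/8 * ln N) = (lod_const - ln 2 / 4) + real 3 * (ln t / 4)"
      unfolding lod_const_def lg_def[symmetric] lgG(1) lnt by (simp add: field_simps)
    finally show ?thesis unfolding k_def up by (simp only: exp_add)
  qed
  have M2e: "Gamma (3/4) * pi powr (3/4) / (2 powr (11/4) * 3 powr (5/8) * N powr (5/8))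
        = exp (ln (Gamma (3/4)) + 3/4 * ln pi - (11/4 * ln 2 + 5/8 * ln 3 + 5/8 * ln N))"
    using N G by (simp only: exp_diff exp_add) (simp add: pw)
  have M2: "Gamma (3/4) * pi powr (3/4) / (2 powr (11/4) * 3 powr (5/8) * N powr (5/8)) \<le> u ^ 5"
  proof -
    have "ln (Gamma (3/4)) \<le> ln pi / 2 + ln 2 / 4" using lgG lg by linarith
    thus ?thesis unfolding M2e up exp_le_cancel_iff lnt by (simp add: field_simps)
  qed
  define \<nu> where "\<nu> = exp (ln N / 8)"
  have \<nu>p: "\<nu> ^ m = exp (real m * (ln N / 8))" for m unfolding \<nu>_def by (simp only: exp_of_nat_mult)
  \<comment> \<open>As t = u^4, this is n t^2, so the product of \<nu> and u is a constant near
    0.82.\<close>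
  have \<nu>8: "(\<nu> * u) ^ Suc 7 = pi\<^sup>2 / 48"
  proof -
    have "(\<nu> * u) ^ Suc 7 = \<nu> ^ 8 * (u ^ 4)\<^sup>2" by (simp add: power_mult_distrib flip: power_mult)
    also have "\<nu> ^ 8 = N" using N by (simp add: \<nu>p)
    finally show ?thesis using nt tu by simp
  qed
  have \<nu>1: "\<nu> * u \<le> 83/100"
  proof (rule power_le_imp_le_base[where n = 7])
    show "(\<nu> * u) ^ Suc 7 \<le> (83/100) ^ Suc 7" unfolding \<nu>8 using pi_sq_bounds by (simp add: eval_nat_numeral)
  qed simp
  have \<nu>2: "1/2 \<le> \<nu> * u"
  proof (rule power_le_imp_le_base[where n = 7])
    show "(1/2) ^ Suc 7 \<le> (\<nu> * u) ^ Suc 7" unfolding \<nu>8 using pi_sq_bounds by (simp add: eval_nat_numeral)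
  qed (simp add: \<nu>_def u_def)
  have ex: "1 / (5 * t) + N * t = (pi / 4 + 12 / (5 * pi)) * w"
    unfolding w2 t_def using w by (simp add: field_simps power2_eq_square)
  show ?thesis
  proof (rule that[of u t x k k' \<nu>, folded N_def, folded w_def])
    show "N powr (7/8) = \<nu> ^ 7" "N powr (5/8) = \<nu> ^ 5" using N by (simp_all add: pw \<nu>p)
    show "0 \<le> Gamma (3/4) * pi powr (3/4) / (2 powr (11/4) * 3 powr (5/8) * N powr (5/8))" unfolding M2e by simp
    show "0 \<le> k'" by (simp add: k'_def)
    show "\<nu> > 0" by (simp add: \<nu>_def)
    show "x = pi / 2 * w" by (rule x_def)
  qed (fact u0 u2 tu t1 nt xnt x60 xt \<kappa> k1 k2 \<kappa>' k'1 M1 M2 \<nu>1 \<nu>2 ex)+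
qed

text \<open>In terms of u = t^(1/4) every error that carries the full exponential is a multiple of u^7 or
  of u^9, while 4 / n^(7/8) is about 16 u^7. The variables stand for y = 1 / x, R = sqrt (\<pi> / x),
  q = 1 / \<pi>, s = 1 / (\<pi> sqrt 2), f = exp (- x / 4) and e = exp (333/10 t).\<close>

lemma error_budget:
  fixes u :: real
  assumes u: "0 < u" "u\<^sup>2 \<le> 81/1000" and k: "0 \<le> k" "k \<le> 14143/10000" and k': "0 \<le> k'" "k' \<le> 11/10"
    and R: "0 \<le> R" "R \<le> 2765/1000 * u\<^sup>2" and y: "0 \<le> y" "y \<le> 2432/1000 * u ^ 4" and e: "0 \<le> e" "e \<le> 128/100"
    and q: "0 \<le> q" "q \<le> 31832/100000" and f: "0 \<le> f" "f \<le> 8/15 * y" and s: "0 \<le> s" "s \<le> 2252/10000"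
  shows "f * (k * u ^ 3 * R * q) + k * u ^ 3 * e * (9/2 * y * q) + k * u ^ 3 * e * (333/10 * u ^ 4 * R * q)
    + k' * u ^ 5 * e * (R * q) + k * u ^ 3 * (s * R) * (7/4 * y) + u ^ 5 * (s * R) * (1 + 5/4 * y) \<le> 13 * u ^ 7"
proof -
  note nn = u(1)[THEN less_imp_le] k(1) k'(1) R(1) y(1) e(1) q(1) f(1) s(1)
  have f': "f \<le> 8/15 * (2432/1000 * u ^ 4)" using f y by linarith
  have y1: "1 + 5/4 * y \<le> 1021/1000"
  proof -
    have "(u\<^sup>2)\<^sup>2 \<le> (81/1000)\<^sup>2" using u by (intro power_mono) auto
    hence "u ^ 4 \<le> 6561/1000000" by (simp add: power2_eq_square eval_nat_numeral)
    thus ?thesis using y by simp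
  qed
  have "f * (k * u ^ 3 * R * q) \<le> 8/15 * (2432/1000 * u ^ 4) * (14143/10000 * u ^ 3 * (2765/1000 * u\<^sup>2) * (31832/100000))"
    using nn f' k R q by (intro mult_mono) (auto intro!: mult_nonneg_nonneg)
  also have "\<dots> = 8/15 * (2432/1000) * (14143/10000 * (2765/1000) * (31832/100000)) * u ^ 9" by (simp add: eval_nat_numeral)
  also have "\<dots> \<le> 162/100 * u ^ 9" using u by (intro mult_right_mono) auto
  finally have 1: "f * (k * u ^ 3 * R * q) \<le> 162/100 * u ^ 9" .
  have "k * u ^ 3 * e * (9/2 * y * q) \<le> 14143/10000 * u ^ 3 * (128/100) * (9/2 * (2432/1000 * u ^ 4) * (31832/100000))"
    using nn k e y q by (intro mult_mono) (auto intro!: mult_nonneg_nonneg)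
  also have "\<dots> = 14143/10000 * (128/100) * (9/2 * (2432/1000) * (31832/100000)) * u ^ 7" by (simp add: eval_nat_numeral)
  also have "\<dots> \<le> 631/100 * u ^ 7" using u by (intro mult_right_mono) auto
  finally have 2: "k * u ^ 3 * e * (9/2 * y * q) \<le> 631/100 * u ^ 7" .
  have "k * u ^ 3 * e * (333/10 * u ^ 4 * R * q) \<le> 14143/10000 * u ^ 3 * (128/100) * (333/10 * u ^ 4 * (2765/1000 * u\<^sup>2) * (31832/100000))"
    using nn k e R q by (intro mult_mono) (auto intro!: mult_nonneg_nonneg)
  also have "\<dots> = 14143/10000 * (128/100) * (333/10 * (2765/1000) * (31832/100000)) * u ^ 9" by (simp add: eval_nat_numeral)
  also have "\<dots> \<le> 532/10 * u ^ 9" using u by (intro mult_right_mono) auto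
  finally have 3: "k * u ^ 3 * e * (333/10 * u ^ 4 * R * q) \<le> 532/10 * u ^ 9" .
  have "k' * u ^ 5 * e * (R * q) \<le> 11/10 * u ^ 5 * (128/100) * (2765/1000 * u\<^sup>2 * (31832/100000))"
    using nn k' e R q by (intro mult_mono) (auto intro!: mult_nonneg_nonneg)
  also have "\<dots> = 11/10 * (128/100) * (2765/1000 * (31832/100000)) * u ^ 7" by (simp add: eval_nat_numeral)
  also have "\<dots> \<le> 124/100 * u ^ 7" using u by (intro mult_right_mono) auto
  finally have 4: "k' * u ^ 5 * e * (R * q) \<le> 124/100 * u ^ 7" .
  have "k * u ^ 3 * (s * R) * (7/4 * y) \<le> 14143/10000 * u ^ 3 * (2252/10000 * (2765/1000 * u\<^sup>2)) * (7/4 * (2432/1000 * u ^ 4))"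
    using nn k s R y by (intro mult_mono) (auto intro!: mult_nonneg_nonneg)
  also have "\<dots> = 14143/10000 * (2252/10000 * (2765/1000)) * (7/4 * (2432/1000)) * u ^ 9" by (simp add: eval_nat_numeral)
  also have "\<dots> \<le> 376/100 * u ^ 9" using u by (intro mult_right_mono) auto
  finally have 5: "k * u ^ 3 * (s * R) * (7/4 * y) \<le> 376/100 * u ^ 9" .
  have "u ^ 5 * (s * R) * (1 + 5/4 * y) \<le> u ^ 5 * (2252/10000 * (2765/1000 * u\<^sup>2)) * (1021/1000)"
    using nn s R y1 by (intro mult_mono) (auto intro!: mult_nonneg_nonneg add_nonneg_nonneg)
  also have "\<dots> = 2252/10000 * (2765/1000) * (1021/1000) * u ^ 7" by (simp add: eval_nat_numeral)
  also have "\<dots> \<le> 64/100 * u ^ 7" using u by (intro mult_right_mono) auto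
  finally have 6: "u ^ 5 * (s * R) * (1 + 5/4 * y) \<le> 64/100 * u ^ 7" .
  have "u ^ 9 = u\<^sup>2 * u ^ 7" by (simp add: eval_nat_numeral)
  also have "\<dots> \<le> 81/1000 * u ^ 7" using u by (intro mult_right_mono) auto
  finally have "u ^ 9 \<le> 81/1000 * u ^ 7" .
  with 1 2 3 4 5 6 show ?thesis using zero_less_power[OF u(1), of 7] by linarith
qed

text \<open>Makes the additive constant 7/4 of the minor arcs fit the coefficient 21 \<pi>/10 of the
  error function. Fourth powers are compared, exp 7 with 6.3^4.\<close>

lemma exp_7_4_le: "exp (7/4) \<le> 21 * pi / 10"
proof -
  have "exp (7/4) ^ Suc 3 = exp (real (Suc 3) * (7/4 :: real))" by (simp only: exp_of_nat_mult)
  also have "\<dots> = exp (real 7 * 1)" by simp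
  also have "\<dots> = exp 1 ^ 7" by (simp only: exp_of_nat_mult)
  also have "\<dots> \<le> (272/100) ^ 7" using e_less_272 by (intro power_mono) auto
  also have "\<dots> \<le> (63/10) ^ Suc 3" by (simp add: eval_nat_numeral)
  finally have "exp (7/4) \<le> (63/10 :: real)" by (rule power_le_imp_le_base) simp
  thus ?thesis using pi_gt3 by simp
qed

lemma coeff_error:
  assumes a: "is_coeff_seq a" and n: "n > 4800"
  shows "\<bar>of_int (a n) - main_term n\<bar> \<le> error_fun n"
proof -
  from n obtain t u k k' \<nu> x :: real where u: "u > 0" "u\<^sup>2 \<le> 81/1000" and tu: "t = u ^ 4" and t1: "t \<le> 131/20000"
    and nt: "real n * t\<^sup>2 = pi\<^sup>2 / 48" and xnt: "x = 2 * real n * t"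
    and xw: "x = pi / 2 * sqrt (real n / 3)" and x60: "x \<ge> 60" and xt: "x * t = pi\<^sup>2 / 24"
    and \<kappa>: "exp (lod_const - ln 2 / 4 - ln t / 4) = k / u" and k: "7/10 \<le> k" "k \<le> 14143/10000"
    and \<kappa>': "exp (ln t / 4 - lod_const - ln 2 / 8) = k' * u" and k': "0 \<le> k'" "k' \<le> 11/10"
    and M1: "Gamma (1/4) * pi powr (1/4) / (2 powr (9/4) * 3 powr (3/8) * real n powr (3/8)) = k * u ^ 3"
    and M2: "0 \<le> Gamma (3/4) * pi powr (3/4) / (2 powr (11/4) * 3 powr (5/8) * real n powr (5/8))"
      "Gamma (3/4) * pi powr (3/4) / (2 powr (11/4) * 3 powr (5/8) * real n powr (5/8)) \<le> u ^ 5"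
    and \<nu>: "\<nu> > 0" "real n powr (7/8) = \<nu> ^ 7" "real n powr (5/8) = \<nu> ^ 5" "1/2 \<le> \<nu> * u" "\<nu> * u \<le> 83/100"
    and ex: "1 / (5 * t) + real n * t = (pi / 4 + 12 / (5 * pi)) * sqrt (real n / 3)"
    by (rule saddle_parameters)
  have t0: "t > 0" using u tu by simp
  have x0: "x > 0" using x60 by simp
  define m2 where "m2 = Gamma (3/4) * pi powr (3/4) / (2 powr (11/4) * 3 powr (5/8) * real n powr (5/8))"
  define \<epsilon> where "\<epsilon> = 333/10 * t"
  define R where "R = sqrt (pi / x)"
  define y where "y = 1 / x"
  define q where "q = 1 / pi"
  define s where "s = sqrt 2 / (2 * pi)"
  define f where "f = exp (- (x / 4))"
  define B where "B = exp x / sqrt (2 * pi * x)"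
  have y: "0 \<le> y" "y \<le> 2432/1000 * u ^ 4"
  proof -
    have "y = 24 * t / pi\<^sup>2" using xt x0 t0 by (simp add: y_def field_simps)
    also have "\<dots> \<le> 24 * t / (9869/1000)" using pi_sq_bounds t0 by (intro divide_left_mono) auto
    also have "\<dots> \<le> 2432/1000 * t" using t0 by simp
    finally show "y \<le> 2432/1000 * u ^ 4" unfolding tu .
    show "0 \<le> y" using x0 by (simp add: y_def)
  qed
  have R: "0 \<le> R" "R \<le> 2765/1000 * u\<^sup>2"
  proof -
    show "0 \<le> R" using x0 by (simp add: R_def)
    have "R\<^sup>2 = pi / x" using x0 by (simp add: R_def)
    also have "\<dots> = 24 * t / pi" using xt x0 t0 by (simp add: field_simps power2_eq_square)
    also have "\<dots> \<le> 24 * t / (31415/10000)" using pi_approx t0 by (intro divide_left_mono) auto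
    also have "\<dots> \<le> (2765/1000)\<^sup>2 * t" using t0 by (simp add: power2_eq_square)
    also have "\<dots> = (2765/1000 * u\<^sup>2)\<^sup>2" by (simp only: tu power_mult_distrib) (simp flip: power_mult)
    finally show "R \<le> 2765/1000 * u\<^sup>2" by (rule power2_le_imp_le) simp
  qed
  have e: "exp \<epsilon> \<le> 128/100"
  proof -
    have "1 - \<epsilon> \<le> exp (- \<epsilon>)" using exp_ge_add_one_self[of "- \<epsilon>"] by simp
    hence "100/128 \<le> exp (- \<epsilon>)" using t1 by (simp add: \<epsilon>_def)
    thus ?thesis by (simp add: exp_minus inverse_eq_divide le_divide_eq)
  qed
  have q: "0 \<le> q" "q \<le> 31832/100000" using pi_approx by (simp_all add: q_def divide_le_eq)
  have s: "0 \<le> s" "s \<le> 2252/10000"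
  proof -
    have "sqrt 2 \<le> (14143/10000 :: real)" by (rule real_le_lsqrt) (auto simp: power2_eq_square)
    thus "s \<le> 2252/10000" using pi_approx by (simp add: s_def divide_le_eq)
  qed (simp add: s_def)
  have f: "0 \<le> f" "f \<le> 8/15 * y"
  proof -
    have "15/8 * x \<le> (x / 4)\<^sup>2 / 2" using x60 by (simp add: power2_eq_square)
    also have "\<dots> \<le> exp (x / 4)" using exp_lower_Taylor_quadratic[of "x / 4"] x0 by simp
    finally show "f \<le> 8/15 * y" using x0 by (simp add: f_def y_def exp_minus field_simps)
  qed (simp add: f_def)
  have B: "B = exp x * (s * R)"
  proof -
    have "sqrt (2 * pi * x) * (sqrt 2 * R) = sqrt ((2 * pi * x) * (2 * (pi / x)))" by (simp only: R_def real_sqrt_mult)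
    also have "(2 * pi * x) * (2 * (pi / x)) = (2 * pi)\<^sup>2" using x0 by (simp add: power2_eq_square)
    also have "sqrt \<dots> = 2 * pi" by (simp only: real_sqrt_abs) simp
    finally show ?thesis using x0 by (simp add: B_def s_def field_simps)
  qed
  have B0: "B \<ge> 0" using x60 by (simp add: B_def)
  have S2: "sqrt (2 * pi / x) = 2 * pi * (s * R)"
    by (simp add: s_def R_def flip: real_sqrt_mult)
  have b3: "\<bar>besselI (-3/4) x - B\<bar> \<le> B * (7/4 * y)" using besselI_minus_three_quarters[of x] x60 by (simp add: B_def y_def)
  have b5: "\<bar>besselI (-5/4) x\<bar> \<le> B * (1 + 5/4 * y)" using besselI_minus_five_quarters[of x] x60 by (simp add: B_def y_def)
  have mt: "main_term n = k * u ^ 3 * besselI (-3/4) x + (-1) ^ n * m2 * besselI (-5/4) x"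
    unfolding main_term_def M1 m2_def[symmetric] xw[symmetric] ..
  \<comment> \<open>The subtracted term is the value of the Gaussian integral. It equals 2 \<pi>
    times the leading term k u^3 B of the first Bessel summand, so what remains is pure
    error.\<close>
  define Z where "Z = 2 * pi * of_int (a n) - k * u ^ 3 * exp x * (2 * pi * (s * R))"
  have ku: "k / u * exp x * (t * c) = k * u ^ 3 * exp x * c" for c using u by (simp add: tu eval_nat_numeral)
  have arc: "\<bar>Z\<bar> \<le> 2 * pi * exp (1 / (5 * t) + 7/4 + real n * t) + k / u * exp x * (f * (2 * t * R))
     + k / u * exp x * exp \<epsilon> * (9 * t / x + 2 * \<epsilon> * t * R) + k' * u * exp x * exp \<epsilon> * (2 * t * R)"
    using coeff_arc_estimate[OF a t0 t1 nt xnt]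
    unfolding \<kappa> \<kappa>' \<epsilon>_def[symmetric] f_def[symmetric] R_def[symmetric] S2 ku Z_def[symmetric] .
  have "of_int (a n) - main_term n = Z / (2 * pi) + k * u ^ 3 * (B - besselI (-3/4) x) - (-1) ^ n * m2 * besselI (-5/4) x"
  proof -
    have "Z / (2 * pi) = of_int (a n) - k * u ^ 3 * B" unfolding Z_def B by (simp add: diff_divide_distrib)
    thus ?thesis unfolding mt by (simp add: algebra_simps)
  qed
  hence "\<bar>of_int (a n) - main_term n\<bar> \<le> \<bar>Z / (2 * pi)\<bar> + \<bar>k * u ^ 3 * (B - besselI (-3/4) x)\<bar> + \<bar>(-1) ^ n * m2 * besselI (-5/4) x\<bar>"
    by linarith
  moreover have "\<bar>k * u ^ 3 * (B - besselI (-3/4) x)\<bar> \<le> k * u ^ 3 * (B * (7/4 * y))"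
    unfolding abs_mult[of "k * u ^ 3"] using b3 k u by (intro mult_mono) (auto simp: abs_minus_commute)
  moreover have "\<bar>(-1) ^ n * m2 * besselI (-5/4) x\<bar> \<le> u ^ 5 * (B * (1 + 5/4 * y))"
    using b5 M2 B0 y u by (simp only: abs_mult power_abs abs_minus_cancel abs_one power_one mult_1_left m2_def[symmetric])
      (intro mult_mono, auto)
  moreover have "\<bar>Z / (2 * pi)\<bar> \<le> exp (7/4) * exp (1 / (5 * t) + real n * t) + exp x * (f * (k * u ^ 3 * R * q)
     + k * u ^ 3 * exp \<epsilon> * (9/2 * y * q) + k * u ^ 3 * exp \<epsilon> * (333/10 * u ^ 4 * R * q) + k' * u ^ 5 * exp \<epsilon> * (R * q))"
  proof -
    have "\<bar>Z / (2 * pi)\<bar> = \<bar>Z\<bar> / (2 * pi)" by (simp add: abs_divide)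
    also have "\<dots> \<le> (2 * pi * exp (1 / (5 * t) + 7/4 + real n * t) + k / u * exp x * (f * (2 * t * R))
     + k / u * exp x * exp \<epsilon> * (9 * t / x + 2 * \<epsilon> * t * R) + k' * u * exp x * exp \<epsilon> * (2 * t * R)) / (2 * pi)"
      using arc by (intro divide_right_mono) auto
    also have "1 / (5 * t) + 7/4 + real n * t = 7/4 + (1 / (5 * t) + real n * t)" by simp
    also have "(2 * pi * exp (7/4 + (1 / (5 * t) + real n * t)) + k / u * exp x * (f * (2 * t * R))
     + k / u * exp x * exp \<epsilon> * (9 * t / x + 2 * \<epsilon> * t * R) + k' * u * exp x * exp \<epsilon> * (2 * t * R)) / (2 * pi) =
      exp (7/4) * exp (1 / (5 * t) + real n * t) + exp x * (f * (k * u ^ 3 * R * q)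
     + k * u ^ 3 * exp \<epsilon> * (9/2 * y * q) + k * u ^ 3 * exp \<epsilon> * (333/10 * u ^ 4 * R * q) + k' * u ^ 5 * exp \<epsilon> * (R * q))"
    proof -
      have "(2 * pi * E + k / u * X * (f * (2 * u ^ 4 * R)) + k / u * X * h * (9 * u ^ 4 / x + 2 * (333/10 * u ^ 4) * u ^ 4 * R) + k' * u * X * h * (2 * u ^ 4 * R)) / (2 * pi)
        = E + X * (f * (k * u ^ 3 * R * (1 / pi)) + k * u ^ 3 * h * (9/2 * (1 / x) * (1 / pi)) + k * u ^ 3 * h * (333/10 * u ^ 4 * R * (1 / pi)) + k' * u ^ 5 * h * (R * (1 / pi)))"
        for E X h using u x0 by (simp add: field_simps eval_nat_numeral)
      thus ?thesis unfolding exp_add[of "7/4"] \<epsilon>_def tu y_def q_def .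
    qed
    finally show ?thesis .
  qed
  ultimately have "\<bar>of_int (a n) - main_term n\<bar> \<le> exp (7/4) * exp (1 / (5 * t) + real n * t) + exp x * (f * (k * u ^ 3 * R * q)
     + k * u ^ 3 * exp \<epsilon> * (9/2 * y * q) + k * u ^ 3 * exp \<epsilon> * (333/10 * u ^ 4 * R * q) + k' * u ^ 5 * exp \<epsilon> * (R * q)
     + k * u ^ 3 * (s * R) * (7/4 * y) + u ^ 5 * (s * R) * (1 + 5/4 * y))"
    unfolding B by (simp add: algebra_simps)
  also have "\<dots> \<le> 21 * pi / 10 * exp (1 / (5 * t) + real n * t) + exp x * (13 * u ^ 7)"
    by (intro add_mono mult_right_mono mult_left_mono exp_7_4_le error_budget)
      (use u k k' R y e q f s in auto)
  \<comment> \<open>The product \<nu> u is at most 0.83, and 0.83^7 < 4/13.\<close>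
  also have "13 * u ^ 7 \<le> 4 / real n powr (7/8)"
  proof -
    have "(\<nu> * u) ^ 7 \<le> (83/100) ^ 7" using \<nu> u by (intro power_mono) auto
    also have "\<dots> \<le> 4/13" by (simp add: eval_nat_numeral)
    finally have "13 * (u ^ 7 * \<nu> ^ 7) \<le> 4" by (simp add: power_mult_distrib mult.commute)
    thus ?thesis using \<nu> by (simp add: le_divide_eq)
  qed
  also have "21 * pi / 10 * exp (1 / (5 * t) + real n * t) + exp x * (4 / real n powr (7/8)) \<le> error_fun n"
  proof -
    have "4 / real n powr (7/8) \<le> 4 / real n powr (7/8) + 5 / real n + 13 / (20 * real n powr (9/8))
        + 21291081 / real n powr (19/8) + 17716899 / real n powr (21/8)" by simp
    hence "exp x * (4 / real n powr (7/8)) \<le> (4 / real n powr (7/8) + 5 / real n + 13 / (20 * real n powr (9/8))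
        + 21291081 / real n powr (19/8) + 17716899 / real n powr (21/8)) * exp x"
      unfolding mult.commute[of "exp x"] by (intro mult_right_mono) auto
    thus ?thesis unfolding error_fun_def ex xw[symmetric] by simp
  qed
  finally show ?thesis by simp
qed

text \<open>The first summand dominates, since the second is smaller by a factor of order u^2 <=
  0.081 and so cannot cancel it for either parity. The constant 128 is 2 * 2 * 2^5: half of u^3 B is
  kept, B >= u^2 exp x / 2, and \<nu> u >= 1/2 is raised to the fifth power.\<close>

lemma main_term_ge:
  assumes n: "n > 4800"
  shows "exp (pi / 2 * sqrt (real n / 3)) / real n powr (5/8) \<le> 128 * main_term n"
proof -
  from n obtain t u k k' \<nu> x :: real where u: "u > 0" "u\<^sup>2 \<le> 81/1000" and tu: "t = u ^ 4"
    and xw: "x = pi / 2 * sqrt (real n / 3)" and x60: "x \<ge> 60" and xt: "x * t = pi\<^sup>2 / 24"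
    and k: "7/10 \<le> k"
    and M1: "Gamma (1/4) * pi powr (1/4) / (2 powr (9/4) * 3 powr (3/8) * real n powr (3/8)) = k * u ^ 3"
    and M2: "0 \<le> Gamma (3/4) * pi powr (3/4) / (2 powr (11/4) * 3 powr (5/8) * real n powr (5/8))"
      "Gamma (3/4) * pi powr (3/4) / (2 powr (11/4) * 3 powr (5/8) * real n powr (5/8)) \<le> u ^ 5"
    and \<nu>: "\<nu> > 0" "real n powr (5/8) = \<nu> ^ 5" "1/2 \<le> \<nu> * u"
    by (rule saddle_parameters) blast
  define m2 where "m2 = Gamma (3/4) * pi powr (3/4) / (2 powr (11/4) * 3 powr (5/8) * real n powr (5/8))"
  define B where "B = exp x / sqrt (2 * pi * x)"
  have B0: "B \<ge> 0" using x60 by (simp add: B_def)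
  have mt: "main_term n = k * u ^ 3 * besselI (-3/4) x + (-1) ^ n * m2 * besselI (-5/4) x"
    unfolding main_term_def M1 m2_def[symmetric] xw[symmetric] ..
  have "7 / (4 * x) \<le> 1/30" "5 / (4 * x) \<le> 1/40" using x60 by (simp_all add: divide_le_eq)
  hence "B * (7 / (4 * x)) \<le> B * (1/30)" "B * (1 + 5 / (4 * x)) \<le> B * (41/40)" using B0 by (intro mult_left_mono; simp)+
  hence b3: "besselI (-3/4) x \<ge> 29/30 * B" and b5: "\<bar>besselI (-5/4) x\<bar> \<le> 41/40 * B"
    using besselI_minus_three_quarters[of x] besselI_minus_five_quarters[of x] x60 unfolding B_def by auto
  have "7/10 * u ^ 3 * (29/30 * B) \<le> k * u ^ 3 * besselI (-3/4) x" using k u B0 b3 by (intro mult_mono) auto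
  moreover have "\<bar>(-1) ^ n * m2 * besselI (-5/4) x\<bar> \<le> 81/1000 * u ^ 3 * (41/40 * B)"
  proof -
    have "u ^ 5 = u\<^sup>2 * u ^ 3" by (simp add: eval_nat_numeral)
    also have "\<dots> \<le> 81/1000 * u ^ 3" using u by (intro mult_right_mono) auto
    finally have "m2 \<le> 81/1000 * u ^ 3" using M2(2)[folded m2_def] by linarith
    thus ?thesis using b5 M2 u
      by (simp only: abs_mult power_abs abs_minus_cancel abs_one power_one mult_1_left m2_def[symmetric])
        (intro mult_mono, auto)
  qed
  moreover have "7/10 * u ^ 3 * (29/30 * B) - 81/1000 * u ^ 3 * (41/40 * B) = (203/300 - 3321/40000) * (u ^ 3 * B)" by simp
  ultimately have "(203/300 - 3321/40000) * (u ^ 3 * B) \<le> main_term n" unfolding mt by linarith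
  moreover have "1/2 * (u ^ 3 * B) \<le> (203/300 - 3321/40000) * (u ^ 3 * B)" using u B0 by (intro mult_right_mono) auto
  moreover have "u ^ 3 * B \<ge> exp x / (64 * real n powr (5/8))"
  proof -
    have "sqrt (2 * pi * x) \<le> 2 / u\<^sup>2"
    proof (rule real_le_lsqrt)
      have "2 * pi * x * u ^ 4 = pi ^ 3 / 12" using xt by (simp add: tu power2_eq_square power3_eq_cube)
      hence "2 * pi * x = pi ^ 3 / 12 / u ^ 4" using u by (simp add: field_simps)
      also have "pi ^ 3 \<le> 48"
      proof -
        have "pi ^ 3 \<le> (32/10) ^ 3" using pi_approx by (intro power_mono) auto
        thus ?thesis by (simp add: eval_nat_numeral)
      qed
      hence "pi ^ 3 / 12 / u ^ 4 \<le> 4 / u ^ 4" using u by (intro divide_right_mono) auto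
      finally show "2 * pi * x \<le> (2 / u\<^sup>2)\<^sup>2" by (simp add: power_divide flip: power_mult)
    qed (use u in auto)
    moreover have "sqrt (2 * pi * x) > 0" using x60 by simp
    ultimately have "exp x / (2 / u\<^sup>2) \<le> B" unfolding B_def using u by (intro divide_left_mono) auto
    hence "u ^ 3 * (exp x / (2 / u\<^sup>2)) \<le> u ^ 3 * B" using u by (intro mult_left_mono) auto
    moreover have "u ^ 3 * (exp x / (2 / u\<^sup>2)) = exp x * (u ^ 5 / 2)" by (simp add: eval_nat_numeral)
    moreover have "1 / (32 * \<nu> ^ 5) \<le> u ^ 5"
    proof -
      have "(1/2) ^ 5 \<le> (\<nu> * u) ^ 5" using \<nu> by (intro power_mono) auto
      moreover have "(1/2 :: real) ^ 5 = 1 / 32" by (simp add: eval_nat_numeral)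
      ultimately have "1 / 32 \<le> \<nu> ^ 5 * u ^ 5" by (simp only: power_mult_distrib)
      thus ?thesis using \<nu> by (simp add: field_simps)
    qed
    hence "exp x * (1 / (32 * \<nu> ^ 5) / 2) \<le> exp x * (u ^ 5 / 2)" by (intro mult_left_mono divide_right_mono) auto
    moreover have "exp x * (1 / (32 * \<nu> ^ 5) / 2) = exp x / (64 * real n powr (5/8))" by (simp add: \<nu>(2))
    ultimately show ?thesis by linarith
  qed
  moreover have "exp x / real n powr (5/8) = 64 * (exp x / (64 * real n powr (5/8)))" by simp
  ultimately show ?thesis unfolding xw[symmetric] by linarith
qed

text \<open>The first exponential grows more slowly because \<pi>/4 + 12/(5 \<pi>) < \<pi>/2, that
  is \<pi>^2 > 48/5; the second has the same exponential but the powers of n are at most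
  n^(-7/8).\<close>

lemma error_fun_smallo:
  "error_fun \<in> o(\<lambda>n. exp (pi / 2 * sqrt (real n / 3)) / real n powr (5/8))"
proof -
  define c where "c = pi / 4 + 12 / (5 * pi)"
  define d where "d = pi / 2 - c"
  have d: "d > 0"
  proof -
    have "48/5 < pi\<^sup>2" using pi_sq_bounds by simp
    hence "12 / (5 * pi) < pi / 4" by (simp add: divide_less_eq power2_eq_square)
    thus ?thesis by (simp add: d_def c_def)
  qed
  have c: "c > 0" by (simp add: c_def add_pos_pos)
  have pc: "pi / 2 = c + d" by (simp add: d_def)
  have "(\<lambda>n. 21 * pi / 10 * exp (c * sqrt (real n / 3))
     + (4 / real n powr (7/8) + 5 / real n + 13 / (20 * real n powr (9/8))
        + 21291081 / real n powr (19/8) + 17716899 / real n powr (21/8))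
       * exp ((c + d) * sqrt (real n / 3))) \<in> o(\<lambda>n. exp ((c + d) * sqrt (real n / 3)) / real n powr (5/8))"
  proof (rule sum_in_smallo)
    have "(\<lambda>n. exp (c * sqrt (real n / 3)) / (exp ((c + d) * sqrt (real n / 3)) / real n powr (5/8))) = (\<lambda>n. real n powr (5/8) * exp (- d * sqrt (real n / 3)))"
      by (simp add: fun_eq_iff distrib_right exp_add exp_minus field_simps)
    moreover have "(\<lambda>n. real n powr (5/8) * exp (- d * sqrt (real n / 3))) \<longlonglongrightarrow> 0" using d by real_asymp
    ultimately have "(\<lambda>n. exp (c * sqrt (real n / 3))) \<in> o(\<lambda>n. exp ((c + d) * sqrt (real n / 3)) / real n powr (5/8))"
      by (intro smalloI_tendsto) (auto intro!: eventually_mono[OF eventually_gt_at_top[of 0]])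
    thus "(\<lambda>n. 21 * pi / 10 * exp (c * sqrt (real n / 3))) \<in> o(\<lambda>n. exp ((c + d) * sqrt (real n / 3)) / real n powr (5/8))"
      by simp
    have "(\<lambda>n. 4 / real n powr (7/8) + 5 / real n + 13 / (20 * real n powr (9/8))
        + 21291081 / real n powr (19/8) + 17716899 / real n powr (21/8)) \<in> o(\<lambda>n. 1 / real n powr (5/8))"
      by real_asymp
    from landau_o.small.mult_right[OF this, of "\<lambda>n. exp ((c + d) * sqrt (real n / 3))"]
    show "(\<lambda>n. (4 / real n powr (7/8) + 5 / real n + 13 / (20 * real n powr (9/8))
        + 21291081 / real n powr (19/8) + 17716899 / real n powr (21/8))
       * exp ((c + d) * sqrt (real n / 3))) \<in> o(\<lambda>n. exp ((c + d) * sqrt (real n / 3)) / real n powr (5/8))"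
      by simp
  qed
  thus ?thesis unfolding error_fun_def[abs_def] c_def[symmetric] pc .
qed

theorem theorem1p8:
  fixes a :: "nat \<Rightarrow> int"
  assumes "is_coeff_seq a"
  shows "((\<lambda>n. of_int (a n)) \<sim>[at_top] main_term) \<and>
         (\<forall>n>4800. \<bar>of_int (a n) - main_term n\<bar> \<le> error_fun n)"
proof
  show E: "\<forall>n>4800. \<bar>of_int (a n) - main_term n\<bar> \<le> error_fun n"
    using coeff_error[OF assms] by blast
  define g where "g = (\<lambda>n. exp (pi / 2 * sqrt (real n / 3)) / real n powr (5/8))"
  have "(\<lambda>n. of_int (a n) - main_term n) \<in> O(error_fun)"
    by (rule bigoI[of _ 1]) (use E in \<open>auto intro!: eventually_mono[OF eventually_gt_at_top[of 4800]] intro: order_trans[OF _ abs_ge_self]\<close>)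
  also have "error_fun \<in> o(g)" unfolding g_def by (rule error_fun_smallo)
  also have "g \<in> O(main_term)"
  proof (rule bigoI[of _ 128])
    show "\<forall>\<^sub>F n in sequentially. norm (g n) \<le> 128 * norm (main_term n)"
      using eventually_gt_at_top[of 4800]
    proof eventually_elim
      case (elim n)
      have "norm (g n) = g n" by (simp add: g_def)
      also have "\<dots> \<le> 128 * main_term n" unfolding g_def by (rule main_term_ge[OF elim])
      finally show ?case by (auto intro: order_trans)
    qed
  qed
  finally show "(\<lambda>n. of_int (a n)) \<sim>[at_top] main_term" by (rule smallo_imp_asymp_equiv)
qed

end
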